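(* Let $\mathbb{W}$ be a word algebra and let $\pi$ be an RRW derivation of $\vdash f:\mathbb{W}^{i_1}\times\dots\times\mathbb{W}^{i_n}\to\mathbb{W}^{i}$. Let $j_1,\dots,j_m$ be the indices $j\in\{1,\dots,n\}$ with $i<i_j$, and let $k_1,\dots,k_h$ be the indices $k$ with $i_k=i$. Let $x_1,\dots,x_n,x$ be pairwise distinct resource variables. Then there exist a QBAL proof $\langle\pi\rangle$ and a resource polynomial $q$ such that $$\langle\pi\rangle:\ \{x_{k_1}\le x,\dots,x_{k_h}\le x\};\ \mathbf{W}_{x_1},\dots,\mathbf{W}_{x_n}\vdash\mathbf{W}_{q(x_{j_1},\dots,x_{j_m})+x}$$ and $\psi\circ[\![\langle\pi\rangle]\!]\circ(\varphi\times\dots\times\varphi)=f$.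
   Context: Resource polynomials: finite sums of finite products $\prod_i\binom{x_i}{n_i}$ (pairwise distinct variables, $n_i\in\mathbb{N}$), read as functions of natural-number variables. A constraint is $p\le q$ for resource polynomials; $p<q$ abbreviates $p+1\le q$; a constraint set is a finite set of constraints. $\Phi\models c$: every assignment of naturals satisfying all of $\Phi$ satisfies $c$; $\Phi\models\Psi$: $\Phi\models c$ for all $c\in\Psi$; $p\sqsubseteq_\Phi q$: $\Phi\models p\le q$. QBAL formulas: $A::=\alpha(p_1,\dots,p_n)\mid A\otimes A\mid A\multimap A\mid\forall\alpha.A\mid\,!_{x<p}A\mid\forall(x_1,\dots,x_n){:}\Phi.A\mid\exists(x_1,\dots,x_n){:}\Phi.A$ ($\alpha$ atoms with fixed arities, $x\notin FV(p)$, and boundedness: for each quantifier formula there are resource polynomials $r_i$ not containing $\overline{x}$ with $\Phi\models\{x_i\le r_i\}_i$). $!_{x<p}$ binds $x$; quantifiers bind $\overline{x}$ in $\Phi$ and body; formulas up to renaming of bound variables; substitutions are capture-avoiding. Polarity: variables of $p_i$ positive in $\alpha(\overline{p})$; in $p\le q$, $p$ negative, $q$ positive; reversed in first argument of $\multimap$, in $p$ of $!_{x<p}$, in the constraint set of $\forall\overline{x}{:}\Phi$; preserved elsewhere. $A\{B/\alpha(x_1,\dots,x_n)\}$ (for $B$ in which $x_1..x_n$ occur only positively) replaces each free $\alpha(p_1,\dots,p_n)$ by $B\{\overline{p}/\overline{x}\}$. Order: $\alpha(\overline{p})\le_\Phi\alpha(\overline{q})$ iff $p_i\sqsubseteq_\Phi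 q_i$; $\otimes$ covariant in both; $A\multimap B\le_\Phi C\multimap D$ iff $C\le_\Phi A$, $B\le_\Phi D$; $\forall\alpha.A\le_\Phi\forall\alpha.B$ iff $A\le_\Phi B$; $!_{x<p}A\le_\Phi!_{x<q}B$ iff $q\sqsubseteq_\Phi p$, $x\notin FV(\Phi)$, $A\le_{\Phi\cup\{x<q\}}B$; $\forall\overline{x}{:}\Psi.A\le_\Phi\forall\overline{x}{:}\Theta.B$ iff $\Phi\cup\Theta\models\Psi$, $\overline{x}\notin FV(\Phi)$, $A\le_{\Phi\cup\Theta}B$; $\exists\overline{x}{:}\Psi.A\le_\Phi\exists\overline{x}{:}\Theta.B$ iff $\Phi\cup\Psi\models\Theta$, $\overline{x}\notin FV(\Phi)$, $A\le_{\Phi\cup\Psi}B$. QBAL judgements $\Phi;\Gamma\vdash A$ ($\Gamma$ a multiset of formulas) are derived by the rules: (A) $\Phi;A\vdash B$ if $A\le_\Phi B$. (U) from $\Phi;\Gamma\vdash A$ and $\Phi;\Delta,A\vdash B$ infer $\Phi;\Gamma,\Delta\vdash B$. (W) from $\Phi;\Gamma\vdash B$ infer $\Phi;\Gamma,A\vdash B$. (X) from $\Phi;\Gamma,!_{x<p}A,!_{y<q}A\{p+y/x\}\vdash B$ and $p+q\sqsubseteq_\Phi r$ infer $\Phi;\Gamma,!_{x<r}A\vdash B$. ($R_\multimap$) from $\Phi;\Gamma,A\vdash B$ infer $\Phi;\Gamma\vdash A\multimap B$. ($L_\multimap$) from $\Phi;\Gamma\vdash A$ and $\Phi;\Delta,B\vdash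 C$ infer $\Phi;\Gamma,\Delta,A\multimap B\vdash C$. ($R_\otimes$) from $\Phi;\Gamma\vdash A$ and $\Phi;\Delta\vdash B$ infer $\Phi;\Gamma,\Delta\vdash A\otimes B$. ($L_\otimes$) from $\Phi;\Gamma,A,B\vdash C$ infer $\Phi;\Gamma,A\otimes B\vdash C$. ($P_!$) from $\Phi;A_1,\dots,A_n\vdash B$, with $\Psi\cup\{x<p\}\models\Phi$, $x\notin FV(\Psi)$ and $p\sqsubseteq_\Psi q_i$ for all $i$, infer $\Psi;!_{x<q_1}A_1,\dots,!_{x<q_n}A_n\vdash\,!_{x<p}B$. ($D_!$) from $\Phi;A\{1/x\},\Gamma\vdash B$ and $1\sqsubseteq_\Phi p$ infer $\Phi;!_{x<p}A,\Gamma\vdash B$. ($N_!$) from $\Phi;!_{y<p}!_{z<q\{y/w\}}A\{(z+\sum_{w<y}q)/x\},\Gamma\vdash B$ and $\sum_{w<p}q\sqsubseteq_\Phi r$ infer $\Phi;!_{x<r}A,\Gamma\vdash B$. ($R_{\forall\alpha}$) from $\Phi;\Gamma\vdash A$, $\alpha$ not free in $\Gamma$, infer $\Phi;\Gamma\vdash\forall\alpha.A$. ($L_{\forall\alpha}$) from $\Phi;\Gamma,A\{B/\alpha(x_1,\dots,x_n)\}\vdash C$ infer $\Phi;\Gamma,\forall\alpha.A\vdash C$. ($R_{\forall x}$) from $\Phi\cup\Psi;\Gamma\vdash A$, $\overline{x}\notin FV(\Gamma)\cup FV(\Phi)$, infer $\Phi;\Gamma\vdash\forall\overline{x}{:}\Psi.A$.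 ($L_{\forall x}$) from $\Phi;\Gamma,A\{\overline{p}/\overline{x}\}\vdash C$ and $\Phi\models\Psi\{\overline{p}/\overline{x}\}$ infer $\Phi;\Gamma,\forall\overline{x}{:}\Psi.A\vdash C$. ($R_{\exists x}$) from $\Phi;\Gamma\vdash A\{\overline{p}/\overline{x}\}$ and $\Phi\models\Psi\{\overline{p}/\overline{x}\}$ infer $\Phi;\Gamma\vdash\exists\overline{x}{:}\Psi.A$. ($L_{\exists x}$) from $\Phi\cup\Psi;\Gamma,A\vdash C$, $\overline{x}\notin FV(\Gamma)\cup FV(C)\cup FV(\Phi)$, infer $\Phi;\Gamma,\exists\overline{x}{:}\Psi.A\vdash C$. Semantics: work in a constructive ambient set theory with a set $\mathcal{U}$ of sets containing $\mathbb{N}$ and $\mathbb{W}$, closed under binary products, function spaces and $\mathcal{U}$-indexed products. Erase formulas by $\alpha(\overline{p})\mapsto\alpha$, $\otimes\mapsto\wedge$, $\multimap\mapsto\to$, $\forall\alpha\mapsto\forall\alpha$, $!_{x<p}A,\forall\overline{x}{:}\Phi.A,\exists\overline{x}{:}\Phi.A\mapsto$ erasure of $A$; interpret by $[\![\alpha]\!]=\rho(\alpha)$, $\wedge$ as product, $\to$ as function space, $[\![\forall\alpha.A]\!]=\prod_{C\in\mathcal{U}}[\![A]\!]_{\rho[\alpha\mapsto C]}$. A QBAL proof of $\Phi;A_1,\dots,A_n\vdash B$ denotes a function $[\![A_1]\!]\times\dots\times[\![A_n]\!]\to[\![B]\!]$ given by the standard set-theoretic semantics of its erased second-order intuitionistic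 proof (rules $P_!,D_!,N_!$ and first-order quantifier rules act as identities, X as diagonal, axiom identity, cut composition, weakening projection, other rules as usual). Word algebras: $\mathbb{W}$ is the free algebra generated by one constant $0_{\mathbb{W}}$ and unary constructors $c^1,\dots,c^w$. $\mathbf{W}_p$ is the QBAL formula $\forall\alpha.\,!_{y<p}(\alpha(y)\multimap\alpha(y+1))\multimap\cdots\multimap\,!_{y<p}(\alpha(y)\multimap\alpha(y+1))\multimap\alpha(0)\multimap\alpha(p)$ with $w$ copies of $!_{y<p}(\alpha(y)\multimap\alpha(y+1))$, $\alpha$ unary, $y$ fresh; its meaning is $\prod_{C\in\mathcal{U}}(C\Rightarrow C)\Rightarrow\dots\Rightarrow(C\Rightarrow C)\Rightarrow C\Rightarrow C$. $\varphi:\mathbb{W}\to[\![\mathbf{W}_p]\!]$: $\varphi(t)_C(f_1,\dots,f_w,z)=$ value of $t$ with $0_{\mathbb{W}}$ read as $z$ and $c^i$ as $f_i$; $\psi(u)=u_{\mathbb{W}}(c^1,\dots,c^w,0_{\mathbb{W}})$. RRW (ramified recurrence on words): functions on $\mathbb{W}$ built by composition $\mathrm{comp}(g,f_1,\dots,f_n)(\overline{t})=g(f_1(\overline{t}),\dots,f_n(\overline{t}))$; primitive recursion $g=\mathrm{rec}(f_{c^1},\dots,f_{c^w},f_0)$ with $g(\overline{t},0_{\mathbb{W}})=f_0(\overline{t})$, $g(\overline{t},c^k(t))=f_{c^k}(\overline{t},g(\overline{t},t),t)$; conditional $g=\mathrm{cond}(f_{c^1},\dots,f_{c^w},f_0)$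 with $g(\overline{t},0_{\mathbb{W}})=f_0(\overline{t})$, $g(\overline{t},c^k(t))=f_{c^k}(\overline{t},t)$. Derivable judgements $\vdash f:\mathbb{W}^{i_1}\times\dots\times\mathbb{W}^{i_n}\to\mathbb{W}^{i}$ (tiers $i_1,\dots,i_n,i\in\mathbb{N}$): $\vdash\mathrm{id}:\mathbb{W}^i\to\mathbb{W}^i$; $\vdash0_{\mathbb{W}}:\mathbb{W}^i$; $\vdash c^k:\mathbb{W}^i\to\mathbb{W}^i$; $\vdash\pi^m_l:\mathbb{W}^{j_1}\times\dots\times\mathbb{W}^{j_m}\to\mathbb{W}^j$ when $j_l=j$ ($l$-th projection); if $\vdash g:\mathbb{W}^{i_1}\times\dots\times\mathbb{W}^{i_n}\to\mathbb{W}^i$ and $\vdash f_k:\mathbb{W}^{j_1}\times\dots\times\mathbb{W}^{j_m}\to\mathbb{W}^{i_k}$ for $k=1,\dots,n$ then $\vdash\mathrm{comp}(g,f_1,\dots,f_n):\mathbb{W}^{j_1}\times\dots\times\mathbb{W}^{j_m}\to\mathbb{W}^i$; if $\vdash f_{c^k}:\mathbb{W}^{i_1}\times\dots\times\mathbb{W}^{i_n}\times\mathbb{W}^i\times\mathbb{W}^j\to\mathbb{W}^i$ for all $k$, $\vdash f_0:\mathbb{W}^{i_1}\times\dots\times\mathbb{W}^{i_n}\to\mathbb{W}^i$ and $i<j$, then $\vdash\mathrm{rec}(f_{c^1},\dots,f_{c^w},f_0):\mathbb{W}^{i_1}\times\dots\times\mathbb{W}^{i_n}\times\mathbb{W}^j\to\mathbb{W}^i$;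 if $\vdash f_{c^k}:\mathbb{W}^{i_1}\times\dots\times\mathbb{W}^{i_n}\times\mathbb{W}^j\to\mathbb{W}^i$ for all $k$ and $\vdash f_0:\mathbb{W}^{i_1}\times\dots\times\mathbb{W}^{i_n}\to\mathbb{W}^i$, then $\vdash\mathrm{cond}(f_{c^1},\dots,f_{c^w},f_0):\mathbb{W}^{i_1}\times\dots\times\mathbb{W}^{i_n}\times\mathbb{W}^j\to\mathbb{W}^i$. *)

theory Defs
  imports Main
begin

section \<open>Resource polynomials and constraints\<close>

text \<open>
  Resource polynomials are read as functions of natural-number variables, so a polynomial is the
  function it denotes on assignments. Variables are natural numbers; underneath resource binders
  they are de Bruijn indices (the innermost bound variables come first), which takes care of
  renaming and of capture.
\<close>

type_synonym rpoly = "(nat \<Rightarrow> nat) \<Rightarrow> nat"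
type_synonym rsubst = "nat \<Rightarrow> rpoly"
type_synonym constr = "rpoly \<times> rpoly"  \<comment> \<open>\<open>(p, q)\<close> is the constraint \<open>p \<le> q\<close>\<close>

definition respoly :: "rpoly \<Rightarrow> bool" where
  "respoly p \<longleftrightarrow> (\<exists>ms :: (nat \<times> nat) list list.
     (\<forall>m\<in>set ms. distinct (map fst m)) \<and>
     p = (\<lambda>e. \<Sum>m\<leftarrow>ms. \<Prod>(x, n)\<leftarrow>m. e x choose n))"

text \<open>
  For a sum of products of binomials, the function depends on \<open>x\<close> iff some binomial
  \<open>x choose n\<close> with \<open>n > 0\<close> occurs, so this is the set of variables of the polynomial.
\<close>

definition fvp :: "rpoly \<Rightarrow> nat set" where
  "fvp p = {x. \<exists>e n. p (e(x := n)) \<noteq> p e}"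

definition rvar :: "nat \<Rightarrow> rpoly" where
  "rvar i = (\<lambda>e. e i)"

definition psub :: "rsubst \<Rightarrow> rpoly \<Rightarrow> rpoly" where
  "psub \<sigma> p = (\<lambda>e. p (\<lambda>i. \<sigma> i e))"

text \<open>Weakening by \<open>n\<close> fresh innermost variables.\<close>

definition wk :: "nat \<Rightarrow> rsubst" where
  "wk n = (\<lambda>i. rvar (i + n))"

text \<open>A substitution pushed under a binder of \<open>n\<close> variables.\<close>

definition lift :: "nat \<Rightarrow> rsubst \<Rightarrow> rsubst" where
  "lift n \<sigma> = (\<lambda>i. if i < n then rvar i else psub (wk n) (\<sigma> (i - n)))"

text \<open>Replaces the \<open>length ps\<close> innermost variables by \<open>ps\<close>.\<close>

definition instr :: "rpoly list \<Rightarrow> rsubst" where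
  "instr ps = (\<lambda>i. if i < length ps then ps ! i else rvar (i - length ps))"

definition csub :: "rsubst \<Rightarrow> constr set \<Rightarrow> constr set" where
  "csub \<sigma> \<Phi> = map_prod (psub \<sigma>) (psub \<sigma>) ` \<Phi>"

definition entails :: "constr set \<Rightarrow> constr \<Rightarrow> bool" (infix "\<Turnstile>" 50) where
  "\<Phi> \<Turnstile> c \<longleftrightarrow> (\<forall>e. (\<forall>(p, q)\<in>\<Phi>. p e \<le> q e) \<longrightarrow> fst c e \<le> snd c e)"

definition entails_all :: "constr set \<Rightarrow> constr set \<Rightarrow> bool" (infix "\<Turnstile>s" 50) where
  "\<Phi> \<Turnstile>s \<Psi> \<longleftrightarrow> (\<forall>c\<in>\<Psi>. \<Phi> \<Turnstile> c)"

definition cless :: "rpoly \<Rightarrow> rpoly \<Rightarrow> constr" where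
  "cless p q = ((\<lambda>e. p e + 1), q)"

definition wf_constrs :: "constr set \<Rightarrow> bool" where
  "wf_constrs \<Phi> \<longleftrightarrow> finite \<Phi> \<and> (\<forall>(p, q)\<in>\<Phi>. respoly p \<and> respoly q)"

section \<open>Formulas\<close>

text \<open>
  \<open>Atom i ps\<close> is the atom number \<open>i\<close> among the atoms of arity \<open>length ps\<close>. Atoms are de Bruijn
  indices as well, counted separately for each arity: \<open>AllA k A\<close> binds the atom number \<open>0\<close> of
  arity \<open>k\<close> in \<open>A\<close>. \<open>Bang p A\<close> binds one resource variable in \<open>A\<close> (not in \<open>p\<close>); \<open>AllR n \<Phi> A\<close>
  and \<open>ExR n \<Phi> A\<close> bind \<open>n\<close> resource variables in \<open>\<Phi>\<close> and \<open>A\<close>.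
\<close>

datatype form =
    Atom nat "rpoly list"
  | Tensor form form
  | Lolli form form
  | AllA nat form
  | Bang rpoly form
  | AllR nat "constr set" form
  | ExR nat "constr set" form

definition bounded_vars :: "nat \<Rightarrow> constr set \<Rightarrow> bool" where
  "bounded_vars n \<Phi> \<longleftrightarrow> (\<forall>i<n. \<exists>r. respoly r \<and> \<Phi> \<Turnstile> (rvar i, psub (wk n) r))"

primrec wf_form :: "form \<Rightarrow> bool" where
  "wf_form (Atom i ps) \<longleftrightarrow> (\<forall>p\<in>set ps. respoly p)"
| "wf_form (Tensor A B) \<longleftrightarrow> wf_form A \<and> wf_form B"
| "wf_form (Lolli A B) \<longleftrightarrow> wf_form A \<and> wf_form B"
| "wf_form (AllA k A) \<longleftrightarrow> wf_form A"
| "wf_form (Bang p A) \<longleftrightarrow> respoly p \<and> wf_form A"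
| "wf_form (AllR n \<Phi> A) \<longleftrightarrow> wf_constrs \<Phi> \<and> bounded_vars n \<Phi> \<and> wf_form A"
| "wf_form (ExR n \<Phi> A) \<longleftrightarrow> wf_constrs \<Phi> \<and> bounded_vars n \<Phi> \<and> wf_form A"

primrec fsub :: "rsubst \<Rightarrow> form \<Rightarrow> form" where
  "fsub \<sigma> (Atom i ps) = Atom i (map (psub \<sigma>) ps)"
| "fsub \<sigma> (Tensor A B) = Tensor (fsub \<sigma> A) (fsub \<sigma> B)"
| "fsub \<sigma> (Lolli A B) = Lolli (fsub \<sigma> A) (fsub \<sigma> B)"
| "fsub \<sigma> (AllA k A) = AllA k (fsub \<sigma> A)"
| "fsub \<sigma> (Bang p A) = Bang (psub \<sigma> p) (fsub (lift 1 \<sigma>) A)"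
| "fsub \<sigma> (AllR n \<Phi> A) = AllR n (csub (lift n \<sigma>) \<Phi>) (fsub (lift n \<sigma>) A)"
| "fsub \<sigma> (ExR n \<Phi> A) = ExR n (csub (lift n \<sigma>) \<Phi>) (fsub (lift n \<sigma>) A)"

text \<open>\<open>ashift k c A\<close>: the atoms of arity \<open>k\<close> with number at least \<open>c\<close> move up by one.\<close>

primrec ashift :: "nat \<Rightarrow> nat \<Rightarrow> form \<Rightarrow> form" where
  "ashift k c (Atom i ps) = Atom (if length ps = k \<and> c \<le> i then Suc i else i) ps"
| "ashift k c (Tensor A B) = Tensor (ashift k c A) (ashift k c B)"
| "ashift k c (Lolli A B) = Lolli (ashift k c A) (ashift k c B)"
| "ashift k c (AllA k' A) = AllA k' (ashift k (if k' = k then Suc c else c) A)"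
| "ashift k c (Bang p A) = Bang p (ashift k c A)"
| "ashift k c (AllR n \<Phi> A) = AllR n \<Phi> (ashift k c A)"
| "ashift k c (ExR n \<Phi> A) = ExR n \<Phi> (ashift k c A)"

text \<open>
  \<open>asub k c A B\<close> is \<open>A{B/\<alpha>(x\<^sub>1,\<dots>,x\<^sub>k)}\<close> where \<open>\<alpha>\<close> is the atom number \<open>c\<close> of arity \<open>k\<close> and
  \<open>x\<^sub>1,\<dots>,x\<^sub>k\<close> are the resource variables \<open>0,\<dots>,k-1\<close> of \<open>B\<close>; the variables \<open>k, k+1, \<dots>\<close> of \<open>B\<close>
  are the variables \<open>0, 1, \<dots>\<close> of \<open>A\<close>. The atom \<open>\<alpha>\<close> disappears, so those above it move down.
\<close>

primrec asub :: "nat \<Rightarrow> nat \<Rightarrow> form \<Rightarrow> form \<Rightarrow> form" where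
  "asub k c (Atom i ps) B =
     (if length ps = k \<and> i = c then fsub (instr ps) B
      else if length ps = k \<and> c < i then Atom (i - 1) ps
      else Atom i ps)"
| "asub k c (Tensor A A') B = Tensor (asub k c A B) (asub k c A' B)"
| "asub k c (Lolli A A') B = Lolli (asub k c A B) (asub k c A' B)"
| "asub k c (AllA k' A) B = AllA k' (asub k (if k' = k then Suc c else c) A (ashift k' 0 B))"
| "asub k c (Bang p A) B = Bang p (asub k c A (fsub (lift k (wk 1)) B))"
| "asub k c (AllR n \<Phi> A) B = AllR n \<Phi> (asub k c A (fsub (lift k (wk n)) B))"
| "asub k c (ExR n \<Phi> A) B = ExR n \<Phi> (asub k c A (fsub (lift k (wk n)) B))"

text \<open>\<open>occ True x A\<close> and \<open>occ False x A\<close>: \<open>x\<close> occurs positively, respectively negatively, in \<open>A\<close>.\<close>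

definition cocc :: "bool \<Rightarrow> nat \<Rightarrow> constr set \<Rightarrow> bool" where
  "cocc s x \<Phi> \<longleftrightarrow> (\<exists>(p, q)\<in>\<Phi>. x \<in> fvp (if s then q else p))"

primrec occ :: "bool \<Rightarrow> nat \<Rightarrow> form \<Rightarrow> bool" where
  "occ s x (Atom i ps) \<longleftrightarrow> s \<and> (\<exists>p\<in>set ps. x \<in> fvp p)"
| "occ s x (Tensor A B) \<longleftrightarrow> occ s x A \<or> occ s x B"
| "occ s x (Lolli A B) \<longleftrightarrow> occ (\<not> s) x A \<or> occ s x B"
| "occ s x (AllA k A) \<longleftrightarrow> occ s x A"
| "occ s x (Bang p A) \<longleftrightarrow> (\<not> s \<and> x \<in> fvp p) \<or> occ s (x + 1) A"
| "occ s x (AllR n \<Phi> A) \<longleftrightarrow> cocc (\<not> s) (x + n) \<Phi> \<or> occ s (x + n) A"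
| "occ s x (ExR n \<Phi> A) \<longleftrightarrow> cocc s (x + n) \<Phi> \<or> occ s (x + n) A"

inductive le_form :: "constr set \<Rightarrow> form \<Rightarrow> form \<Rightarrow> bool" where
  le_Atom: "list_all2 (\<lambda>p q. \<Phi> \<Turnstile> (p, q)) ps qs \<Longrightarrow> le_form \<Phi> (Atom i ps) (Atom i qs)"
| le_Tensor: "le_form \<Phi> A C \<Longrightarrow> le_form \<Phi> B D \<Longrightarrow> le_form \<Phi> (Tensor A B) (Tensor C D)"
| le_Lolli: "le_form \<Phi> C A \<Longrightarrow> le_form \<Phi> B D \<Longrightarrow> le_form \<Phi> (Lolli A B) (Lolli C D)"
| le_AllA: "le_form \<Phi> A B \<Longrightarrow> le_form \<Phi> (AllA k A) (AllA k B)"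
| le_Bang: "\<Phi> \<Turnstile> (q, p) \<Longrightarrow>
    le_form (csub (wk 1) \<Phi> \<union> {cless (rvar 0) (psub (wk 1) q)}) A B \<Longrightarrow>
    le_form \<Phi> (Bang p A) (Bang q B)"
| le_AllR: "csub (wk n) \<Phi> \<union> \<Theta> \<Turnstile>s \<Psi> \<Longrightarrow> le_form (csub (wk n) \<Phi> \<union> \<Theta>) A B \<Longrightarrow>
    le_form \<Phi> (AllR n \<Psi> A) (AllR n \<Theta> B)"
| le_ExR: "csub (wk n) \<Phi> \<union> \<Psi> \<Turnstile>s \<Theta> \<Longrightarrow> le_form (csub (wk n) \<Phi> \<union> \<Psi>) A B \<Longrightarrow>
    le_form \<Phi> (ExR n \<Psi> A) (ExR n \<Theta> B)"

section \<open>Erased formulas and second-order intuitionistic proofs\<close>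

datatype ftype = TAtom nat nat | TProd ftype ftype | TFun ftype ftype | TAll nat ftype

primrec erase :: "form \<Rightarrow> ftype" where
  "erase (Atom i ps) = TAtom (length ps) i"
| "erase (Tensor A B) = TProd (erase A) (erase B)"
| "erase (Lolli A B) = TFun (erase A) (erase B)"
| "erase (AllA k A) = TAll k (erase A)"
| "erase (Bang p A) = erase A"
| "erase (AllR n \<Phi> A) = erase A"
| "erase (ExR n \<Phi> A) = erase A"

primrec tshift :: "nat \<Rightarrow> nat \<Rightarrow> ftype \<Rightarrow> ftype" where
  "tshift k c (TAtom l i) = TAtom l (if l = k \<and> c \<le> i then Suc i else i)"
| "tshift k c (TProd T S) = TProd (tshift k c T) (tshift k c S)"
| "tshift k c (TFun T S) = TFun (tshift k c T) (tshift k c S)"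
| "tshift k c (TAll l T) = TAll l (tshift k (if l = k then Suc c else c) T)"

primrec tsub :: "nat \<Rightarrow> nat \<Rightarrow> ftype \<Rightarrow> ftype \<Rightarrow> ftype" where
  "tsub k c (TAtom l i) S =
     (if l = k \<and> i = c then S else if l = k \<and> c < i then TAtom l (i - 1) else TAtom l i)"
| "tsub k c (TProd T T') S = TProd (tsub k c T S) (tsub k c T' S)"
| "tsub k c (TFun T T') S = TFun (tsub k c T S) (tsub k c T' S)"
| "tsub k c (TAll l T) S = TAll l (tsub k (if l = k then Suc c else c) T (tshift l 0 S))"

text \<open>
  Sequent proofs. Contexts are lists, and the multiset of hypotheses is obtained through the
  exchange rule \<open>PExch\<close>: this says which argument of the denoted function belongs to which
  hypothesis. Number arguments are context lengths telling where contexts are split; formula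
  arguments are the components of the principal formula (for \<open>PAllL k T S\<close>, the quantified
  body \<open>T\<close> and the instance \<open>S\<close>).
\<close>

datatype iproof =
    PAx
  | PExch nat iproof
  | PCut nat iproof iproof
  | PWeak iproof
  | PContr iproof
  | PFunR ftype ftype iproof
  | PFunL ftype ftype nat iproof iproof
  | PProdR ftype ftype nat iproof iproof
  | PProdL ftype ftype iproof
  | PAllR nat ftype iproof
  | PAllL nat ftype ftype iproof

inductive iproves :: "ftype list \<Rightarrow> ftype \<Rightarrow> iproof \<Rightarrow> bool" where
  i_Ax: "iproves [T] T PAx"
| i_Exch: "iproves (G @ T # S # D) R \<pi> \<Longrightarrow> iproves (G @ S # T # D) R (PExch (length G) \<pi>)"
| i_Cut: "iproves G T \<pi> \<Longrightarrow> iproves (D @ [T]) S \<pi>' \<Longrightarrow> iproves (G @ D) S (PCut (length G) \<pi> \<pi>')"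
| i_Weak: "iproves G S \<pi> \<Longrightarrow> iproves (G @ [T]) S (PWeak \<pi>)"
| i_Contr: "iproves (G @ [T, T]) S \<pi> \<Longrightarrow> iproves (G @ [T]) S (PContr \<pi>)"
| i_FunR: "iproves (G @ [T]) S \<pi> \<Longrightarrow> iproves G (TFun T S) (PFunR T S \<pi>)"
| i_FunL: "iproves G T \<pi> \<Longrightarrow> iproves (D @ [S]) R \<pi>' \<Longrightarrow>
    iproves (G @ D @ [TFun T S]) R (PFunL T S (length G) \<pi> \<pi>')"
| i_ProdR: "iproves G T \<pi> \<Longrightarrow> iproves D S \<pi>' \<Longrightarrow>
    iproves (G @ D) (TProd T S) (PProdR T S (length G) \<pi> \<pi>')"
| i_ProdL: "iproves (G @ [T, S]) R \<pi> \<Longrightarrow> iproves (G @ [TProd T S]) R (PProdL T S \<pi>)"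
| i_AllR: "iproves (map (tshift k 0) G) T \<pi> \<Longrightarrow> iproves G (TAll k T) (PAllR k T \<pi>)"
| i_AllL: "iproves (G @ [tsub k 0 T S]) R \<pi> \<Longrightarrow> iproves (G @ [TAll k T]) R (PAllL k T S \<pi>)"

section \<open>QBAL proofs\<close>

definition wf_seq :: "constr set \<Rightarrow> form list \<Rightarrow> form \<Rightarrow> bool" where
  "wf_seq \<Phi> \<Gamma> A \<longleftrightarrow> wf_constrs \<Phi> \<and> (\<forall>B\<in>set \<Gamma>. wf_form B) \<and> wf_form A"

text \<open>
  \<open>qbal \<Phi> \<Gamma> A \<pi>\<close>: there is a QBAL proof of \<open>\<Phi>; \<Gamma> \<turnstile> A\<close> whose erasure is the second-order
  intuitionistic proof \<open>\<pi>\<close>. In \<open>q_PBang\<close>, \<open>q_AllR\<close> and \<open>q_ExL\<close> the premise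
  lives in the context extended by the bound variables, and \<open>x \<notin> FV(\<dots>)\<close> becomes
  weakening by \<open>wk\<close>. In \<open>q_NBang\<close>, \<open>q\<close> has the variable \<open>w\<close> as its variable \<open>0\<close>,
  so that \<open>q\<close> is also \<open>q{y/w}\<close> under the binder of \<open>y\<close>; the formula substituted into is under the
  binders of \<open>y\<close> (variable \<open>1\<close>) and \<open>z\<close> (variable \<open>0\<close>).
\<close>

inductive qbal :: "constr set \<Rightarrow> form list \<Rightarrow> form \<Rightarrow> iproof \<Rightarrow> bool" where
  q_Ax: "wf_seq \<Phi> [A] B \<Longrightarrow> le_form \<Phi> A B \<Longrightarrow> qbal \<Phi> [A] B PAx"
| q_Exch: "qbal \<Phi> (\<Gamma> @ A # B # \<Delta>) C \<pi> \<Longrightarrow> qbal \<Phi> (\<Gamma> @ B # A # \<Delta>) C (PExch (length \<Gamma>) \<pi>)"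
| q_Cut: "qbal \<Phi> \<Gamma> A \<pi> \<Longrightarrow> qbal \<Phi> (\<Delta> @ [A]) B \<pi>' \<Longrightarrow> qbal \<Phi> (\<Gamma> @ \<Delta>) B (PCut (length \<Gamma>) \<pi> \<pi>')"
| q_Weak: "wf_form A \<Longrightarrow> qbal \<Phi> \<Gamma> B \<pi> \<Longrightarrow> qbal \<Phi> (\<Gamma> @ [A]) B (PWeak \<pi>)"
| q_Contr: "wf_seq \<Phi> (\<Gamma> @ [Bang r A]) B \<Longrightarrow>
    qbal \<Phi> (\<Gamma> @ [Bang p A,
       Bang q (fsub (\<lambda>i. if i = 0 then (\<lambda>e. psub (wk 1) p e + e 0) else rvar i) A)]) B \<pi> \<Longrightarrow>
    \<Phi> \<Turnstile> ((\<lambda>e. p e + q e), r) \<Longrightarrow>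
    qbal \<Phi> (\<Gamma> @ [Bang r A]) B (PContr \<pi>)"
| q_LolliR: "qbal \<Phi> (\<Gamma> @ [A]) B \<pi> \<Longrightarrow> qbal \<Phi> \<Gamma> (Lolli A B) (PFunR (erase A) (erase B) \<pi>)"
| q_LolliL: "qbal \<Phi> \<Gamma> A \<pi> \<Longrightarrow> qbal \<Phi> (\<Delta> @ [B]) C \<pi>' \<Longrightarrow>
    qbal \<Phi> (\<Gamma> @ \<Delta> @ [Lolli A B]) C (PFunL (erase A) (erase B) (length \<Gamma>) \<pi> \<pi>')"
| q_TensorR: "qbal \<Phi> \<Gamma> A \<pi> \<Longrightarrow> qbal \<Phi> \<Delta> B \<pi>' \<Longrightarrow>
    qbal \<Phi> (\<Gamma> @ \<Delta>) (Tensor A B) (PProdR (erase A) (erase B) (length \<Gamma>) \<pi> \<pi>')"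
| q_TensorL: "qbal \<Phi> (\<Gamma> @ [A, B]) C \<pi> \<Longrightarrow>
    qbal \<Phi> (\<Gamma> @ [Tensor A B]) C (PProdL (erase A) (erase B) \<pi>)"
| q_PBang: "wf_seq \<Psi> (map2 Bang qs As) (Bang p B) \<Longrightarrow> length qs = length As \<Longrightarrow>
    qbal \<Phi> As B \<pi> \<Longrightarrow>
    csub (wk 1) \<Psi> \<union> {cless (rvar 0) (psub (wk 1) p)} \<Turnstile>s \<Phi> \<Longrightarrow>
    (\<And>q. q \<in> set qs \<Longrightarrow> \<Psi> \<Turnstile> (p, q)) \<Longrightarrow>
    qbal \<Psi> (map2 Bang qs As) (Bang p B) \<pi>"
| q_DBang: "wf_seq \<Phi> (\<Gamma> @ [Bang p A]) B \<Longrightarrow>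
    qbal \<Phi> (\<Gamma> @ [fsub (instr [\<lambda>e. 1]) A]) B \<pi> \<Longrightarrow>
    \<Phi> \<Turnstile> ((\<lambda>e. 1), p) \<Longrightarrow>
    qbal \<Phi> (\<Gamma> @ [Bang p A]) B \<pi>"
| q_NBang: "wf_seq \<Phi> (\<Gamma> @ [Bang r A]) B \<Longrightarrow>
    qbal \<Phi> (\<Gamma> @ [Bang p (Bang q
      (fsub (\<lambda>i. if i = 0 then (\<lambda>e. e 0 + (\<Sum>w<e 1. q (case_nat w (\<lambda>j. e (j + 2)))))
                 else rvar (i + 1)) A))]) B \<pi> \<Longrightarrow>
    \<Phi> \<Turnstile> ((\<lambda>e. \<Sum>w<p e. q (case_nat w e)), r) \<Longrightarrow>
    qbal \<Phi> (\<Gamma> @ [Bang r A]) B \<pi>"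
| q_AllAR: "qbal \<Phi> (map (ashift k 0) \<Gamma>) A \<pi> \<Longrightarrow> qbal \<Phi> \<Gamma> (AllA k A) (PAllR k (erase A) \<pi>)"
| q_AllAL: "wf_seq \<Phi> (\<Gamma> @ [AllA k A]) C \<Longrightarrow>
    wf_form B \<Longrightarrow> (\<And>i. i < k \<Longrightarrow> \<not> occ False i B) \<Longrightarrow>
    qbal \<Phi> (\<Gamma> @ [asub k 0 A B]) C \<pi> \<Longrightarrow>
    qbal \<Phi> (\<Gamma> @ [AllA k A]) C (PAllL k (erase A) (erase B) \<pi>)"
| q_AllR: "wf_seq \<Phi> \<Gamma> (AllR n \<Psi> A) \<Longrightarrow>
    qbal (csub (wk n) \<Phi> \<union> \<Psi>) (map (fsub (wk n)) \<Gamma>) A \<pi> \<Longrightarrow>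
    qbal \<Phi> \<Gamma> (AllR n \<Psi> A) \<pi>"
| q_AllL: "wf_seq \<Phi> (\<Gamma> @ [AllR n \<Psi> A]) C \<Longrightarrow>
    length ps = n \<Longrightarrow> (\<And>p. p \<in> set ps \<Longrightarrow> respoly p) \<Longrightarrow>
    qbal \<Phi> (\<Gamma> @ [fsub (instr ps) A]) C \<pi> \<Longrightarrow>
    \<Phi> \<Turnstile>s csub (instr ps) \<Psi> \<Longrightarrow>
    qbal \<Phi> (\<Gamma> @ [AllR n \<Psi> A]) C \<pi>"
| q_ExR: "wf_seq \<Phi> \<Gamma> (ExR n \<Psi> A) \<Longrightarrow>
    length ps = n \<Longrightarrow> (\<And>p. p \<in> set ps \<Longrightarrow> respoly p) \<Longrightarrow>
    qbal \<Phi> \<Gamma> (fsub (instr ps) A) \<pi> \<Longrightarrow>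
    \<Phi> \<Turnstile>s csub (instr ps) \<Psi> \<Longrightarrow>
    qbal \<Phi> \<Gamma> (ExR n \<Psi> A) \<pi>"
| q_ExL: "wf_seq \<Phi> (\<Gamma> @ [ExR n \<Psi> A]) C \<Longrightarrow>
    qbal (csub (wk n) \<Phi> \<union> \<Psi>) (map (fsub (wk n)) \<Gamma> @ [A]) (fsub (wk n) C) \<pi> \<Longrightarrow>
    qbal \<Phi> (\<Gamma> @ [ExR n \<Psi> A]) C \<pi>"

section \<open>Word algebras and ramified recurrence\<close>

text \<open>Constructors \<open>c\<^sup>1,\<dots>,c\<^sup>w\<close> are numbered \<open>0,\<dots>,w-1\<close>.\<close>

datatype word = Wzero | Wcon nat word

inductive_set words :: "nat \<Rightarrow> word set" for w :: nat where
  "Wzero \<in> words w"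
| "k < w \<Longrightarrow> t \<in> words w \<Longrightarrow> Wcon k t \<in> words w"

primrec wrec :: "(nat \<Rightarrow> word list \<Rightarrow> word) \<Rightarrow> (word list \<Rightarrow> word) \<Rightarrow> word list \<Rightarrow> word \<Rightarrow> word" where
  "wrec fc f0 ts Wzero = f0 ts"
| "wrec fc f0 ts (Wcon k t) = fc k (ts @ [wrec fc f0 ts t, t])"

primrec wcond :: "(nat \<Rightarrow> word list \<Rightarrow> word) \<Rightarrow> (word list \<Rightarrow> word) \<Rightarrow> word list \<Rightarrow> word \<Rightarrow> word" where
  "wcond fc f0 ts Wzero = f0 ts"
| "wcond fc f0 ts (Wcon k t) = fc k (ts @ [t])"

text \<open>
  \<open>rrw w f is i\<close>: \<open>\<turnstile> f : W\<^sup>i\<^sup>1 \<times> \<dots> \<times> W\<^sup>i\<^sup>n \<rightarrow> W\<^sup>i\<close>. An \<open>n\<close>-ary function takes the list of its arguments;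
  its values elsewhere are irrelevant.
\<close>

inductive rrw :: "nat \<Rightarrow> (word list \<Rightarrow> word) \<Rightarrow> nat list \<Rightarrow> nat \<Rightarrow> bool" for w :: nat where
  rrw_id: "rrw w (\<lambda>ts. hd ts) [i] i"
| rrw_zero: "rrw w (\<lambda>ts. Wzero) [] i"
| rrw_con: "k < w \<Longrightarrow> rrw w (\<lambda>ts. Wcon k (hd ts)) [i] i"
| rrw_proj: "l < length js \<Longrightarrow> js ! l = j \<Longrightarrow> rrw w (\<lambda>ts. ts ! l) js j"
| rrw_comp: "rrw w g is' i \<Longrightarrow> length fs = length is' \<Longrightarrow>
    (\<And>k. k < length is' \<Longrightarrow> rrw w (fs ! k) js (is' ! k)) \<Longrightarrow>
    rrw w (\<lambda>ts. g (map (\<lambda>f. f ts) fs)) js i"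
| rrw_rec: "(\<And>k. k < w \<Longrightarrow> rrw w (fc k) (is' @ [i, j]) i) \<Longrightarrow> rrw w f0 is' i \<Longrightarrow> i < j \<Longrightarrow>
    rrw w (\<lambda>ts. wrec fc f0 (butlast ts) (last ts)) (is' @ [j]) i"
| rrw_cond: "(\<And>k. k < w \<Longrightarrow> rrw w (fc k) (is' @ [j]) i) \<Longrightarrow> rrw w f0 is' i \<Longrightarrow>
    rrw w (\<lambda>ts. wcond fc f0 (butlast ts) (last ts)) (is' @ [j]) i"

text \<open>The formula \<open>W\<^sub>p\<close>.\<close>

definition Wform :: "nat \<Rightarrow> rpoly \<Rightarrow> form" where
  "Wform w p = AllA 1
     (foldr Lolli (replicate w (Bang p (Lolli (Atom 0 [rvar 0]) (Atom 0 [\<lambda>e. e 0 + 1]))))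
       (Lolli (Atom 0 [\<lambda>e. 0]) (Atom 0 [p])))"

section \<open>Semantics\<close>

text \<open>
  In classical logic there is no nontrivial family of sets closed under full function
  spaces and products indexed by the family itself, so the ambient constructive set theory cannot be
  identified with HOL. It enters through what it provides: a universe (the type \<open>'u\<close>, with
  \<open>el C\<close> the set of elements of \<open>C\<close>), whose function spaces and products consist of those functions
  that exist in the ambient theory. \<open>fam\<close> collects the families \<open>'u \<Rightarrow> 'u\<close> of the ambient theory.
  Operations carry the sets they operate on, e.g. \<open>app A B f a\<close> for \<open>f\<close> in the function
  space \<open>fn A B\<close>; \<open>inst F u C\<close> is the component at \<open>C\<close> of an element \<open>u\<close> of the product \<open>pi F\<close>.
\<close>

record ('u, 'v) ambient =
  el :: "'u \<Rightarrow> 'v set"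
  natset :: 'u
  natv :: "nat \<Rightarrow> 'v"
  sucv :: 'v
  wordset :: 'u
  wordv :: "word \<Rightarrow> 'v"
  conv :: "nat \<Rightarrow> 'v"
  prd :: "'u \<Rightarrow> 'u \<Rightarrow> 'u"
  pairv :: "'u \<Rightarrow> 'u \<Rightarrow> 'v \<Rightarrow> 'v \<Rightarrow> 'v"
  fstv :: "'u \<Rightarrow> 'u \<Rightarrow> 'v \<Rightarrow> 'v"
  sndv :: "'u \<Rightarrow> 'u \<Rightarrow> 'v \<Rightarrow> 'v"
  fn :: "'u \<Rightarrow> 'u \<Rightarrow> 'u"
  app :: "'u \<Rightarrow> 'u \<Rightarrow> 'v \<Rightarrow> 'v \<Rightarrow> 'v"
  fam :: "('u \<Rightarrow> 'u) set"
  pi :: "('u \<Rightarrow> 'u) \<Rightarrow> 'u"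
  inst :: "('u \<Rightarrow> 'u) \<Rightarrow> 'v \<Rightarrow> 'u \<Rightarrow> 'v"

text \<open>The element of the function space, respectively of the product, with the given values.\<close>

definition lam :: "('u, 'v) ambient \<Rightarrow> 'u \<Rightarrow> 'u \<Rightarrow> ('v \<Rightarrow> 'v) \<Rightarrow> 'v" where
  "lam M A B g = (THE f. f \<in> el M (fn M A B) \<and> (\<forall>a\<in>el M A. app M A B f a = g a))"

definition tlam :: "('u, 'v) ambient \<Rightarrow> ('u \<Rightarrow> 'u) \<Rightarrow> ('u \<Rightarrow> 'v) \<Rightarrow> 'v" where
  "tlam M F g = (THE u. u \<in> el M (pi M F) \<and> (\<forall>C. inst M F u C = g C))"

text \<open>A valuation \<open>\<rho>\<close> maps the atom number \<open>i\<close> of arity \<open>k\<close> to \<open>\<rho> k i\<close>.\<close>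

definition bindv :: "nat \<Rightarrow> 'u \<Rightarrow> (nat \<Rightarrow> nat \<Rightarrow> 'u) \<Rightarrow> (nat \<Rightarrow> nat \<Rightarrow> 'u)" where
  "bindv k C \<rho> = \<rho>(k := case_nat C (\<rho> k))"

primrec tsem :: "('u, 'v) ambient \<Rightarrow> (nat \<Rightarrow> nat \<Rightarrow> 'u) \<Rightarrow> ftype \<Rightarrow> 'u" where
  "tsem M \<rho> (TAtom k i) = \<rho> k i"
| "tsem M \<rho> (TProd T S) = prd M (tsem M \<rho> T) (tsem M \<rho> S)"
| "tsem M \<rho> (TFun T S) = fn M (tsem M \<rho> T) (tsem M \<rho> S)"
| "tsem M \<rho> (TAll k T) = pi M (\<lambda>C. tsem M (bindv k C \<rho>) T)"

text \<open>The function denoted by a proof; \<open>es\<close> lists the arguments, one for each hypothesis.\<close>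

primrec psem :: "('u, 'v) ambient \<Rightarrow> (nat \<Rightarrow> nat \<Rightarrow> 'u) \<Rightarrow> iproof \<Rightarrow> 'v list \<Rightarrow> 'v" where
  "psem M \<rho> PAx es = hd es"
| "psem M \<rho> (PExch n \<pi>) es = psem M \<rho> \<pi> (es[n := es ! Suc n, Suc n := es ! n])"
| "psem M \<rho> (PCut n \<pi> \<pi>') es = psem M \<rho> \<pi>' (drop n es @ [psem M \<rho> \<pi> (take n es)])"
| "psem M \<rho> (PWeak \<pi>) es = psem M \<rho> \<pi> (butlast es)"
| "psem M \<rho> (PContr \<pi>) es = psem M \<rho> \<pi> (es @ [last es])"
| "psem M \<rho> (PFunR T S \<pi>) es =
     lam M (tsem M \<rho> T) (tsem M \<rho> S) (\<lambda>a. psem M \<rho> \<pi> (es @ [a]))"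
| "psem M \<rho> (PFunL T S n \<pi> \<pi>') es =
     psem M \<rho> \<pi>' (butlast (drop n es) @
       [app M (tsem M \<rho> T) (tsem M \<rho> S) (last es) (psem M \<rho> \<pi> (take n es))])"
| "psem M \<rho> (PProdR T S n \<pi> \<pi>') es =
     pairv M (tsem M \<rho> T) (tsem M \<rho> S) (psem M \<rho> \<pi> (take n es)) (psem M \<rho> \<pi>' (drop n es))"
| "psem M \<rho> (PProdL T S \<pi>) es =
     psem M \<rho> \<pi> (butlast es @ [fstv M (tsem M \<rho> T) (tsem M \<rho> S) (last es),
                               sndv M (tsem M \<rho> T) (tsem M \<rho> S) (last es)])"
| "psem M \<rho> (PAllR k T \<pi>) es =
     tlam M (\<lambda>C. tsem M (bindv k C \<rho>) T) (\<lambda>C. psem M (bindv k C \<rho>) \<pi> es)"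
| "psem M \<rho> (PAllL k T S \<pi>) es =
     psem M \<rho> \<pi> (butlast es @ [inst M (\<lambda>C. tsem M (bindv k C \<rho>) T) (last es) (tsem M \<rho> S)])"

abbreviation env_in :: "('u, 'v) ambient \<Rightarrow> (nat \<Rightarrow> nat \<Rightarrow> 'u) \<Rightarrow> 'v list \<Rightarrow> ftype list \<Rightarrow> bool" where
  "env_in M \<rho> es G \<equiv> list_all2 (\<lambda>a T. a \<in> el M (tsem M \<rho> T)) es G"

text \<open>
  The last three assumptions say that what is definable by formulas and proofs of second-order
  intuitionistic logic exists in the ambient theory. Realizability universes (partial equivalence
  relations over a partial combinatory algebra, with \<open>pi\<close> the intersection) are examples.
\<close>

locale ambient_universe =
  fixes w :: nat and M :: "('u, 'v) ambient"
  assumes nat_el: "el M (natset M) = range (natv M)"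
    and nat_inj: "inj (natv M)"
    and suc_el: "sucv M \<in> el M (fn M (natset M) (natset M))"
    and suc_app: "app M (natset M) (natset M) (sucv M) (natv M n) = natv M (Suc n)"
    and word_el: "el M (wordset M) = wordv M ` words w"
    and word_inj: "inj_on (wordv M) (words w)"
    and con_el: "k < w \<Longrightarrow> conv M k \<in> el M (fn M (wordset M) (wordset M))"
    and con_app: "k < w \<Longrightarrow> t \<in> words w \<Longrightarrow>
          app M (wordset M) (wordset M) (conv M k) (wordv M t) = wordv M (Wcon k t)"
    and pair_el: "a \<in> el M A \<Longrightarrow> b \<in> el M B \<Longrightarrow> pairv M A B a b \<in> el M (prd M A B)"
    and fst_el: "c \<in> el M (prd M A B) \<Longrightarrow> fstv M A B c \<in> el M A"
    and snd_el: "c \<in> el M (prd M A B) \<Longrightarrow> sndv M A B c \<in> el M B"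
    and fst_pair: "a \<in> el M A \<Longrightarrow> b \<in> el M B \<Longrightarrow> fstv M A B (pairv M A B a b) = a"
    and snd_pair: "a \<in> el M A \<Longrightarrow> b \<in> el M B \<Longrightarrow> sndv M A B (pairv M A B a b) = b"
    and pair_fst_snd: "c \<in> el M (prd M A B) \<Longrightarrow> pairv M A B (fstv M A B c) (sndv M A B c) = c"
    and app_el: "f \<in> el M (fn M A B) \<Longrightarrow> a \<in> el M A \<Longrightarrow> app M A B f a \<in> el M B"
    and app_ext: "f \<in> el M (fn M A B) \<Longrightarrow> g \<in> el M (fn M A B) \<Longrightarrow>
          (\<And>a. a \<in> el M A \<Longrightarrow> app M A B f a = app M A B g a) \<Longrightarrow> f = g"
    and inst_el: "F \<in> fam M \<Longrightarrow> u \<in> el M (pi M F) \<Longrightarrow> inst M F u C \<in> el M (F C)"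
    and inst_ext: "F \<in> fam M \<Longrightarrow> u \<in> el M (pi M F) \<Longrightarrow> v \<in> el M (pi M F) \<Longrightarrow>
          (\<And>C. inst M F u C = inst M F v C) \<Longrightarrow> u = v"
    and definable_fam: "(\<lambda>C. tsem M (bindv k C \<rho>) T) \<in> fam M"
    and definable_fun: "iproves (G @ [T]) S \<pi> \<Longrightarrow> env_in M \<rho> es G \<Longrightarrow>
          \<exists>f\<in>el M (fn M (tsem M \<rho> T) (tsem M \<rho> S)).
            \<forall>a\<in>el M (tsem M \<rho> T).
              app M (tsem M \<rho> T) (tsem M \<rho> S) f a = psem M \<rho> \<pi> (es @ [a])"
    and definable_pi: "iproves (map (tshift k 0) G) T \<pi> \<Longrightarrow> env_in M \<rho> es G \<Longrightarrow>
          \<exists>u\<in>el M (pi M (\<lambda>C. tsem M (bindv k C \<rho>) T)).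
            \<forall>C. inst M (\<lambda>C. tsem M (bindv k C \<rho>) T) u C = psem M (bindv k C \<rho>) \<pi> es"

text \<open>
  \<open>wfun M n C\<close> is \<open>(C \<Rightarrow> C) \<Rightarrow> \<dots> \<Rightarrow> (C \<Rightarrow> C) \<Rightarrow> C \<Rightarrow> C\<close> with \<open>n\<close> arguments \<open>C \<Rightarrow> C\<close>, so that the meaning
  of \<open>W\<^sub>p\<close> is \<open>pi M (wfun M w)\<close>; \<open>wapp\<close> is iterated application.
\<close>

primrec wfun :: "('u, 'v) ambient \<Rightarrow> nat \<Rightarrow> 'u \<Rightarrow> 'u" where
  "wfun M 0 C = fn M C C"
| "wfun M (Suc n) C = fn M (fn M C C) (wfun M n C)"

primrec wapp :: "('u, 'v) ambient \<Rightarrow> 'u \<Rightarrow> 'v list \<Rightarrow> 'v \<Rightarrow> 'v \<Rightarrow> 'v" where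
  "wapp M C [] z u = app M C C u z"
| "wapp M C (f # fs) z u = wapp M C fs z (app M (fn M C C) (wfun M (length fs) C) u f)"

primrec wval :: "('u, 'v) ambient \<Rightarrow> 'u \<Rightarrow> 'v list \<Rightarrow> 'v \<Rightarrow> word \<Rightarrow> 'v" where
  "wval M C fs z Wzero = z"
| "wval M C fs z (Wcon k t) = app M C C (fs ! k) (wval M C fs z t)"

definition phi :: "nat \<Rightarrow> ('u, 'v) ambient \<Rightarrow> word \<Rightarrow> 'v" where
  "phi w M t = (THE u. u \<in> el M (pi M (wfun M w)) \<and>
     (\<forall>C fs z. length fs = w \<and> set fs \<subseteq> el M (fn M C C) \<and> z \<in> el M C \<longrightarrow>
        wapp M C fs z (inst M (wfun M w) u C) = wval M C fs z t))"

definition psi :: "nat \<Rightarrow> ('u, 'v) ambient \<Rightarrow> 'v \<Rightarrow> 'v" where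
  "psi w M u = wapp M (wordset M) (map (conv M) [0..<w]) (wordv M Wzero)
     (inst M (wfun M w) u (wordset M))"

end

theory Submission
  imports Defs "HOL-Library.Multiset"
begin

text \<open>
  Every RRW function is represented by an iteration on Church words. A word of size \<open>p\<close> can be rebuilt
  inside a modality at the cost of a constant in its size, so words may be copied freely; in
  particular the parameters of a recursion are available in each of its steps. The recursive value
  grows by an amount \<open>K\<close> per step which depends only on arguments of higher tier, hence by a
  polynomial in these in total. A conditional iterates functions that ignore the current value,
  applied to the predecessor of the tested word. For the semantics it is shown that each proof maps
  canonical representations to the canonical representation of the result; this is stronger than
  the equation for \<open>\<psi>\<close>, and stable under composition.
\<close>

section \<open>Erasure\<close>

text \<open>The form of the bound carries the induction. Arguments of the tier of the result enter
  its size only through a common bound \<open>P\<close>, and \<open>P\<close> occurs with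
  coefficient 1: one step turns \<open>P\<close> into \<open>K + P\<close>, and y steps turn it into
  \<open>y K + P\<close>. With coefficient 2 the growth would be exponential. For the same reason
  \<open>P\<close> is kept apart from the polynomial and tied to the arguments by constraints; a sum
  of their sizes would spoil the coefficient. The obstacle is sharing. Contraction applies only to
  formulas \<open>!A\<close>, while the parameters of an iteration are wanted in the start value, in
  each step function and below the modality in front of it. A rebuilt word comes back larger by 1,
  whatever the number of copies. Every constant in the bounds is composed of such charges: 1 for
  copying, 1 more for promotion, 2 for a constructor, 1 for the predecessor. Rebuilding has to
  denote the identity. This follows from the uniqueness of canonical representations, and it is
  established for elements that represent words; hence the conditions \<open>isw\<close> in the
  specifications.\<close>

lemma erase_fsub [simp]: "erase (fsub \<sigma> A) = erase A"
  by (induction A arbitrary: \<sigma>) auto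

lemma erase_ashift [simp]: "erase (ashift k c A) = tshift k c (erase A)"
  by (induction A arbitrary: c) auto

lemma erase_asub [simp]: "erase (asub k c A B) = tsub k c (erase A) (erase B)"
  by (induction A arbitrary: c B) auto

lemma map_erase_Bang: "length qs = length As \<Longrightarrow> map erase (map2 Bang qs As) = map erase As"
  by (induction qs As rule: list_induct2) auto

text \<open>The assumptions \<open>definable_fun\<close> and \<open>definable_pi\<close> speak of
  erased proofs, so semantic arguments about a QBAL proof pass through this typing of its
  erasure.\<close>

lemma qbal_iproves: "qbal \<Phi> \<Gamma> A \<pi> \<Longrightarrow> iproves (map erase \<Gamma>) (erase A) \<pi>"
proof (induction rule: qbal.induct)
  \<comment> \<open>Comparable formulas have the same erasure, since the order relates only
    polynomials and constraints.\<close>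
  case (q_Ax \<Phi> A B)
  from \<open>le_form \<Phi> A B\<close> have "erase A = erase B"
    by induction (auto simp: list_all2_lengthD)
  then show ?case by (auto intro: iproves.intros)
next
  case (q_Exch \<Phi> \<Gamma> A B \<Delta> C \<pi>)
  then show ?case using i_Exch[of "map erase \<Gamma>" "erase A" "erase B"] by simp
next
  case (q_Cut \<Phi> \<Gamma> A \<pi> \<Delta> B \<pi>')
  then show ?case using i_Cut[of "map erase \<Gamma>"] by simp
next
  case (q_LolliL \<Phi> \<Gamma> A \<pi> \<Delta> B C \<pi>')
  then show ?case using i_FunL[of "map erase \<Gamma>"] by simp
next
  case (q_TensorR \<Phi> \<Gamma> A \<pi> \<Delta> B \<pi>')
  then show ?case using i_ProdR[of "map erase \<Gamma>"] by simp
next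
  case (q_PBang \<Psi> qs As p B \<Phi> \<pi>)
  then show ?case using map_erase_Bang by simp
next
  case (q_AllAR \<Phi> k \<Gamma> A \<pi>)
  then show ?case using i_AllR[of k "map erase \<Gamma>"] by (simp add: comp_def)
next
  case (q_AllR \<Phi> \<Gamma> n \<Psi> A \<pi>)
  then show ?case by (simp add: comp_def)
next
  case (q_ExL \<Phi> \<Gamma> n \<Psi> A C \<pi>)
  then show ?case by (simp add: comp_def)
qed (auto intro: iproves.intros)

lemma wf_form_ashift [simp]: "wf_form (ashift k c A) = wf_form A"
  by (induction A arbitrary: c) auto

lemma qbal_wf: "qbal \<Phi> \<Gamma> A \<pi> \<Longrightarrow> wf_seq \<Phi> \<Gamma> A"
  by (induction rule: qbal.induct) (auto simp: wf_seq_def)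

section \<open>Semantics of second-order proofs\<close>

text \<open>\<open>bindv\<close> inserts a value at index 0; inductions on types pass quantifiers of
  the same arity and need insertion at every index.\<close>

definition insv :: "nat \<Rightarrow> nat \<Rightarrow> 'u \<Rightarrow> (nat \<Rightarrow> nat \<Rightarrow> 'u) \<Rightarrow> (nat \<Rightarrow> nat \<Rightarrow> 'u)" where
  "insv k c C \<rho> = \<rho>(k := \<lambda>i. if i < c then \<rho> k i else if i = c then C else \<rho> k (i - 1))"

lemma insv_0: "insv k 0 C \<rho> = bindv k C \<rho>"
  by (auto simp: insv_def bindv_def fun_eq_iff split: nat.splits)

lemma bindv_insv:
  "bindv l D (insv k c C \<rho>) = insv k (if l = k then Suc c else c) C (bindv l D \<rho>)"
  by (auto simp: insv_def bindv_def fun_eq_iff split: nat.splits)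

lemma tsem_tshift: "tsem M (insv k c C \<rho>) (tshift k c T) = tsem M \<rho> T"
  by (induction T arbitrary: c \<rho>) (auto simp: bindv_insv, auto simp: insv_def)

lemma tsem_tshift_0 [simp]: "tsem M (bindv k C \<rho>) (tshift k 0 T) = tsem M \<rho> T"
  using tsem_tshift[of M k 0] by (simp add: insv_0)

lemma tsem_tsub: "tsem M \<rho> (tsub k c T S) = tsem M (insv k c (tsem M \<rho> S) \<rho>) T"
  by (induction T arbitrary: c \<rho> S) (auto simp: bindv_insv, auto simp: insv_def)

lemma tsem_tsub_0: "tsem M \<rho> (tsub k 0 T S) = tsem M (bindv k (tsem M \<rho> S) \<rho>) T"
  by (simp add: tsem_tsub insv_0)

context ambient_universe
begin

text \<open>\<open>lam\<close> is a definite description. It is proper here: existence is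
  \<open>definable_fun\<close>, uniqueness is extensionality of application.\<close>

lemma lam_props:
  assumes "iproves (G @ [T]) S \<pi>" "env_in M \<rho> es G"
  shows "lam M (tsem M \<rho> T) (tsem M \<rho> S) (\<lambda>a. psem M \<rho> \<pi> (es @ [a])) \<in> el M (fn M (tsem M \<rho> T) (tsem M \<rho> S))"
      (is "?l \<in> _")
    and "a \<in> el M (tsem M \<rho> T) \<Longrightarrow> app M (tsem M \<rho> T) (tsem M \<rho> S)
          (lam M (tsem M \<rho> T) (tsem M \<rho> S) (\<lambda>a. psem M \<rho> \<pi> (es @ [a]))) a = psem M \<rho> \<pi> (es @ [a])"
proof -
  let ?P = "\<lambda>f. f \<in> el M (fn M (tsem M \<rho> T) (tsem M \<rho> S)) \<and>
    (\<forall>a\<in>el M (tsem M \<rho> T). app M (tsem M \<rho> T) (tsem M \<rho> S) f a = psem M \<rho> \<pi> (es @ [a]))"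
  obtain f where f: "?P f" using definable_fun[OF assms] by blast
  have "?P ?l" unfolding lam_def
  proof (rule theI)
    show "?P f" by fact
    show "g = f" if "?P g" for g
      by (rule app_ext[where A = "tsem M \<rho> T" and B = "tsem M \<rho> S"]) (use that f in auto)
  qed
  then show "?l \<in> el M (fn M (tsem M \<rho> T) (tsem M \<rho> S))"
    and "a \<in> el M (tsem M \<rho> T) \<Longrightarrow> app M (tsem M \<rho> T) (tsem M \<rho> S) ?l a = psem M \<rho> \<pi> (es @ [a])"
    by auto
qed

lemma tlam_props:
  assumes "iproves (map (tshift k 0) G) T \<pi>" "env_in M \<rho> es G"
  defines "F \<equiv> \<lambda>C. tsem M (bindv k C \<rho>) T"
  defines "u \<equiv> tlam M F (\<lambda>C. psem M (bindv k C \<rho>) \<pi> es)"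
  shows "u \<in> el M (pi M F)"
    and "inst M F u C = psem M (bindv k C \<rho>) \<pi> es"
proof -
  let ?P = "\<lambda>u. u \<in> el M (pi M F) \<and> (\<forall>C. inst M F u C = psem M (bindv k C \<rho>) \<pi> es)"
  obtain v where v: "?P v" using definable_pi[OF assms(1,2)] unfolding F_def by blast
  have "F \<in> fam M" unfolding F_def by (rule definable_fam)
  have "?P u" unfolding u_def tlam_def
  proof (rule theI)
    show "?P v" by fact
    show "g = v" if "?P g" for g
      by (rule inst_ext[OF \<open>F \<in> fam M\<close>]) (use that v in auto)
  qed
  then show "u \<in> el M (pi M F)" "inst M F u C = psem M (bindv k C \<rho>) \<pi> es" by auto
qed

text \<open>Specifications presuppose well-typed environments; this keeps them applicable to the
  values that cuts and eliminations pass on.\<close>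

lemma psem_el: "iproves G T \<pi> \<Longrightarrow> env_in M \<rho> es G \<Longrightarrow> psem M \<rho> \<pi> es \<in> el M (tsem M \<rho> T)"
proof (induction arbitrary: \<rho> es rule: iproves.induct)
  case (i_Ax T)
  then show ?case by (auto simp: list_all2_Cons2)
next
  case (i_Exch G T S D R \<pi>)
  from i_Exch.prems obtain gs a b ds where "es = gs @ b # a # ds" "env_in M \<rho> gs G"
    "a \<in> el M (tsem M \<rho> T)" "b \<in> el M (tsem M \<rho> S)" "env_in M \<rho> ds D"
    by (auto simp: list_all2_append2 list_all2_Cons2)
  moreover from this have "length gs = length G" by (auto dest: list_all2_lengthD)
  ultimately show ?case
    using i_Exch.IH[of \<rho> "gs @ a # b # ds"]
    by (auto simp: list_all2_append nth_append list_update_append)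
next
  case (i_Cut G T \<pi> D S \<pi>')
  from i_Cut.prems obtain gs ds where "es = gs @ ds" "env_in M \<rho> gs G" "env_in M \<rho> ds D"
    by (auto simp: list_all2_append2)
  moreover from this have "length gs = length G" by (auto dest: list_all2_lengthD)
  ultimately show ?case
    using i_Cut.IH(1)[of \<rho> gs] by (auto intro!: i_Cut.IH(2) list_all2_appendI)
next
  case (i_Weak G S \<pi> T)
  then show ?case by (auto simp: list_all2_append2 list_all2_Cons2)
next
  case (i_Contr G T S \<pi>)
  from i_Contr.prems obtain gs a where "es = gs @ [a]" "env_in M \<rho> gs G" "a \<in> el M (tsem M \<rho> T)"
    by (auto simp: list_all2_append2 list_all2_Cons2)
  then show ?case using i_Contr.IH[of \<rho> "gs @ [a,a]"] by (simp add: list_all2_appendI)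
next
  case (i_FunR G T S \<pi>)
  then show ?case using lam_props(1)[OF i_FunR.hyps] by simp
next
  case (i_FunL G T \<pi> D S R \<pi>')
  from i_FunL.prems obtain gs ds f where "es = gs @ ds @ [f]" "env_in M \<rho> gs G" "env_in M \<rho> ds D"
    "f \<in> el M (fn M (tsem M \<rho> T) (tsem M \<rho> S))"
    by (auto simp: list_all2_append2 list_all2_Cons2)
  moreover from this have "length gs = length G" by (auto dest: list_all2_lengthD)
  ultimately show ?case
    using i_FunL.IH(1)[of \<rho> gs] by (auto intro!: i_FunL.IH(2) list_all2_appendI app_el)
next
  case (i_ProdR G T \<pi> D S \<pi>')
  from i_ProdR.prems obtain gs ds where "es = gs @ ds" "env_in M \<rho> gs G" "env_in M \<rho> ds D"
    by (auto simp: list_all2_append2)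
  moreover from this have "length gs = length G" by (auto dest: list_all2_lengthD)
  ultimately show ?case
    using i_ProdR.IH(1)[of \<rho> gs] i_ProdR.IH(2)[of \<rho> ds] by (auto intro!: pair_el)
next
  case (i_ProdL G T S R \<pi>)
  from i_ProdL.prems obtain gs c where "es = gs @ [c]" "env_in M \<rho> gs G"
    "c \<in> el M (prd M (tsem M \<rho> T) (tsem M \<rho> S))"
    by (auto simp: list_all2_append2 list_all2_Cons2)
  then show ?case by (auto intro!: i_ProdL.IH list_all2_appendI fst_el snd_el)
next
  case (i_AllR k G T \<pi>)
  then show ?case using tlam_props(1)[OF i_AllR.hyps i_AllR.prems] by simp
next
  case (i_AllL G k T S R \<pi>)
  from i_AllL.prems obtain gs c where "es = gs @ [c]" "env_in M \<rho> gs G"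
    "c \<in> el M (pi M (\<lambda>C. tsem M (bindv k C \<rho>) T))"
    by (auto simp: list_all2_append2 list_all2_Cons2)
  then show ?case
    using inst_el[OF definable_fam]
    by (auto intro!: i_AllL.IH list_all2_appendI simp: tsem_tsub_0)
qed

end

section \<open>Derivability with a specification of the denoted function\<close>

text \<open>
  Hypotheses carry names, and the arguments of the denoted function are given by an environment
  \<open>\<eta>\<close> on names. So exchange and weakening do not affect specifications, and two hypotheses may
  share a name: they then receive the same argument.
\<close>

definition typed :: "('u, 'v) ambient \<Rightarrow> (nat \<Rightarrow> nat \<Rightarrow> 'u) \<Rightarrow> (nat \<Rightarrow> 'v) \<Rightarrow> (nat \<times> form) list \<Rightarrow> bool" where
  "typed M \<rho> \<eta> \<Gamma> \<longleftrightarrow> (\<forall>(n, B)\<in>set \<Gamma>. \<eta> n \<in> el M (tsem M \<rho> (erase B)))"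

type_synonym ('u, 'v) spec =
  "('u, 'v) ambient \<Rightarrow> (nat \<Rightarrow> nat \<Rightarrow> 'u) \<Rightarrow> (nat \<Rightarrow> 'v) \<Rightarrow> 'v \<Rightarrow> bool"

abbreviation names :: "(nat \<times> form) list \<Rightarrow> nat set" where
  "names \<Gamma> \<equiv> fst ` set \<Gamma>"

text \<open>The proof is chosen before universe, valuation and environment, as the final statement
  demands. \<open>R\<close> is a relation so that it can be conditional, for instance on arguments
  representing words.\<close>

definition der :: "nat \<Rightarrow> constr set \<Rightarrow> (nat \<times> form) list \<Rightarrow> form \<Rightarrow> ('u, 'v) spec \<Rightarrow> bool" where
  "der w \<Phi> \<Gamma> A R \<longleftrightarrow> (\<exists>\<pi>. qbal \<Phi> (map snd \<Gamma>) A \<pi> \<and>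
     (\<forall>M \<rho> \<eta>. ambient_universe w M \<longrightarrow> typed M \<rho> \<eta> \<Gamma> \<longrightarrow>
        R M \<rho> \<eta> (psem M \<rho> \<pi> (map (\<lambda>x. \<eta> (fst x)) \<Gamma>))))"

lemma typed_simps [simp]:
  "typed M \<rho> \<eta> []"
  "typed M \<rho> \<eta> ((n, A) # \<Gamma>) \<longleftrightarrow> \<eta> n \<in> el M (tsem M \<rho> (erase A)) \<and> typed M \<rho> \<eta> \<Gamma>"
  "typed M \<rho> \<eta> (\<Gamma> @ \<Delta>) \<longleftrightarrow> typed M \<rho> \<eta> \<Gamma> \<and> typed M \<rho> \<eta> \<Delta>"
  by (auto simp: typed_def)

lemma typed_env_in: "typed M \<rho> \<eta> \<Gamma> \<longleftrightarrow> env_in M \<rho> (map (\<lambda>x. \<eta> (fst x)) \<Gamma>) (map erase (map snd \<Gamma>))"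
  by (induction \<Gamma>) auto

lemma typed_upd [simp]: "n \<notin> names \<Gamma> \<Longrightarrow> typed M \<rho> (\<eta>(n := a)) \<Gamma> = typed M \<rho> \<eta> \<Gamma>"
  by (induction \<Gamma>) auto

lemma vals_upd [simp]:
  "n \<notin> names \<Gamma> \<Longrightarrow> map (\<lambda>x. (\<eta>(n := a)) (fst x)) \<Gamma> = map (\<lambda>x. \<eta> (fst x)) \<Gamma>"
  by auto

lemma derI:
  assumes "qbal \<Phi> (map snd \<Gamma>) A \<pi>"
    and "\<And>M \<rho> \<eta>. ambient_universe w M \<Longrightarrow> typed M \<rho> \<eta> \<Gamma> \<Longrightarrow>
        R M \<rho> \<eta> (psem M \<rho> \<pi> (map (\<lambda>x. \<eta> (fst x)) \<Gamma>))"
  shows "der w \<Phi> \<Gamma> A R"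
  using assms unfolding der_def by blast

lemma derE:
  fixes R :: "('u, 'v) spec"
  assumes "der w \<Phi> \<Gamma> A R"
  obtains \<pi> where "qbal \<Phi> (map snd \<Gamma>) A \<pi>"
    and "\<And>M \<rho> \<eta>. ambient_universe w M \<Longrightarrow> typed M \<rho> \<eta> \<Gamma> \<Longrightarrow>
        R M \<rho> \<eta> (psem M \<rho> \<pi> (map (\<lambda>x. \<eta> (fst x)) \<Gamma>))"
    and "\<And>(M :: ('u, 'v) ambient) \<rho> \<eta>. ambient_universe w M \<Longrightarrow> typed M \<rho> \<eta> \<Gamma> \<Longrightarrow>
        psem M \<rho> \<pi> (map (\<lambda>x. \<eta> (fst x)) \<Gamma>) \<in> el M (tsem M \<rho> (erase A))"
    and "iproves (map erase (map snd \<Gamma>)) (erase A) \<pi>"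
proof -
  obtain \<pi> where *: "qbal \<Phi> (map snd \<Gamma>) A \<pi>"
    "\<And>M \<rho> \<eta>. ambient_universe w M \<Longrightarrow> typed M \<rho> \<eta> \<Gamma> \<Longrightarrow>
        R M \<rho> \<eta> (psem M \<rho> \<pi> (map (\<lambda>x. \<eta> (fst x)) \<Gamma>))"
    using assms unfolding der_def by blast
  note ip = qbal_iproves[OF *(1)]
  show thesis
    by (rule that[OF * _ ip]) (auto simp: typed_env_in intro!: ambient_universe.psem_el[OF _ ip])
qed

lemma der_wf: "der w \<Phi> \<Gamma> A R \<Longrightarrow> wf_seq \<Phi> (map snd \<Gamma>) A"
  by (auto elim!: derE dest: qbal_wf)

lemma der_conseq:
  fixes R R' :: "('u, 'v) spec"
  assumes "der w \<Phi> \<Gamma> A R"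
    and "\<And>(M :: ('u, 'v) ambient) \<rho> \<eta> v. ambient_universe w M \<Longrightarrow> typed M \<rho> \<eta> \<Gamma> \<Longrightarrow>
      v \<in> el M (tsem M \<rho> (erase A)) \<Longrightarrow> R M \<rho> \<eta> v \<Longrightarrow> R' M \<rho> \<eta> v"
  shows "der w \<Phi> \<Gamma> A R'"
  using assms(1) by (rule derE) (rule derI, assumption, auto intro: assms(2))

text \<open>Names belong to the environment and not to the \<open>qbal\<close> proof, so
  \<open>g\<close> need not be injective: identifying names feeds one argument to several
  hypotheses.\<close>

lemma der_rename:
  assumes "der w \<Phi> \<Gamma> A R"
  shows "der w \<Phi> (map (apfst g) \<Gamma>) A (\<lambda>M \<rho> \<eta>. R M \<rho> (\<eta> \<circ> g))"
  using assms
proof (rule derE, goal_cases)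
  case (1 \<pi>)
  have [simp]: "map snd (map (apfst g) \<Gamma>) = map snd \<Gamma>" by simp
  have [simp]: "typed M \<rho> \<eta> (map (apfst g) \<Gamma>) = typed M \<rho> (\<eta> \<circ> g) \<Gamma>" for M :: "('u, 'v) ambient" and \<rho> \<eta>
    by (induction \<Gamma>) auto
  have [simp]: "map (\<lambda>x. \<eta> (fst x)) (map (apfst g) \<Gamma>) = map (\<lambda>x. (\<eta> \<circ> g) (fst x)) \<Gamma>" for \<eta> :: "nat \<Rightarrow> 'b"
    by simp
  show ?case by (rule derI, (simp only: \<open>map snd (map _ _) = _\<close>, rule 1(1))) (use 1(2)[of _ _ "_ \<circ> g"] in \<open>simp add: comp_def\<close>)
qed

section \<open>Structural rules\<close>

lemma der_ax:
  assumes "wf_constrs \<Phi>" "wf_form A" "wf_form B" "le_form \<Phi> A B"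
  shows "der w \<Phi> [(n, A)] B (\<lambda>M \<rho> \<eta> v. v = \<eta> n)"
  by (rule derI[where \<pi> = PAx]) (use assms in \<open>auto intro!: q_Ax simp: wf_seq_def\<close>)

lemma der_swap:
  assumes "der w \<Phi> (\<Gamma> @ a # b # \<Delta>) C R"
  shows "der w \<Phi> (\<Gamma> @ b # a # \<Delta>) C R"
  using assms
proof (rule derE, goal_cases)
  case (1 \<pi>)
  show ?case
  proof (rule derI)
    show "qbal \<Phi> (map snd (\<Gamma> @ b # a # \<Delta>)) C (PExch (length \<Gamma>) \<pi>)"
      using 1(1) q_Exch[of \<Phi> "map snd \<Gamma>"] by simp
    show "R M \<rho> \<eta> (psem M \<rho> (PExch (length \<Gamma>) \<pi>) (map (\<lambda>x. \<eta> (fst x)) (\<Gamma> @ b # a # \<Delta>)))"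
      if "ambient_universe w M" "typed M \<rho> \<eta> (\<Gamma> @ b # a # \<Delta>)" for M \<rho> \<eta>
      using 1(2)[of M \<rho> \<eta>] that by (cases a; cases b) (simp add: nth_append list_update_append)
  qed
qed

lemma der_perm:
  assumes "der w \<Phi> \<Gamma> C R" "mset \<Gamma>' = mset \<Gamma>"
  shows "der w \<Phi> \<Gamma>' C R"
proof -
  have move: "der w \<Phi> (\<Gamma>1 @ \<Gamma>2 @ a # \<Delta>) C R" if "der w \<Phi> (\<Gamma>1 @ a # \<Gamma>2 @ \<Delta>) C R" for \<Gamma>1 \<Gamma>2 a \<Delta>
    using that
  proof (induction \<Gamma>2 arbitrary: \<Gamma>1)
    case (Cons b \<Gamma>2)
    from der_swap[of w \<Phi> \<Gamma>1 a b "\<Gamma>2 @ \<Delta>" C R] Cons(2) show ?case using Cons(1)[of "\<Gamma>1 @ [b]"] by simp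
  qed simp
  \<comment> \<open>\<open>\<Delta>\<close> collects the entries that are already in place; the last
    entry of the target is moved to its front.\<close>
  have "der w \<Phi> (\<Gamma>' @ \<Delta>) C R" if "der w \<Phi> (\<Gamma> @ \<Delta>) C R" "mset \<Gamma>' = mset \<Gamma>" for \<Gamma> \<Gamma>' \<Delta>
    using that
  proof (induction \<Gamma>' arbitrary: \<Gamma> \<Delta> rule: rev_induct)
    case (snoc a \<Gamma>')
    have "a \<in> set \<Gamma>" using snoc.prems(2) by (metis in_set_conv_decomp set_mset_mset)
    then obtain \<Gamma>1 \<Gamma>2 where \<Gamma>: "\<Gamma> = \<Gamma>1 @ a # \<Gamma>2" by (auto simp: in_set_conv_decomp)
    then have "der w \<Phi> ((\<Gamma>1 @ \<Gamma>2) @ a # \<Delta>) C R" using move[of \<Gamma>1 a \<Gamma>2 \<Delta>] snoc.prems(1) by simp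
    moreover have "mset \<Gamma>' = mset (\<Gamma>1 @ \<Gamma>2)" using snoc.prems(2) \<Gamma> by simp
    ultimately show ?case using snoc.IH[of "\<Gamma>1 @ \<Gamma>2" "a # \<Delta>"] by simp
  qed simp
  from this[of \<Gamma> "[]" \<Gamma>'] assms show ?thesis by simp
qed

lemma der_weaken:
  assumes "der w \<Phi> \<Gamma> C R" "\<forall>(n, A)\<in>set \<Delta>. wf_form A"
  shows "der w \<Phi> (\<Gamma> @ \<Delta>) C R"
  using assms(2)
proof (induction \<Delta> rule: rev_induct)
  case Nil
  then show ?case using assms(1) by simp
next
  case (snoc x \<Delta>)
  obtain n A where x: "x = (n, A)" by force
  from snoc have "der w \<Phi> (\<Gamma> @ \<Delta>) C R" by simp
  then show ?case
  proof (rule derE, goal_cases)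
    case (1 \<pi>)
    show ?case
    proof (rule derI)
      show "qbal \<Phi> (map snd (\<Gamma> @ \<Delta> @ [x])) C (PWeak \<pi>)"
        using 1(1) snoc.prems q_Weak[of A \<Phi> "map snd (\<Gamma> @ \<Delta>)"] by (simp add: x)
    qed (use 1(2) in \<open>simp add: x butlast_append\<close>)
  qed
qed

lemma der_struct:
  assumes "der w \<Phi> \<Gamma> C R" "mset \<Gamma>' = mset (\<Gamma> @ \<Delta>)" "\<forall>(n, A)\<in>set \<Delta>. wf_form A"
  shows "der w \<Phi> \<Gamma>' C R"
  using der_perm[OF der_weaken[OF assms(1,3)] assms(2)] .

lemma der_cut:
  fixes R1 R2 :: "('u, 'v) spec"
  assumes "der w \<Phi> \<Gamma> A R1" "der w \<Phi> (\<Delta> @ [(n, A)]) B R2" "n \<notin> names \<Delta>"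
  shows "der w \<Phi> (\<Gamma> @ \<Delta>) B (\<lambda>M \<rho> \<eta> v.
    \<exists>a\<in>el M (tsem M \<rho> (erase A)). R1 M \<rho> \<eta> a \<and> R2 M \<rho> (\<eta>(n := a)) v)"
  using assms(1)
proof (rule derE, goal_cases)
  case (1 \<pi>1)
  note D = this
  from assms(2) show ?case
  proof (rule derE, goal_cases)
    case (1 \<pi>2)
    note 2 = this
    show ?case
    proof (rule derI)
      show "qbal \<Phi> (map snd (\<Gamma> @ \<Delta>)) B (PCut (length \<Gamma>) \<pi>1 \<pi>2)"
        using q_Cut[OF D(1), of "map snd \<Delta>" B \<pi>2] 2(1) by simp
    next
      fix M :: "('u, 'v) ambient" and \<rho> \<eta> assume H: "ambient_universe w M" "typed M \<rho> \<eta> (\<Gamma> @ \<Delta>)"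
      let ?a = "psem M \<rho> \<pi>1 (map (\<lambda>x. \<eta> (fst x)) \<Gamma>)"
      show "\<exists>a\<in>el M (tsem M \<rho> (erase A)). R1 M \<rho> \<eta> a \<and>
        R2 M \<rho> (\<eta>(n := a)) (psem M \<rho> (PCut (length \<Gamma>) \<pi>1 \<pi>2) (map (\<lambda>x. \<eta> (fst x)) (\<Gamma> @ \<Delta>)))"
        using H D(2)[of M \<rho> \<eta>] D(3)[of M \<rho> \<eta>] 2(2)[of M \<rho> "\<eta>(n := ?a)"] assms(3)
        by (intro bexI[of _ ?a]) (auto simp del: fun_upd_apply, simp)
    qed
  qed
qed

text \<open>A coercion that denotes the identity, at least under \<open>P\<close>, exchanges the
  formula of a hypothesis while its name and value stay, so \<open>R\<close> carries over. Words
  enter modalities in this way.\<close>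

lemma der_coerce:
  fixes R :: "('u, 'v) spec"
  assumes "der w \<Phi> [(n, A)] B (\<lambda>M \<rho> \<eta> v. P M \<rho> \<eta> \<longrightarrow> v = \<eta> n)" "der w \<Phi> (\<Gamma> @ [(n, B)]) C R"
  shows "der w \<Phi> (\<Gamma> @ [(n, A)]) C (\<lambda>M \<rho> \<eta> v. P M \<rho> \<eta> \<longrightarrow> R M \<rho> \<eta> v)"
  using assms(1)
proof (rule derE, goal_cases)
  case (1 \<pi>1)
  note D = this
  from assms(2) show ?case
  proof (rule derE, goal_cases)
    case (1 \<pi>2)
    note 2 = this
    have "der w \<Phi> ((n, A) # \<Gamma>) C (\<lambda>M \<rho> \<eta> v. P M \<rho> \<eta> \<longrightarrow> R M \<rho> \<eta> v)"
    proof (rule derI)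
      show "qbal \<Phi> (map snd ((n, A) # \<Gamma>)) C (PCut 1 \<pi>1 \<pi>2)"
        using q_Cut[OF D(1), of "map snd \<Gamma>" C \<pi>2] 2(1) by simp
    next
      fix M :: "('u, 'v) ambient" and \<rho> \<eta> assume H: "ambient_universe w M" "typed M \<rho> \<eta> ((n, A) # \<Gamma>)"
      show "P M \<rho> \<eta> \<longrightarrow> R M \<rho> \<eta> (psem M \<rho> (PCut 1 \<pi>1 \<pi>2) (map (\<lambda>x. \<eta> (fst x)) ((n, A) # \<Gamma>)))"
        using H D(2)[of M \<rho> \<eta>] D(3)[of M \<rho> \<eta>] 2(2)[of M \<rho> \<eta>] by auto
    qed
    then show ?case by (rule der_perm) simp
  qed
qed

section \<open>Logical rules\<close>

lemma der_lolliR: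
  fixes R :: "('u, 'v) spec"
  assumes "der w \<Phi> (\<Gamma> @ [(n, A)]) B R" "n \<notin> names \<Gamma>"
  shows "der w \<Phi> \<Gamma> (Lolli A B) (\<lambda>M \<rho> \<eta> f. \<forall>a\<in>el M (tsem M \<rho> (erase A)).
    R M \<rho> (\<eta>(n := a)) (app M (tsem M \<rho> (erase A)) (tsem M \<rho> (erase B)) f a))"
  using assms(1)
proof (rule derE, goal_cases)
  case (1 \<pi>)
  show ?case
  proof (rule derI)
    show "qbal \<Phi> (map snd \<Gamma>) (Lolli A B) (PFunR (erase A) (erase B) \<pi>)"
      using 1(1) by (simp add: q_LolliR)
  next
    fix M :: "('u, 'v) ambient" and \<rho> \<eta> assume H: "ambient_universe w M" "typed M \<rho> \<eta> \<Gamma>"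
    have "app M (tsem M \<rho> (erase A)) (tsem M \<rho> (erase B)) (psem M \<rho> (PFunR (erase A) (erase B) \<pi>)
        (map (\<lambda>x. \<eta> (fst x)) \<Gamma>)) a = psem M \<rho> \<pi> (map (\<lambda>x. \<eta> (fst x)) \<Gamma> @ [a])"
      if "a \<in> el M (tsem M \<rho> (erase A))" for a
      using ambient_universe.lam_props(2)[OF H(1), of "map erase (map snd \<Gamma>)" "erase A" "erase B" \<pi>]
        1(4) H(2) that by (simp add: typed_env_in)
    then show "\<forall>a\<in>el M (tsem M \<rho> (erase A)).
      R M \<rho> (\<eta>(n := a)) (app M (tsem M \<rho> (erase A)) (tsem M \<rho> (erase B))
        (psem M \<rho> (PFunR (erase A) (erase B) \<pi>) (map (\<lambda>x. \<eta> (fst x)) \<Gamma>)) a)"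
      using H assms(2) 1(2)[OF H(1), of \<rho> "\<eta>(n := _)"] by (auto simp del: psem.simps fun_upd_apply)
        (simp del: psem.simps)
  qed
qed

lemma der_lolliL:
  fixes R1 R2 :: "('u, 'v) spec"
  assumes "der w \<Phi> \<Gamma> A R1" "der w \<Phi> (\<Delta> @ [(n, B)]) C R2" "n \<notin> names \<Delta>"
  shows "der w \<Phi> (\<Gamma> @ \<Delta> @ [(m, Lolli A B)]) C (\<lambda>M \<rho> \<eta> v.
    \<exists>a\<in>el M (tsem M \<rho> (erase A)). R1 M \<rho> \<eta> a \<and>
      R2 M \<rho> (\<eta>(n := app M (tsem M \<rho> (erase A)) (tsem M \<rho> (erase B)) (\<eta> m) a)) v)"
  using assms(1)
proof (rule derE, goal_cases)
  case (1 \<pi>1)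
  note D = this
  from assms(2) show ?case
  proof (rule derE, goal_cases)
    case (1 \<pi>2)
    note 2 = this
    let ?\<pi> = "PFunL (erase A) (erase B) (length \<Gamma>) \<pi>1 \<pi>2"
    show ?case
    proof (rule derI)
      show "qbal \<Phi> (map snd (\<Gamma> @ \<Delta> @ [(m, Lolli A B)])) C ?\<pi>"
        using q_LolliL[OF D(1), of "map snd \<Delta>" B C \<pi>2] 2(1) by simp
    next
      fix M :: "('u, 'v) ambient" and \<rho> \<eta>
      assume H: "ambient_universe w M" "typed M \<rho> \<eta> (\<Gamma> @ \<Delta> @ [(m, Lolli A B)])"
      let ?a = "psem M \<rho> \<pi>1 (map (\<lambda>x. \<eta> (fst x)) \<Gamma>)"
      let ?b = "app M (tsem M \<rho> (erase A)) (tsem M \<rho> (erase B)) (\<eta> m) ?a"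
      have a: "?a \<in> el M (tsem M \<rho> (erase A))" using H D(3)[of M \<rho> \<eta>] by simp
      have "?b \<in> el M (tsem M \<rho> (erase B))"
        using ambient_universe.app_el[OF H(1) _ a] H(2) by simp
      then show "\<exists>a\<in>el M (tsem M \<rho> (erase A)). R1 M \<rho> \<eta> a \<and>
        R2 M \<rho> (\<eta>(n := app M (tsem M \<rho> (erase A)) (tsem M \<rho> (erase B)) (\<eta> m) a))
          (psem M \<rho> ?\<pi> (map (\<lambda>x. \<eta> (fst x)) (\<Gamma> @ \<Delta> @ [(m, Lolli A B)])))"
        using H D(2)[of M \<rho> \<eta>] a 2(2)[of M \<rho> "\<eta>(n := ?b)"] assms(3)
        by (intro bexI[of _ ?a]) (auto simp: butlast_append simp del: fun_upd_apply, simp)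
    qed
  qed
qed

lemma der_tensorR:
  fixes R1 R2 :: "('u, 'v) spec"
  assumes "der w \<Phi> \<Gamma> A R1" "der w \<Phi> \<Delta> B R2"
  shows "der w \<Phi> (\<Gamma> @ \<Delta>) (Tensor A B) (\<lambda>M \<rho> \<eta> v.
    \<exists>a\<in>el M (tsem M \<rho> (erase A)). \<exists>b\<in>el M (tsem M \<rho> (erase B)). R1 M \<rho> \<eta> a \<and> R2 M \<rho> \<eta> b \<and>
      v = pairv M (tsem M \<rho> (erase A)) (tsem M \<rho> (erase B)) a b)"
  using assms(1)
proof (rule derE, goal_cases)
  case (1 \<pi>1)
  note D = this
  from assms(2) show ?case
  proof (rule derE, goal_cases)
    case (1 \<pi>2)
    note 2 = this
    show ?case
    proof (rule derI)
      show "qbal \<Phi> (map snd (\<Gamma> @ \<Delta>)) (Tensor A B) (PProdR (erase A) (erase B) (length \<Gamma>) \<pi>1 \<pi>2)"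
        using q_TensorR[OF D(1) 2(1)] by simp
    next
      fix M :: "('u, 'v) ambient" and \<rho> \<eta>
      assume H: "ambient_universe w M" "typed M \<rho> \<eta> (\<Gamma> @ \<Delta>)"
      show "\<exists>a\<in>el M (tsem M \<rho> (erase A)). \<exists>b\<in>el M (tsem M \<rho> (erase B)). R1 M \<rho> \<eta> a \<and> R2 M \<rho> \<eta> b \<and>
          psem M \<rho> (PProdR (erase A) (erase B) (length \<Gamma>) \<pi>1 \<pi>2) (map (\<lambda>x. \<eta> (fst x)) (\<Gamma> @ \<Delta>)) =
          pairv M (tsem M \<rho> (erase A)) (tsem M \<rho> (erase B)) a b"
        using D(2,3)[of M \<rho> \<eta>] 2(2,3)[of M \<rho> \<eta>] H
        by (intro bexI[of _ "psem M \<rho> \<pi>1 (map (\<lambda>x. \<eta> (fst x)) \<Gamma>)"]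
            bexI[of _ "psem M \<rho> \<pi>2 (map (\<lambda>x. \<eta> (fst x)) \<Delta>)"]) auto
    qed
  qed
qed

lemma der_tensorL:
  fixes R :: "('u, 'v) spec"
  assumes "der w \<Phi> (\<Gamma> @ [(n, A), (m, B)]) C R" "n \<notin> names \<Gamma>" "m \<notin> names \<Gamma>" "n \<noteq> m"
  shows "der w \<Phi> (\<Gamma> @ [(k, Tensor A B)]) C (\<lambda>M \<rho> \<eta>.
    R M \<rho> (\<eta>(n := fstv M (tsem M \<rho> (erase A)) (tsem M \<rho> (erase B)) (\<eta> k),
             m := sndv M (tsem M \<rho> (erase A)) (tsem M \<rho> (erase B)) (\<eta> k))))"
  using assms(1)
proof (rule derE, goal_cases)
  case (1 \<pi>)
  show ?case
  proof (rule derI)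
    show "qbal \<Phi> (map snd (\<Gamma> @ [(k, Tensor A B)])) C (PProdL (erase A) (erase B) \<pi>)"
      using 1(1) q_TensorL[of \<Phi> "map snd \<Gamma>"] by simp
  next
    fix M :: "('u, 'v) ambient" and \<rho> \<eta>
    assume H: "ambient_universe w M" "typed M \<rho> \<eta> (\<Gamma> @ [(k, Tensor A B)])"
    let ?\<eta> = "\<eta>(n := fstv M (tsem M \<rho> (erase A)) (tsem M \<rho> (erase B)) (\<eta> k),
             m := sndv M (tsem M \<rho> (erase A)) (tsem M \<rho> (erase B)) (\<eta> k))"
    have vals: "map (\<lambda>x. ?\<eta> (fst x)) \<Gamma> = map (\<lambda>x. \<eta> (fst x)) \<Gamma>"
      using assms(2,3) by auto
    have "typed M \<rho> ?\<eta> (\<Gamma> @ [(n, A), (m, B)])"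
      using H assms(2-4) ambient_universe.fst_el[OF H(1)] ambient_universe.snd_el[OF H(1)] by simp
    from 1(2)[OF H(1) this]
    show "R M \<rho> ?\<eta> (psem M \<rho> (PProdL (erase A) (erase B) \<pi>)
        (map (\<lambda>x. \<eta> (fst x)) (\<Gamma> @ [(k, Tensor A B)])))"
      using assms(2-4) by (simp add: vals del: fun_upd_apply) simp
  qed
qed

text \<open>Giving the hypotheses the bound of the conclusion loses nothing: \<open>q_PBang\<close>
  asks for bounds at least that large, and the order lowers larger ones.\<close>

lemma der_promote:
  assumes "der w \<Phi>' \<Gamma> B R" "wf_constrs \<Phi>" "respoly p"
    and "csub (wk 1) \<Phi> \<union> {cless (rvar 0) (psub (wk 1) p)} \<Turnstile>s \<Phi>'"
  shows "der w \<Phi> (map (apsnd (Bang p)) \<Gamma>) (Bang p B) R"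
  using assms(1)
proof (rule derE, goal_cases)
  case (1 \<pi>)
  have m: "map2 Bang (replicate (length \<Gamma>) p) (map snd \<Gamma>) = map snd (map (apsnd (Bang p)) \<Gamma>)"
    by (induction \<Gamma>) auto
  have t: "typed M \<rho> \<eta> (map (apsnd (Bang p)) \<Gamma>) = typed M \<rho> \<eta> \<Gamma>" for M :: "('u, 'v) ambient" and \<rho> \<eta>
    by (induction \<Gamma>) auto
  have wf: "wf_seq \<Phi> (map snd (map (apsnd (Bang p)) \<Gamma>)) (Bang p B)"
    using qbal_wf[OF 1(1)] assms(2,3) by (auto simp: wf_seq_def)
  show ?case
  proof (rule derI)
    show "qbal \<Phi> (map snd (map (apsnd (Bang p)) \<Gamma>)) (Bang p B) \<pi>"
      using q_PBang[of \<Phi> "replicate (length \<Gamma>) p" "map snd \<Gamma>" p B \<Phi>' \<pi>] 1(1) wf assms(4)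
      unfolding m by (simp add: entails_def)
  qed (use 1(2) in \<open>simp add: t comp_def\<close>)
qed

lemma der_derelict:
  assumes "der w \<Phi> (\<Gamma> @ [(n, fsub (instr [\<lambda>e. 1]) A)]) B R" "wf_form (Bang p A)" "\<Phi> \<Turnstile> (\<lambda>e. 1, p)"
  shows "der w \<Phi> (\<Gamma> @ [(n, Bang p A)]) B R"
  using assms(1)
proof (rule derE, goal_cases)
  case (1 \<pi>)
  show ?case
  proof (rule derI)
    show "qbal \<Phi> (map snd (\<Gamma> @ [(n, Bang p A)])) B \<pi>"
      using q_DBang[of \<Phi> "map snd \<Gamma>" p A B \<pi>] 1(1) assms(2,3) qbal_wf[OF 1(1)]
      by (simp add: wf_seq_def)
  qed (use 1(2) in simp)
qed

lemma der_contract: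
  assumes "der w \<Phi> (\<Gamma> @ [(n, Bang p A),
      (n, Bang q (fsub (\<lambda>i. if i = 0 then (\<lambda>e. psub (wk 1) p e + e 0) else rvar i) A))]) B R"
    and "respoly r" "\<Phi> \<Turnstile> (\<lambda>e. p e + q e, r)"
  shows "der w \<Phi> (\<Gamma> @ [(n, Bang r A)]) B R"
  using assms(1)
proof (rule derE, goal_cases)
  case (1 \<pi>)
  show ?case
  proof (rule derI)
    show "qbal \<Phi> (map snd (\<Gamma> @ [(n, Bang r A)])) B (PContr \<pi>)"
      unfolding map_append list.map snd_conv
    proof (rule q_Contr)
      show "wf_seq \<Phi> (map snd \<Gamma> @ [Bang r A]) B"
        using qbal_wf[OF 1(1)] assms(2) by (simp add: wf_seq_def)
    qed (use 1(1) assms(3) in \<open>simp_all only: map_append list.map snd_conv\<close>)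
  qed (use 1(2) in simp)
qed

lemma der_allAR:
  fixes R :: "('u, 'v) spec"
  assumes "der w \<Phi> (map (apsnd (ashift k 0)) \<Gamma>) A R"
  shows "der w \<Phi> \<Gamma> (AllA k A) (\<lambda>M \<rho> \<eta> u. \<forall>C.
    R M (bindv k C \<rho>) \<eta> (inst M (\<lambda>C. tsem M (bindv k C \<rho>) (erase A)) u C))"
  using assms(1)
proof (rule derE, goal_cases)
  case (1 \<pi>)
  show ?case
  proof (rule derI)
    show "qbal \<Phi> (map snd \<Gamma>) (AllA k A) (PAllR k (erase A) \<pi>)"
      using 1(1) by (intro q_AllAR) (simp add: comp_def)
  next
    fix M :: "('u, 'v) ambient" and \<rho> \<eta> assume H: "ambient_universe w M" "typed M \<rho> \<eta> \<Gamma>"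
    have t: "typed M (bindv k C \<rho>) \<eta> (map (apsnd (ashift k 0)) \<Gamma>)" for C
      using H(2) by (induction \<Gamma>) auto
    show "\<forall>C. R M (bindv k C \<rho>) \<eta> (inst M (\<lambda>C. tsem M (bindv k C \<rho>) (erase A))
        (psem M \<rho> (PAllR k (erase A) \<pi>) (map (\<lambda>x. \<eta> (fst x)) \<Gamma>)) C)"
      using ambient_universe.tlam_props(2)[OF H(1), of k "map erase (map snd \<Gamma>)" "erase A" \<pi> \<rho>]
        1(4) 1(2)[OF H(1) t] H(2)
      by (simp add: comp_def typed_env_in)
  qed
qed

lemma der_allAL:
  fixes R :: "('u, 'v) spec"
  assumes "der w \<Phi> (\<Gamma> @ [(n, asub k 0 A B)]) C R" "wf_form A" "wf_form B"
    and "\<And>i. i < k \<Longrightarrow> \<not> occ False i B" "n \<notin> names \<Gamma>"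
  shows "der w \<Phi> (\<Gamma> @ [(m, AllA k A)]) C (\<lambda>M \<rho> \<eta>.
    R M \<rho> (\<eta>(n := inst M (\<lambda>C. tsem M (bindv k C \<rho>) (erase A)) (\<eta> m) (tsem M \<rho> (erase B)))))"
  using assms(1)
proof (rule derE, goal_cases)
  case (1 \<pi>)
  show ?case
  proof (rule derI)
    show "qbal \<Phi> (map snd (\<Gamma> @ [(m, AllA k A)])) C (PAllL k (erase A) (erase B) \<pi>)"
      using q_AllAL[of \<Phi> "map snd \<Gamma>" k A C B \<pi>] 1(1) assms(2,3,4) qbal_wf[OF 1(1)]
      by (simp add: wf_seq_def)
  next
    fix M :: "('u, 'v) ambient" and \<rho> \<eta>
    assume H: "ambient_universe w M" "typed M \<rho> \<eta> (\<Gamma> @ [(m, AllA k A)])"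
    let ?a = "inst M (\<lambda>C. tsem M (bindv k C \<rho>) (erase A)) (\<eta> m) (tsem M \<rho> (erase B))"
    have "?a \<in> el M (tsem M \<rho> (erase (asub k 0 A B)))"
      using ambient_universe.inst_el[OF H(1) ambient_universe.definable_fam[OF H(1), of k \<rho> "erase A"]] H(2)
      by (simp add: tsem_tsub_0)
    then have "typed M \<rho> (\<eta>(n := ?a)) (\<Gamma> @ [(n, asub k 0 A B)])"
      using H(2) assms(5) by simp
    from 1(2)[OF H(1) this]
    show "R M \<rho> (\<eta>(n := ?a)) (psem M \<rho> (PAllL k (erase A) (erase B) \<pi>)
        (map (\<lambda>x. \<eta> (fst x)) (\<Gamma> @ [(m, AllA k A)])))"
      using assms(5) by (simp del: fun_upd_apply) simp
  qed
qed

lemma der_adapt: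
  fixes R R' :: "('u, 'v) spec"
  assumes "der w \<Phi> \<Gamma> A R" "mset \<Gamma>' = mset \<Gamma>" "A' = A"
    and "\<And>(M :: ('u, 'v) ambient) \<rho> \<eta> v. ambient_universe w M \<Longrightarrow> typed M \<rho> \<eta> \<Gamma>' \<Longrightarrow>
      v \<in> el M (tsem M \<rho> (erase A)) \<Longrightarrow> R M \<rho> \<eta> v \<Longrightarrow> R' M \<rho> \<eta> v"
  shows "der w \<Phi> \<Gamma>' A' R'"
  unfolding assms(3) by (rule der_conseq[OF der_perm[OF assms(1,2)] assms(4)])

section \<open>Polynomials\<close>

text \<open>Polynomials with natural coefficients, a subclass of the resource polynomials.
  Monotonicity, closure under substitution and control of the variables come by rule induction,
  which the normal form in \<open>respoly\<close> does not offer.\<close>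

inductive npoly :: "nat set \<Rightarrow> rpoly \<Rightarrow> bool" for V where
  npoly_const [intro, simp]: "npoly V (\<lambda>e. c)"
| npoly_var': "x \<in> V \<Longrightarrow> npoly V (\<lambda>e. e x)"
| npoly_add [intro, simp]: "npoly V p \<Longrightarrow> npoly V q \<Longrightarrow> npoly V (\<lambda>e. p e + q e)"
| npoly_mult [intro, simp]: "npoly V p \<Longrightarrow> npoly V q \<Longrightarrow> npoly V (\<lambda>e. p e * q e)"

lemma npoly_var [intro, simp]: "x \<in> V \<Longrightarrow> npoly V (\<lambda>e. e x)" "x \<in> V \<Longrightarrow> npoly V (rvar x)"
  by (simp_all add: npoly_var' rvar_def)

lemma npoly_Suc [intro, simp]: "npoly V p \<Longrightarrow> npoly V (\<lambda>e. Suc (p e))"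
  using npoly_add[of V p "\<lambda>e. 1"] by simp

lemma npoly_sum [intro]: "(\<And>k. k \<in> I \<Longrightarrow> npoly V (f k)) \<Longrightarrow> npoly V (\<lambda>e. \<Sum>k\<in>I. f k e)"
  by (induction I rule: infinite_finite_induct) auto

lemma npoly_agree: "npoly V p \<Longrightarrow> (\<And>x. x \<in> V \<Longrightarrow> e x = e' x) \<Longrightarrow> p e = p e'"
  by (induction rule: npoly.induct) auto

lemma npoly_mono: "npoly V p \<Longrightarrow> (\<And>x. x \<in> V \<Longrightarrow> e x \<le> e' x) \<Longrightarrow> p e \<le> p e'"
  by (induction rule: npoly.induct) (auto intro: add_mono mult_mono)

lemma npoly_fvp: "npoly V p \<Longrightarrow> fvp p \<subseteq> V"
proof -
  assume p: "npoly V p"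
  have "p (e(x := n)) = p e" if "x \<notin> V" for x e n
    by (rule npoly_agree[OF p]) (use that in auto)
  then show ?thesis by (auto simp: fvp_def)
qed

lemma npoly_psub: "npoly V q \<Longrightarrow> (\<And>x. x \<in> V \<Longrightarrow> npoly U (\<sigma> x)) \<Longrightarrow> npoly U (psub \<sigma> q)"
  unfolding psub_def by (induction rule: npoly.induct) auto

lemma npoly_wk [intro, simp]: "npoly UNIV p \<Longrightarrow> npoly UNIV (psub (wk n) p)"
  by (erule npoly_psub) (simp add: wk_def)

section \<open>Polynomials with natural coefficients as resource polynomials\<close>

lemma respoly_const: "respoly (\<lambda>e. c)"
  unfolding respoly_def by (rule exI[of _ "replicate c []"]) (auto simp: sum_list_replicate)

lemma respoly_add: "respoly p \<Longrightarrow> respoly q \<Longrightarrow> respoly (\<lambda>e. p e + q e)"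
  unfolding respoly_def
  by (elim exE conjE, rule_tac x = "ms @ msa" in exI) auto

lemma respoly_smult: "respoly p \<Longrightarrow> respoly (\<lambda>e. c * p e)"
  by (induction c) (auto intro: respoly_const respoly_add)

lemma respoly_monom: "distinct (map fst m) \<Longrightarrow> respoly (\<lambda>e. \<Prod>(x, n)\<leftarrow>m. e x choose n)"
  unfolding respoly_def by (rule exI[of _ "[m]"]) auto

lemma respoly_sum_list: "(\<And>m. m \<in> set ms \<Longrightarrow> respoly (f m)) \<Longrightarrow> respoly (\<lambda>e. \<Sum>m\<leftarrow>ms. f m e)"
  by (induction ms) (auto intro: respoly_const respoly_add)

text \<open>Absorbs a factor \<open>k\<close> into the binomial basis without a second binomial in
  the same variable, as monomials need distinct variables.\<close>

lemma times_choose: "k * (k choose n) = Suc n * (k choose Suc n) + n * (k choose n)"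
  using Suc_times_binomial_eq[of k n] by (simp add: algebra_simps)

text \<open>In a monomial without \<open>x\<close> the factor is a new binomial
  \<open>x choose 1\<close>; otherwise \<open>times_choose\<close> splits the monomial in
  two.\<close>

lemma respoly_var_mult:
  assumes "respoly p"
  shows "respoly (\<lambda>e. e x * p e)"
proof -
  have monom: "respoly (\<lambda>e. e x * (\<Prod>(y, n)\<leftarrow>m. e y choose n))" if "distinct (map fst m)" for m :: "(nat \<times> nat) list"
  proof (cases "x \<in> fst ` set m")
    case False
    then show ?thesis using respoly_monom[of "(x, 1) # m"] that by simp
  next
    case True
    then obtain m1 m2 n where m: "m = m1 @ (x, n) # m2" by (force simp: in_set_conv_decomp)
    have "respoly (\<lambda>e. Suc n * (\<Prod>(y, n)\<leftarrow>m1 @ (x, Suc n) # m2. e y choose n) + n * (\<Prod>(y, n)\<leftarrow>m. e y choose n))"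
      using that by (intro respoly_add respoly_smult respoly_monom) (auto simp: m)
    moreover have "Suc n * (\<Prod>(y, n)\<leftarrow>m1 @ (x, Suc n) # m2. e y choose n) + n * (\<Prod>(y, n)\<leftarrow>m. e y choose n)
      = e x * (\<Prod>(y, n)\<leftarrow>m. e y choose n)" (is "_ * ?a + _ * ?b = _") for e :: "nat \<Rightarrow> nat"
    proof -
      let ?c = "(\<Prod>(y, n)\<leftarrow>m1. e y choose n) * (\<Prod>(y, n)\<leftarrow>m2. e y choose n)"
      have a: "?a = (e x choose Suc n) * ?c" and b: "?b = (e x choose n) * ?c" by (simp_all add: m del: binomial_Suc_Suc)
      have "e x * ?b = (e x * (e x choose n)) * ?c" unfolding b by (simp only: mult.assoc)
      also have "\<dots> = Suc n * ?a + n * ?b" unfolding a b times_choose[of "e x" n] by (simp only: algebra_simps)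
      finally show ?thesis by simp
    qed
    ultimately show ?thesis by simp
  qed
  obtain ms :: "(nat \<times> nat) list list" where ms: "\<forall>m\<in>set ms. distinct (map fst m)"
    "p = (\<lambda>e. \<Sum>m\<leftarrow>ms. \<Prod>(x, n)\<leftarrow>m. e x choose n)"
    using assms unfolding respoly_def by blast
  show ?thesis unfolding ms(2) sum_list_const_mult[symmetric]
    by (rule respoly_sum_list) (use ms(1) monom in auto)
qed

text \<open>The extra factor \<open>r\<close> makes the induction work:
  \<open>(p q) r = p (q r)\<close> reduces products to multiplication by constants and
  variables.\<close>

lemma npoly_mult_respoly: "npoly V p \<Longrightarrow> respoly r \<Longrightarrow> respoly (\<lambda>e. p e * r e)"
proof (induction arbitrary: r rule: npoly.induct)
  case (npoly_add p q)
  then show ?case using respoly_add[OF npoly_add.IH] by (simp add: distrib_right)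
next
  case (npoly_mult p q)
  then show ?case by (simp add: mult.assoc)
qed (simp_all add: respoly_smult respoly_var_mult)

lemma npoly_respoly: "npoly V p \<Longrightarrow> respoly p"
  using npoly_mult_respoly[OF _ respoly_const[of 1]] by simp

lemma respoly_wk: "respoly p \<Longrightarrow> respoly (psub (wk n) p)"
  unfolding respoly_def
proof (elim exE conjE)
  fix ms :: "(nat \<times> nat) list list"
  assume "\<forall>m\<in>set ms. distinct (map fst m)" "p = (\<lambda>e. \<Sum>m\<leftarrow>ms. \<Prod>(x, n)\<leftarrow>m. e x choose n)"
  moreover have "map fst (map (apfst (\<lambda>i. i + n)) m) = map (\<lambda>i. i + n) (map fst m)" for m :: "(nat \<times> nat) list"
    by simp
  ultimately show "\<exists>ms. (\<forall>m\<in>set ms. distinct (map fst m)) \<and>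
      psub (wk n) p = (\<lambda>e. \<Sum>m\<leftarrow>ms. \<Prod>(x, n)\<leftarrow>m. e x choose n)"
    by (intro exI[of _ "map (map (apfst (\<lambda>i. i + n))) ms"])
      (auto simp: distinct_map inj_on_def comp_def case_prod_unfold fun_eq_iff psub_def wk_def rvar_def)
qed

section \<open>Constraints and substitutions\<close>

definition sat :: "constr set \<Rightarrow> (nat \<Rightarrow> nat) \<Rightarrow> bool" where
  "sat \<Phi> e \<longleftrightarrow> (\<forall>(p, q)\<in>\<Phi>. p e \<le> q e)"

lemma entails_sat: "\<Phi> \<Turnstile> (p, q) \<longleftrightarrow> (\<forall>e. sat \<Phi> e \<longrightarrow> p e \<le> q e)"
  by (simp add: entails_def sat_def)

text \<open>The constraints in force inside \<open>Bang p\<close>, as in \<open>le_Bang\<close> and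
  \<open>q_PBang\<close>.\<close>

definition below :: "constr set \<Rightarrow> rpoly \<Rightarrow> constr set" where
  "below \<Phi> p = csub (wk 1) \<Phi> \<union> {cless (rvar 0) (psub (wk 1) p)}"

lemma psub_wk [simp]: "psub (wk n) p e = p (\<lambda>i. e (i + n))"
  by (simp add: psub_def wk_def rvar_def)

lemma sat_below: "sat (below \<Phi> p) e \<longleftrightarrow> sat \<Phi> (\<lambda>i. e (Suc i)) \<and> e 0 < p (\<lambda>i. e (Suc i))"
  by (simp add: sat_def below_def csub_def cless_def rvar_def ball_Un case_prod_unfold Suc_le_eq conj_commute)

lemma wf_below: "wf_constrs \<Phi> \<Longrightarrow> respoly p \<Longrightarrow> wf_constrs (below \<Phi> p)"
  unfolding wf_constrs_def below_def
  by (auto simp: csub_def cless_def intro!: respoly_wk)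
     (rule npoly_respoly[of UNIV], simp add: rvar_def)

lemma lift_comp: "psub (lift n \<sigma>) (lift n \<tau> i) = lift n (\<lambda>j. psub \<sigma> (\<tau> j)) i"
  by (auto simp: lift_def psub_def wk_def rvar_def fun_eq_iff)

lemma csub_csub: "csub \<sigma> (csub \<tau> \<Phi>) = csub (\<lambda>i. psub \<sigma> (\<tau> i)) \<Phi>"
  unfolding csub_def image_image by (rule image_cong) (auto simp: psub_def)

lemma fsub_fsub: "fsub \<sigma> (fsub \<tau> A) = fsub (\<lambda>i. psub \<sigma> (\<tau> i)) A"
  by (induction A arbitrary: \<sigma> \<tau>) (auto simp: lift_comp csub_csub, auto simp: psub_def)

lemma lift_rvar [simp]: "lift n rvar = rvar"
  by (auto simp: lift_def psub_def wk_def rvar_def fun_eq_iff)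

lemma fsub_rvar [simp]: "fsub rvar A = A"
proof -
  have [simp]: "psub rvar p = p" for p by (simp add: psub_def rvar_def)
  then have [simp]: "psub rvar = (\<lambda>p. p)" by (simp add: fun_eq_iff)
  have [simp]: "csub rvar \<Phi> = \<Phi>" for \<Phi> by (simp add: csub_def map_prod_def)
  show ?thesis by (induction A) auto
qed

lemma entails_all_Un: "\<Phi> \<union> \<Psi> \<Turnstile>s \<Psi>"
  by (fastforce simp: entails_def entails_all_def)

lemma le_form_refl: "le_form \<Phi> A A"
  by (induction A arbitrary: \<Phi>)
    (auto intro!: le_form.intros list_all2_refl entails_all_Un simp: entails_sat)

section \<open>Church words\<close>

definition wstep :: form where
  "wstep = Lolli (Atom 0 [rvar 0]) (Atom 0 [\<lambda>e. e 0 + 1])"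

definition wbody :: "nat \<Rightarrow> rpoly \<Rightarrow> rpoly \<Rightarrow> rpoly \<Rightarrow> form" where
  "wbody w a p b = (Lolli (Bang p wstep) ^^ w) (Lolli (Atom 0 [a]) (Atom 0 [b]))"

text \<open>Start, bound on the steps and end of the iteration are separate, so that words with
  start \<open>\<alpha>(0)\<close> and with start \<open>\<alpha>(1)\<close> are both
  instances.\<close>

definition Wgen :: "nat \<Rightarrow> rpoly \<Rightarrow> rpoly \<Rightarrow> rpoly \<Rightarrow> form" where
  "Wgen w a p b = AllA 1 (wbody w a p b)"

lemma Wform_eq: "Wform w p = Wgen w (\<lambda>e. 0) p p"
  by (simp add: Wform_def Wgen_def wbody_def wstep_def)

lemma fsub_wstep: "fsub (lift (Suc 0) \<sigma>) wstep = wstep"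
  by (auto simp: wstep_def psub_def lift_def rvar_def)

lemma fsub_Wgen [simp]: "fsub \<sigma> (Wgen w a p b) = Wgen w (psub \<sigma> a) (psub \<sigma> p) (psub \<sigma> b)"
proof -
  have "fsub \<sigma> ((Lolli A ^^ w) B) = (Lolli (fsub \<sigma> A) ^^ w) (fsub \<sigma> B)" for A B
    by (induction w) auto
  then show ?thesis by (simp add: Wgen_def wbody_def fsub_wstep)
qed

lemma ashift_Wgen [simp]: "ashift 1 0 (Wgen w a p b) = Wgen w a p b"
proof -
  have "ashift 1 c ((Lolli A ^^ w) B) = (Lolli (ashift 1 c A) ^^ w) (ashift 1 c B)" for A B c
    by (induction w) auto
  then show ?thesis by (simp add: Wgen_def wbody_def wstep_def)
qed

lemma wf_wstep [simp]: "wf_form wstep"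
  using npoly_respoly[of UNIV "rvar 0"] npoly_respoly[of UNIV "\<lambda>e. e 0 + 1"] by (simp add: wstep_def)

lemma wf_Wgen [simp]: "npoly UNIV a \<Longrightarrow> npoly UNIV p \<Longrightarrow> npoly UNIV b \<Longrightarrow> wf_form (Wgen w a p b)"
proof -
  have "wf_form ((Lolli A ^^ w) B)" if "wf_form A" "wf_form B" for A B
    using that by (induction w) auto
  then show "npoly UNIV a \<Longrightarrow> npoly UNIV p \<Longrightarrow> npoly UNIV b \<Longrightarrow> wf_form (Wgen w a p b)"
    by (simp add: Wgen_def wbody_def npoly_respoly)
qed

text \<open>The bound \<open>p\<close> of the modality stands to the left of \<multimap>, so two
  reversals of the order cancel; the start \<open>a\<close> is reversed once.\<close>

lemma le_Wgen:
  assumes "\<Phi> \<Turnstile> (a', a)" "\<Phi> \<Turnstile> (p, p')" "\<Phi> \<Turnstile> (b, b')"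
  shows "le_form \<Phi> (Wgen w a p b) (Wgen w a' p' b')"
proof -
  have *: "le_form \<Phi> ((Lolli A ^^ w) B) ((Lolli A' ^^ w) B')"
    if "le_form \<Phi> A' A" "le_form \<Phi> B B'" for A A' B B'
    using that by (induction w) (auto intro: le_form.intros)
  show ?thesis
    unfolding Wgen_def wbody_def
    by (intro le_AllA * le_Lolli le_Atom le_Bang le_form_refl) (use assms in simp_all)
qed

text \<open>\<open>p\<close> occurs positively, by two reversals, and the variable of
  \<open>wstep\<close> is bound. So with a closed start the size of a word may depend on the
  variable of an iteration state.\<close>

lemma not_occ_Wgen [simp]:
  assumes "x \<notin> fvp a"
  shows "\<not> occ False x (Wgen w a p b)"
proof -
  have "fvp (rvar 0) = {0}" "fvp (\<lambda>e. Suc (e 0)) = {0}"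
    using npoly_fvp[of "{0}" "\<lambda>e. Suc (e 0)"] npoly_fvp[of "{0}" "rvar 0"]
    by (auto simp: fvp_def rvar_def)
  then have "\<not> occ s (Suc x) wstep" for s by (simp add: wstep_def)
  then have "occ False x ((Lolli (Bang p wstep) ^^ w) B) = occ False x B" for B
    by (induction w) auto
  then show ?thesis using assms by (simp add: Wgen_def wbody_def)
qed

section \<open>Meaning of Church words and canonical representations\<close>

lemma tsem_funpow_TFun:
  "tsem M \<rho> T = fn M C C \<Longrightarrow> tsem M \<rho> S = fn M C C \<Longrightarrow> tsem M \<rho> ((TFun T ^^ n) S) = wfun M n C"
  by (induction n) auto

lemma erase_funpow_Lolli: "erase ((Lolli A ^^ n) B) = (TFun (erase A) ^^ n) (erase B)"
  by (induction n) auto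

lemma bindv_0 [simp]: "bindv k C \<rho> k 0 = C"
  by (simp add: bindv_def)

lemma tsem_wbody: "tsem M (bindv 1 C \<rho>) (erase (wbody w a p b)) = wfun M w C"
  by (simp add: wbody_def erase_funpow_Lolli tsem_funpow_TFun wstep_def bindv_def)

text \<open>Words of all sizes have the same meaning, which allows coercions between sizes to be
  identities.\<close>

lemma tsem_Wgen [simp]: "tsem M \<rho> (erase (Wgen w a p b)) = pi M (wfun M w)"
  unfolding Wgen_def erase.simps tsem.simps tsem_wbody ..

text \<open>The property behind the definite description \<open>phi\<close>. As a relation it can be
  used before existence is known, and existence is later obtained from the derivations
  themselves.\<close>

definition wrep :: "nat \<Rightarrow> ('u, 'v) ambient \<Rightarrow> word \<Rightarrow> 'v \<Rightarrow> bool" where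
  "wrep w M t u \<longleftrightarrow> t \<in> words w \<and> u \<in> el M (pi M (wfun M w)) \<and>
     (\<forall>C fs z. length fs = w \<and> set fs \<subseteq> el M (fn M C C) \<and> z \<in> el M C \<longrightarrow>
        wapp M C fs z (inst M (wfun M w) u C) = wval M C fs z t)"

text \<open>An element of the product is determined by its components, and a component by its values
  under \<open>wapp\<close>, through extensionality for each of its \<open>w + 1\<close>
  arguments.\<close>

lemma (in ambient_universe) wrep_unique:
  assumes "wrep w M t u" "wrep w M t v"
  shows "u = v"
proof -
  \<comment> \<open>\<open>wfun M w\<close> is the meaning of an erased \<open>wbody\<close> with
    any sizes, hence a definable family.\<close>
  have fam: "wfun M w \<in> fam M"
    using definable_fam[of 1 undefined "erase (wbody w a p b)" for a p b] unfolding tsem_wbody .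
  have ext: "f = g" if "f \<in> el M (wfun M n C)" "g \<in> el M (wfun M n C)"
    "\<And>fs z. length fs = n \<Longrightarrow> set fs \<subseteq> el M (fn M C C) \<Longrightarrow> z \<in> el M C \<Longrightarrow> wapp M C fs z f = wapp M C fs z g"
    for f g n C
    using that
  proof (induction n arbitrary: f g)
    case 0
    show ?case
    proof (rule app_ext)
      show "f \<in> el M (fn M C C)" "g \<in> el M (fn M C C)" using 0(1,2) by auto
      show "app M C C f a = app M C C g a" if "a \<in> el M C" for a
        using 0(3)[of "[]" a] that by simp
    qed
  next
    case (Suc n)
    show ?case
    proof (rule app_ext)
      show "f \<in> el M (fn M (fn M C C) (wfun M n C))" "g \<in> el M (fn M (fn M C C) (wfun M n C))"
        using Suc.prems by auto
      fix a assume a: "a \<in> el M (fn M C C)"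
      show "app M (fn M C C) (wfun M n C) f a = app M (fn M C C) (wfun M n C) g a"
      proof (rule Suc.IH)
        fix fs z assume "length fs = n" "set fs \<subseteq> el M (fn M C C)" "z \<in> el M C"
        then show "wapp M C fs z (app M (fn M C C) (wfun M n C) f a) =
            wapp M C fs z (app M (fn M C C) (wfun M n C) g a)"
          using Suc.prems(3)[of "a # fs" z] a by simp
      qed (use Suc.prems a in \<open>auto intro: app_el\<close>)
    qed
  qed
  show ?thesis
  proof (rule inst_ext[OF fam])
    show "inst M (wfun M w) u C = inst M (wfun M w) v C" for C
      by (rule ext[where n = w and C = C]) (use assms in \<open>auto simp: wrep_def intro: inst_el[OF fam]\<close>)
  qed (use assms in \<open>auto simp: wrep_def\<close>)
qed

section \<open>Introduction and elimination of Church words\<close>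

lemma der_lolliR_list:
  fixes R :: "('u, 'v) spec"
  assumes "der w \<Phi> (\<Gamma> @ map (\<lambda>k. (k, A)) ks @ [(m, A0)]) B R"
    and "distinct (ks @ [m])" "set (ks @ [m]) \<inter> names \<Gamma> = {}"
    and "erase A = TFun T T" "erase A0 = T" "erase B = T"
  shows "der w \<Phi> \<Gamma> ((Lolli A ^^ (length ks)) (Lolli A0 B)) (\<lambda>M \<rho> \<eta> u. \<forall>fs z.
    length fs = length ks \<longrightarrow> set fs \<subseteq> el M (fn M (tsem M \<rho> T) (tsem M \<rho> T)) \<longrightarrow> z \<in> el M (tsem M \<rho> T) \<longrightarrow>
    R M \<rho> ((fold (\<lambda>(k, f) \<eta>. \<eta>(k := f)) (zip ks fs) \<eta>)(m := z)) (wapp M (tsem M \<rho> T) fs z u))"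
  using assms(1-3)
proof (induction ks arbitrary: \<Gamma>)
  case Nil
  have *: "(Lolli A ^^ length ([] :: nat list)) (Lolli A0 B) = Lolli A0 B" by simp
  have "der w \<Phi> (\<Gamma> @ [(m, A0)]) B R" using Nil by simp
  from der_lolliR[OF this] show ?case
    unfolding * by (rule der_conseq) (use Nil in \<open>auto simp: assms fun_upd_def\<close>)
next
  case (Cons k ks)
  have "der w \<Phi> (\<Gamma> @ [(k, A)]) ((Lolli A ^^ (length ks)) (Lolli A0 B)) (\<lambda>M \<rho> \<eta> u. \<forall>fs z.
    length fs = length ks \<longrightarrow> set fs \<subseteq> el M (fn M (tsem M \<rho> T) (tsem M \<rho> T)) \<longrightarrow> z \<in> el M (tsem M \<rho> T) \<longrightarrow>
    R M \<rho> ((fold (\<lambda>(k, f) \<eta>. \<eta>(k := f)) (zip ks fs) \<eta>)(m := z)) (wapp M (tsem M \<rho> T) fs z u))"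
    using Cons.prems by (intro Cons.IH) auto
  then have "der w \<Phi> \<Gamma> (Lolli A ((Lolli A ^^ (length ks)) (Lolli A0 B))) (\<lambda>M \<rho> \<eta> f. \<forall>a\<in>el M (tsem M \<rho> (erase A)).
    (\<forall>fs z. length fs = length ks \<longrightarrow> set fs \<subseteq> el M (fn M (tsem M \<rho> T) (tsem M \<rho> T)) \<longrightarrow> z \<in> el M (tsem M \<rho> T) \<longrightarrow>
    R M \<rho> ((fold (\<lambda>(k, f) \<eta>. \<eta>(k := f)) (zip ks fs) (\<eta>(k := a)))(m := z))
      (wapp M (tsem M \<rho> T) fs z (app M (tsem M \<rho> (erase A)) (tsem M \<rho> (erase ((Lolli A ^^ (length ks)) (Lolli A0 B)))) f a))))"
    using Cons.prems by (intro der_lolliR) (auto simp del: fun_upd_apply)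
  then show ?case
  proof (rule der_adapt, goal_cases)
    case (3 M \<rho> \<eta> v)
    have t: "tsem M \<rho> (erase ((Lolli A ^^ (length ks)) (Lolli A0 B))) = wfun M (length ks) (tsem M \<rho> T)"
      by (simp add: erase_funpow_Lolli assms tsem_funpow_TFun)
    show ?case
      using 3(4) unfolding t
      by (auto simp: length_Suc_conv assms simp del: fun_upd_apply)
  qed (use Cons.prems in auto)
qed

lemma fold_upd_upt:
  "length fs = w \<Longrightarrow> (fold (\<lambda>(k, f) \<eta>. \<eta>(k := f)) (zip [0..<w] fs) \<eta>) n = (if n < w then fs ! n else \<eta> n)"
proof (induction fs arbitrary: w n rule: rev_induct)
  case (snoc f fs)
  then show ?case by (cases w) (auto simp: nth_append)
qed simp

text \<open>Naming convention of all iterations: names below \<open>w\<close> are the step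
  functions, \<open>w\<close> is the start value, and the context uses larger names.\<close>

lemma der_Wgen_intro:
  fixes R :: "('u, 'v) spec"
  assumes "der w \<Phi> (map (apsnd (ashift 1 0)) \<Gamma> @ map (\<lambda>k. (k, Bang p wstep)) [0..<w] @ [(w, Atom 0 [a])])
      (Atom 0 [b]) R"
    and "\<And>n. n \<in> names \<Gamma> \<Longrightarrow> w < n"
  shows "der w \<Phi> \<Gamma> (Wgen w a p b) (\<lambda>M \<rho> \<eta> u. \<forall>C fs z.
    length fs = w \<longrightarrow> set fs \<subseteq> el M (fn M C C) \<longrightarrow> z \<in> el M C \<longrightarrow>
    R M (bindv 1 C \<rho>) (\<lambda>n. if n < w then fs ! n else if n = w then z else \<eta> n)
      (wapp M C fs z (inst M (wfun M w) u C)))"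
proof -
  have fresh: "w < n" if "(n, A) \<in> set \<Gamma>" for n A
    using assms(2)[of n] that by force
  have "der w \<Phi> (map (apsnd (ashift 1 0)) \<Gamma>) ((Lolli (Bang p wstep) ^^ (length [0..<w]))
      (Lolli (Atom 0 [a]) (Atom 0 [b]))) (\<lambda>M \<rho> \<eta> u. \<forall>fs z.
    length fs = length [0..<w] \<longrightarrow> set fs \<subseteq> el M (fn M (tsem M \<rho> (TAtom 1 0)) (tsem M \<rho> (TAtom 1 0))) \<longrightarrow>
    z \<in> el M (tsem M \<rho> (TAtom 1 0)) \<longrightarrow>
    R M \<rho> ((fold (\<lambda>(k, f) \<eta>. \<eta>(k := f)) (zip [0..<w] fs) \<eta>)(w := z)) (wapp M (tsem M \<rho> (TAtom 1 0)) fs z u))"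
    using assms(1) by (intro der_lolliR_list) (auto simp: wstep_def dest: fresh)
  from der_allAR[OF this[folded wbody_def, simplified length_upt diff_zero, folded wbody_def]]
  have "der w \<Phi> \<Gamma> (Wgen w a p b) (\<lambda>M \<rho> \<eta> u. \<forall>C fs z.
    length fs = w \<longrightarrow> set fs \<subseteq> el M (fn M C C) \<longrightarrow> z \<in> el M C \<longrightarrow>
    R M (bindv 1 C \<rho>) ((fold (\<lambda>(k, f) \<eta>. \<eta>(k := f)) (zip [0..<w] fs) \<eta>)(w := z))
      (wapp M C fs z (inst M (wfun M w) u C)))"
    unfolding Wgen_def tsem_wbody by (simp del: fun_upd_apply)
  moreover have "(fold (\<lambda>(k, f) \<eta>. \<eta>(k := f)) (zip [0..<w] fs) \<eta>)(w := z) =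
      (\<lambda>n. if n < w then fs ! n else if n = w then z else \<eta> n)" if "length fs = w" for fs z and \<eta> :: "nat \<Rightarrow> 'v"
    using that by (auto simp: fold_upd_upt)
  ultimately show ?thesis by (elim der_conseq) simp
qed

lemma der_lolliL_list:
  fixes w :: nat
  assumes "wf_constrs \<Phi>" "wf_form A" "wf_form A0" "wf_form B"
    and "u \<notin> set ks" "u \<noteq> m"
    and "erase A = TFun T T" "erase A0 = T" "erase B = T"
  shows "der w \<Phi> (map (\<lambda>k. (k, A)) ks @ [(m, A0), (u, (Lolli A ^^ (length ks)) (Lolli A0 B))]) B
    (\<lambda>(M :: ('u, 'v) ambient) \<rho> \<eta> v. v = wapp M (tsem M \<rho> T) (map \<eta> ks) (\<eta> m) (\<eta> u))"
  using assms(5)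
proof (induction ks)
  case Nil
  from der_lolliL[OF der_ax[OF assms(1,3,3) le_form_refl] , where \<Delta> = "[]", simplified, OF der_ax[OF assms(1,4,4) le_form_refl]]
  have "der w \<Phi> [(m, A0), (u, Lolli A0 B)] B (\<lambda>(M :: ('u, 'v) ambient) \<rho> \<eta> v. \<eta> m \<in> el M (tsem M \<rho> (erase A0)) \<and>
    v = (\<eta>(u := app M (tsem M \<rho> (erase A0)) (tsem M \<rho> (erase B)) (\<eta> u) (\<eta> m))) u)" by simp
  then show ?case by simp (erule der_conseq, simp add: assms)
next
  case (Cons k ks)
  then have u: "u \<notin> names (map (\<lambda>k. (k, A)) ks @ [(m, A0)])" using assms(6) by auto
  have "der w \<Phi> ((map (\<lambda>k. (k, A)) ks @ [(m, A0)]) @ [(u, (Lolli A ^^ (length ks)) (Lolli A0 B))]) B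
    (\<lambda>(M :: ('u, 'v) ambient) \<rho> \<eta> v. v = wapp M (tsem M \<rho> T) (map \<eta> ks) (\<eta> m) (\<eta> u))"
    using Cons by simp
  from der_lolliL[OF der_ax[OF assms(1,2,2) le_form_refl] this u, of k u]
  show ?case
  proof (rule der_adapt, goal_cases)
    case (3 M \<rho> \<eta> v)
    have t: "tsem M \<rho> (erase ((Lolli A ^^ (length ks)) (Lolli A0 B))) = wfun M (length ks) (tsem M \<rho> T)"
      by (simp add: erase_funpow_Lolli assms tsem_funpow_TFun)
    have m: "map (\<eta>(u := x)) ks = map \<eta> ks" for x using Cons.prems by auto
    show ?case using 3(4) assms(6) unfolding t by (simp add: assms m)
  qed simp_all
qed

definition psuc :: rsubst where
  "psuc = (\<lambda>i. if i = 0 then (\<lambda>e. Suc (e 0)) else rvar i)"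

text \<open>Iteration with state \<open>B\<close>, whose variable 0 counts the steps. The condition
  on \<open>occ\<close> is the positivity that \<open>q_AllAL\<close> demands.\<close>

lemma der_Wgen_elim:
  fixes w :: nat
  assumes "wf_constrs \<Phi>" "npoly UNIV a" "npoly UNIV p" "npoly UNIV b"
    and "wf_form B" "wf_form (fsub psuc B)" "wf_form (fsub (instr [a]) B)" "wf_form (fsub (instr [b]) B)"
    and "\<not> occ False 0 B"
  shows "der w \<Phi> (map (\<lambda>k. (k, Bang p (Lolli B (fsub psuc B)))) [0..<w] @
      [(w, fsub (instr [a]) B), (Suc w, Wgen w a p b)]) (fsub (instr [b]) B)
    (\<lambda>(M :: ('u, 'v) ambient) \<rho> \<eta> v. \<forall>t. wrep w M t (\<eta> (Suc w)) \<longrightarrow>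
      v = wval M (tsem M \<rho> (erase B)) (map \<eta> [0..<w]) (\<eta> w) t)"
proof -
  let ?A = "Bang p (Lolli B (fsub psuc B))"
  let ?\<Gamma> = "map (\<lambda>k. (k, ?A)) [0..<w] @ [(w, fsub (instr [a]) B)]"
  \<comment> \<open>In \<open>\<alpha>(y) \<multimap> \<alpha>(y+1)\<close> the substitution takes
    place below the binder of y, and the variable of \<open>B\<close> becomes that y: argument y
    gives \<open>B\<close> back, argument y + 1 gives \<open>fsub psuc B\<close>.\<close>
  have inst_wk: "fsub (instr [c]) (fsub (lift 1 (wk 1)) B) = fsub (\<lambda>i. if i = 0 then c else rvar i) B" for c
    unfolding fsub_fsub by (rule arg_cong[of _ _ "\<lambda>\<sigma>. fsub \<sigma> B"])
      (auto simp: fun_eq_iff psub_def lift_def instr_def rvar_def wk_def)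
  have asub_funpow: "asub 1 0 ((Lolli A ^^ n) A') B =
      (Lolli (asub 1 0 A B) ^^ n) (asub 1 0 A' B)" for n A A'
    by (induction n) auto
  have "(\<lambda>i. if i = 0 then rvar 0 else rvar i) = rvar" by auto
  then have "asub 1 0 (Bang p wstep) B = ?A"
    using inst_wk by (simp add: wstep_def psuc_def)
  then have asub: "asub 1 0 (wbody w a p b) B =
      (Lolli ?A ^^ w) (Lolli (fsub (instr [a]) B) (fsub (instr [b]) B))"
    unfolding wbody_def asub_funpow by simp
  have wf: "wf_form ?A" using assms by (simp add: npoly_respoly)
  have wfb: "wf_form (wbody w a p b)" using wf_Wgen[OF assms(2,3,4), of w] by (simp add: Wgen_def)
  have "der w \<Phi> (map (\<lambda>k. (k, ?A)) [0..<w] @ [(w, fsub (instr [a]) B),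
      (Suc w, (Lolli ?A ^^ (length [0..<w])) (Lolli (fsub (instr [a]) B) (fsub (instr [b]) B)))])
      (fsub (instr [b]) B)
      (\<lambda>(M :: ('u, 'v) ambient) \<rho> \<eta> v. v = wapp M (tsem M \<rho> (erase B)) (map \<eta> [0..<w]) (\<eta> w) (\<eta> (Suc w)))"
    by (rule der_lolliL_list) (use assms wf in auto)
  then have "der w \<Phi> (?\<Gamma> @ [(Suc w, asub 1 0 (wbody w a p b) B)]) (fsub (instr [b]) B)
      (\<lambda>(M :: ('u, 'v) ambient) \<rho> \<eta> v. v = wapp M (tsem M \<rho> (erase B)) (map \<eta> [0..<w]) (\<eta> w) (\<eta> (Suc w)))"
    unfolding asub by simp
  from der_allAL[OF this wfb assms(5), of "Suc w"]
  have "der w \<Phi> (?\<Gamma> @ [(Suc w, Wgen w a p b)]) (fsub (instr [b]) B) (\<lambda>(M :: ('u, 'v) ambient) \<rho> \<eta> v.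
      v = wapp M (tsem M \<rho> (erase B)) (map \<eta> [0..<w]) (\<eta> w) (inst M (wfun M w) (\<eta> (Suc w)) (tsem M \<rho> (erase B))))"
    using assms(9) unfolding tsem_wbody Wgen_def by (auto simp: image_iff)
  then show ?thesis
  proof (rule der_adapt, goal_cases)
    case (3 M \<rho> \<eta> v)
    from 3(2) have "set (map \<eta> [0..<w]) \<subseteq> el M (fn M (tsem M \<rho> (erase B)) (tsem M \<rho> (erase B)))"
      "\<eta> w \<in> el M (tsem M \<rho> (erase B))"
      by (auto simp: typed_def)
    then show ?case using 3(4) by (auto simp: wrep_def)
  qed simp_all
qed

text \<open>Cutting name \<open>j\<close> changes the environment at \<open>j\<close>, which the
  specifications of the other premises must not notice; hence they may depend only on names from
  \<open>h\<close> on.\<close>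

lemma der_multicut:
  fixes R :: "('u, 'v) spec" and S :: "nat \<Rightarrow> ('u, 'v) spec"
  assumes "\<And>k. k < h \<Longrightarrow> der w \<Phi> (G k) (A k) (S k)"
    and "der w \<Phi> (map (\<lambda>k. (k, A k)) [0..<h] @ \<Delta>) B R"
    and "\<And>n. n \<in> names \<Delta> \<Longrightarrow> h \<le> n" "\<And>k n. k < h \<Longrightarrow> n \<in> names (G k) \<Longrightarrow> h \<le> n"
    and inv: "\<And>k (M :: ('u, 'v) ambient) \<rho> \<eta> \<eta>' v. k < h \<Longrightarrow> (\<And>n. h \<le> n \<Longrightarrow> \<eta> n = \<eta>' n) \<Longrightarrow> S k M \<rho> \<eta> v \<Longrightarrow> S k M \<rho> \<eta>' v"
  shows "der w \<Phi> (concat (map G [0..<h]) @ \<Delta>) B (\<lambda>M \<rho> \<eta> v. \<exists>as. length as = h \<and>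
    (\<forall>k<h. as ! k \<in> el M (tsem M \<rho> (erase (A k))) \<and> S k M \<rho> \<eta> (as ! k)) \<and>
    R M \<rho> (\<lambda>n. if n < h then as ! n else \<eta> n) v)"
proof -
  have "der w \<Phi> (concat (map G [0..<j]) @ map (\<lambda>k. (k, A k)) [j..<h] @ \<Delta>) B (\<lambda>M \<rho> \<eta> v. \<exists>as. length as = j \<and>
    (\<forall>k<j. as ! k \<in> el M (tsem M \<rho> (erase (A k))) \<and> S k M \<rho> \<eta> (as ! k)) \<and>
    R M \<rho> (\<lambda>n. if n < j then as ! n else \<eta> n) v)" if "j \<le> h" for j
    using that
  proof (induction j)
    case 0
    then show ?case using assms(2) by simp
  next
    case (Suc j)
    let ?\<Delta> = "concat (map G [0..<j]) @ map (\<lambda>k. (k, A k)) [Suc j..<h] @ \<Delta>"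
    have j: "[j..<h] = j # [Suc j..<h]" using Suc.prems by (simp add: upt_conv_Cons)
    have "j \<notin> names (concat (map G [0..<j]))"
    proof
      assume "j \<in> names (concat (map G [0..<j]))"
      then obtain k b where "k < j" "(j, b) \<in> set (G k)" by auto
      then show False using assms(4)[of k j] Suc.prems by force
    qed
    moreover have "j \<notin> names \<Delta>"
      using assms(3)[of j] Suc.prems by auto
    ultimately have "j \<notin> names ?\<Delta>" by auto
    with Suc have "der w \<Phi> (G j @ ?\<Delta>) B (\<lambda>M \<rho> \<eta> v.
      \<exists>a\<in>el M (tsem M \<rho> (erase (A j))). S j M \<rho> \<eta> a \<and> (\<exists>as. length as = j \<and>
    (\<forall>k<j. as ! k \<in> el M (tsem M \<rho> (erase (A k))) \<and> S k M \<rho> (\<eta>(j := a)) (as ! k)) \<and>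
    R M \<rho> (\<lambda>n. if n < j then as ! n else (\<eta>(j := a)) n) v))"
      by (intro der_cut[OF assms(1)]) (auto intro: der_perm simp: j)
    then show ?case
    proof (rule der_conseq[OF der_perm], goal_cases)
      case 1
      then show ?case by simp
    next
      case (2 M \<rho> \<eta> v)
      then obtain a as where a: "a \<in> el M (tsem M \<rho> (erase (A j)))" "S j M \<rho> \<eta> a" "length as = j"
        "\<And>k. k < j \<Longrightarrow> as ! k \<in> el M (tsem M \<rho> (erase (A k)))"
        "\<And>k. k < j \<Longrightarrow> S k M \<rho> (\<eta>(j := a)) (as ! k)"
        "R M \<rho> (\<lambda>n. if n < j then as ! n else (\<eta>(j := a)) n) v" by blast
      have "S k M \<rho> \<eta> (as ! k)" if "k < j" for k
        by (rule inv[OF _ _ a(5)]) (use that Suc.prems in auto)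
      moreover have "(\<lambda>n. if n < j then as ! n else (\<eta>(j := a)) n) =
          (\<lambda>n. if n < Suc j then (as @ [a]) ! n else \<eta> n)"
        using a(3) by (auto simp: fun_eq_iff nth_append less_Suc_eq)
      ultimately show ?case
        using a by (intro exI[of _ "as @ [a]"]) (auto simp: nth_append less_Suc_eq)
    qed
  qed
  from this[of h] show ?thesis by simp
qed

section \<open>Operations on words\<close>

text \<open>
  Dereliction yields the instance \<open>A{1/x}\<close>, never \<open>A{0/x}\<close>, so that \<open>\<alpha>(0) \<multimap> \<alpha>(1)\<close> cannot be used
  and a successor on \<open>W\<^sub>p\<close> does not have type \<open>W\<^bsub>p+1\<^esub>\<close>. Words whose iterations start at \<open>\<alpha>(1)\<close>
  have an exact successor.
\<close>

definition Zform :: "nat \<Rightarrow> rpoly \<Rightarrow> form" where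
  "Zform w p = Wgen w (\<lambda>e. 1) p (\<lambda>e. p e + 1)"

definition isw :: "nat \<Rightarrow> ('u, 'v) ambient \<Rightarrow> 'v \<Rightarrow> bool" where
  "isw w M u \<longleftrightarrow> (\<exists>t. wrep w M t u)"

lemmas npoly_respoly_UNIV [simp] = npoly_respoly[of UNIV]

lemma psub_const [simp]: "psub \<sigma> (\<lambda>e. c) = (\<lambda>e. c)"
  by (simp add: psub_def)

lemma fsub_Wform [simp]: "fsub \<sigma> (Wform w p) = Wform w (psub \<sigma> p)"
  by (simp add: Wform_eq)

lemma fsub_Zform [simp]: "fsub \<sigma> (Zform w p) = Zform w (psub \<sigma> p)"
  by (simp add: Zform_def psub_def)

lemma wf_Wform [simp]: "npoly UNIV p \<Longrightarrow> wf_form (Wform w p)"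
  by (simp add: Wform_eq)

lemma wf_Zform [simp]: "npoly UNIV p \<Longrightarrow> wf_form (Zform w p)"
  by (simp add: Zform_def)

lemma fvp_const [simp]: "fvp (\<lambda>e. c) = {}"
  by (simp add: fvp_def)

lemma not_occ_Wform [simp]: "\<not> occ False x (Wform w p)"
  by (simp add: Wform_eq)

lemma not_occ_Zform [simp]: "\<not> occ False x (Zform w p)"
  by (simp add: Zform_def)

lemma tsem_Wform [simp]: "tsem M \<rho> (erase (Wform w p)) = pi M (wfun M w)"
  by (simp add: Wform_eq)

lemma tsem_Zform [simp]: "tsem M \<rho> (erase (Zform w p)) = pi M (wfun M w)"
  by (simp add: Zform_def)

lemma le_Wform: "\<Phi> \<Turnstile> (p, q) \<Longrightarrow> le_form \<Phi> (Wform w p) (Wform w q)"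
  unfolding Wform_eq by (rule le_Wgen) (auto simp: entails_sat)

text \<open>The charge of 1 for taking a word out of its store: the end point \<open>p + 1\<close>
  becomes the size, and the start drops from 1 to 0.\<close>

lemma le_Zform_Wform: "le_form \<Phi> (Zform w p) (Wform w (\<lambda>e. p e + 1))"
  unfolding Wform_eq Zform_def by (rule le_Wgen) (auto simp: entails_sat)

lemma wrep_words: "wrep w M t u \<Longrightarrow> t \<in> words w"
  by (simp add: wrep_def)

lemma wrepI:
  assumes "t \<in> words w" "u \<in> el M (pi M (wfun M w))"
    and "\<And>C fs z. length fs = w \<Longrightarrow> set fs \<subseteq> el M (fn M C C) \<Longrightarrow> z \<in> el M C \<Longrightarrow>
      wapp M C fs z (inst M (wfun M w) u C) = wval M C fs z t"
  shows "wrep w M t u"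
  using assms by (simp add: wrep_def)

lemma der_coerce_list:
  fixes R :: "('u, 'v) spec"
  assumes "der w \<Phi> (\<Delta> @ map (\<lambda>k. (f k, A k)) ks) C R"
    and "\<And>k. k \<in> set ks \<Longrightarrow>
      der w \<Phi> [(f k, A' k)] (A k) (\<lambda>(M :: ('u, 'v) ambient) \<rho> \<eta> v. P M (\<eta> (f k)) \<longrightarrow> v = \<eta> (f k))"
  shows "der w \<Phi> (\<Delta> @ map (\<lambda>k. (f k, A' k)) ks) C (\<lambda>M \<rho> \<eta> v. (\<forall>k\<in>set ks. P M (\<eta> (f k))) \<longrightarrow> R M \<rho> \<eta> v)"
  using assms
proof (induction ks arbitrary: \<Delta> R)
  case Nil
  then show ?case by simp
next
  case (Cons k ks)
  have "der w \<Phi> ((\<Delta> @ map (\<lambda>k. (f k, A k)) ks) @ [(f k, A k)]) C R"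
    by (rule der_perm[OF Cons.prems(1)]) simp
  from der_coerce[OF Cons.prems(2) this]
  have "der w \<Phi> ((\<Delta> @ [(f k, A' k)]) @ map (\<lambda>k. (f k, A k)) ks) C
      (\<lambda>M \<rho> \<eta> v. P M (\<eta> (f k)) \<longrightarrow> R M \<rho> \<eta> v)"
    by (auto elim: der_perm)
  from Cons.IH[OF this Cons.prems(2)] show ?case
    by (rule der_adapt) auto
qed

lemma der_le_list:
  fixes R :: "('u, 'v) spec"
  assumes "der w \<Phi> (\<Delta> @ map (\<lambda>k. (f k, A k)) ks) C R"
    and "\<And>k. k \<in> set ks \<Longrightarrow> wf_form (A' k)" "\<And>k. k \<in> set ks \<Longrightarrow> le_form \<Phi> (A' k) (A k)"
  shows "der w \<Phi> (\<Delta> @ map (\<lambda>k. (f k, A' k)) ks) C R"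
proof -
  have wf: "wf_seq \<Phi> (map snd (\<Delta> @ map (\<lambda>k. (f k, A k)) ks)) C" by (rule der_wf[OF assms(1)])
  have "der w \<Phi> (\<Delta> @ map (\<lambda>k. (f k, A' k)) ks) C
      (\<lambda>M \<rho> \<eta> v. (\<forall>k\<in>set ks. (\<lambda>_ _. True) M (\<eta> (f k))) \<longrightarrow> R M \<rho> \<eta> v)"
    by (rule der_coerce_list[OF assms(1)], rule der_conseq[OF der_ax])
      (use assms wf in \<open>auto simp: wf_seq_def\<close>)
  then show ?thesis by simp
qed

lemma der_le_concl:
  fixes R :: "('u, 'v) spec"
  assumes "der w \<Phi> \<Gamma> A R" "wf_form B" "le_form \<Phi> A B"
  shows "der w \<Phi> \<Gamma> B R"
proof -
  have "wf_seq \<Phi> (map snd \<Gamma>) A" by (rule der_wf[OF assms(1)])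
  then have ax: "der w \<Phi> ([] @ [(0, A)]) B (\<lambda>(M :: ('u, 'v) ambient) \<rho> \<eta> v. v = \<eta> 0)"
    using der_ax[of \<Phi> A B w 0] assms by (simp add: wf_seq_def)
  show ?thesis by (rule der_adapt[OF der_cut[OF assms(1) ax]]) auto
qed

section \<open>Zero and the exact successor\<close>

lemma der_Wgen_zero:
  assumes "wf_constrs \<Phi>" "npoly UNIV a" "npoly UNIV p" "npoly UNIV b" "\<Phi> \<Turnstile> (a, b)"
  shows "der w \<Phi> [] (Wgen w a p b) (\<lambda>(M :: ('u, 'v) ambient) \<rho> \<eta> v. wrep w M Wzero v)"
proof -
  have "der w \<Phi> [(w, Atom 0 [a])] (Atom 0 [b]) (\<lambda>(M :: ('u, 'v) ambient) \<rho> \<eta> v. v = \<eta> w)"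
    using assms by (intro der_ax) (auto intro: le_Atom)
  then have "der w \<Phi> (map (apsnd (ashift 1 0)) [] @ map (\<lambda>k. (k, Bang p wstep)) [0..<w] @ [(w, Atom 0 [a])])
      (Atom 0 [b]) (\<lambda>(M :: ('u, 'v) ambient) \<rho> \<eta> v. v = \<eta> w)"
    by (rule der_struct[where \<Delta> = "map (\<lambda>k. (k, Bang p wstep)) [0..<w]"]) (use assms in auto)
  from der_Wgen_intro[OF this] show ?thesis
    by (rule der_adapt) (auto intro!: wrepI words.intros)
qed

text \<open>A word with start \<open>\<alpha>(1)\<close> ends at \<open>\<alpha>(p+1)\<close>.
  Contraction splits the bound \<open>p + 1\<close> of step \<open>k\<close> into \<open>p\<close>
  for the word and 1 for one more step, and dereliction of the latter yields just
  \<open>\<alpha>(p+1) \<multimap> \<alpha>(p+2)\<close>.\<close>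

lemma der_Zform_succ:
  assumes "wf_constrs \<Phi>" "npoly UNIV p" "k < w"
  shows "der w \<Phi> [(n, Zform w p)] (Zform w (\<lambda>e. p e + 1))
    (\<lambda>(M :: ('u, 'v) ambient) \<rho> \<eta> v. \<forall>t. wrep w M t (\<eta> n) \<longrightarrow> wrep w M (Wcon k t) v)"
proof -
  let ?at = "\<lambda>p. Atom 0 [p]"
  let ?p1 = "\<lambda>e. p e + 1" and ?p2 = "\<lambda>e. p e + 1 + 1"
  let ?sh = "\<lambda>i. if i = 0 then (\<lambda>e. psub (wk 1) p e + e 0) else rvar i"
  let ?u = "Suc w" and ?m = "Suc (Suc w)"
  let ?E = "map (\<lambda>k. (k, Bang p wstep)) [0..<w] @ [(w, ?at (\<lambda>e. 1)), (?u, Zform w p)]"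
  have B: "Lolli (?at (rvar 0)) (fsub psuc (?at (rvar 0))) = wstep"
    by (simp add: wstep_def psub_def psuc_def rvar_def)
  have B1: "fsub psuc (?at (rvar 0)) = ?at (\<lambda>e. Suc (e 0))"
    by (simp add: psub_def psuc_def rvar_def)
  have B2: "fsub (instr [c]) (?at (rvar 0)) = ?at c" for c
    by (simp add: psub_def instr_def rvar_def)
  have E: "der w \<Phi> ?E (?at ?p1)
     (\<lambda>(M :: ('u, 'v) ambient) \<rho> \<eta> v. \<forall>t. wrep w M t (\<eta> ?u) \<longrightarrow>
      v = wval M (\<rho> 1 0) (map \<eta> [0..<w]) (\<eta> w) t)"
    using der_Wgen_elim[OF assms(1), of "\<lambda>e. 1" p ?p1 "?at (rvar 0)" w] assms
    unfolding B2 B unfolding B1 Zform_def by simp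
  \<comment> \<open>Contraction shifts y to p + y and dereliction puts y = 1, so the step starts
    where the word ends.\<close>
  have S: "fsub (instr [\<lambda>e. 1]) (fsub ?sh wstep) = Lolli (?at ?p1) (?at ?p2)"
    by (simp add: wstep_def psub_def instr_def rvar_def wk_def)
  have wfs: "wf_form (fsub ?sh wstep)"
  proof -
    have "fsub ?sh wstep = Lolli (?at (\<lambda>e. psub (wk 1) p e + e 0)) (?at (\<lambda>e. psub (wk 1) p e + e 0 + 1))"
      by (simp add: wstep_def psub_def rvar_def)
    moreover have "npoly UNIV (\<lambda>e. psub (wk 1) p e + e 0)" "npoly UNIV (\<lambda>e. psub (wk 1) p e + e 0 + 1)"
      using assms(2) by (intro npoly_add npoly_wk npoly_const npoly_var; simp)+
    ultimately show ?thesis by simp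
  qed
  have ax1: "der w \<Phi> [(?m, ?at ?p1)] (?at ?p1) (\<lambda>(M :: ('u, 'v) ambient) \<rho> \<eta> v. v = \<eta> ?m)"
    and ax2: "der w \<Phi> ([] @ [(?m, ?at ?p2)]) (?at ?p2) (\<lambda>(M :: ('u, 'v) ambient) \<rho> \<eta> v. v = \<eta> ?m)"
    using assms by (auto intro!: der_ax le_form_refl)
  have "der w \<Phi> ([(?m, ?at ?p1)] @ [(k, Lolli (?at ?p1) (?at ?p2))]) (?at ?p2)
      (\<lambda>(M :: ('u, 'v) ambient) \<rho> \<eta> v. v = app M (\<rho> 1 0) (\<rho> 1 0) (\<eta> k) (\<eta> ?m))"
    by (rule der_adapt[OF der_lolliL[OF ax1 ax2]]) auto
  then have "der w \<Phi> ([(?m, ?at ?p1)] @ [(k, Bang (\<lambda>e. 1) (fsub ?sh wstep))]) (?at ?p2)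
      (\<lambda>(M :: ('u, 'v) ambient) \<rho> \<eta> v. v = app M (\<rho> 1 0) (\<rho> 1 0) (\<eta> k) (\<eta> ?m))"
    unfolding S[symmetric] by (rule der_derelict) (use wfs in \<open>simp_all add: entails_sat\<close>)
  then have D: "der w \<Phi> ([(k, Bang (\<lambda>e. 1) (fsub ?sh wstep))] @ [(?m, ?at ?p1)]) (?at ?p2)
      (\<lambda>(M :: ('u, 'v) ambient) \<rho> \<eta> v. v = app M (\<rho> 1 0) (\<rho> 1 0) (\<eta> k) (\<eta> ?m))"
    by (rule der_perm) simp
  define G where "G = map (\<lambda>k. (k, Bang p wstep)) ([0..<k] @ [Suc k..<w]) @ [(w, ?at (\<lambda>e. 1)), (?u, Zform w p)]"
  have upt: "[0..<w] = [0..<k] @ k # [Suc k..<w]"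
    using assms(3) upt_add_eq_append[of 0 k "w - k"] by (simp add: upt_conv_Cons)
  have "der w \<Phi> (?E @ [(k, Bang (\<lambda>e. 1) (fsub ?sh wstep))]) (?at ?p2)
      (\<lambda>(M :: ('u, 'v) ambient) \<rho> \<eta> v. \<forall>t. wrep w M t (\<eta> ?u) \<longrightarrow>
        v = app M (\<rho> 1 0) (\<rho> 1 0) (\<eta> k) (wval M (\<rho> 1 0) (map \<eta> [0..<w]) (\<eta> w) t))"
    by (rule der_conseq[OF der_cut[OF E D]]) (use assms(3) in auto)
  then have "der w \<Phi> (G @ [(k, Bang p wstep), (k, Bang (\<lambda>e. 1) (fsub ?sh wstep))]) (?at ?p2)
      (\<lambda>(M :: ('u, 'v) ambient) \<rho> \<eta> v. \<forall>t. wrep w M t (\<eta> ?u) \<longrightarrow>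
        v = app M (\<rho> 1 0) (\<rho> 1 0) (\<eta> k) (wval M (\<rho> 1 0) (map \<eta> [0..<w]) (\<eta> w) t))"
    by (rule der_perm) (simp add: upt G_def)
  then have "der w \<Phi> (G @ [(k, Bang ?p1 wstep)]) (?at ?p2)
      (\<lambda>(M :: ('u, 'v) ambient) \<rho> \<eta> v. \<forall>t. wrep w M t (\<eta> ?u) \<longrightarrow>
        v = app M (\<rho> 1 0) (\<rho> 1 0) (\<eta> k) (wval M (\<rho> 1 0) (map \<eta> [0..<w]) (\<eta> w) t))"
    by (rule der_contract) (use assms in \<open>auto simp: entails_sat\<close>)
  then have "der w \<Phi> ([(w, ?at (\<lambda>e. 1)), (?u, Zform w p), (k, Bang ?p1 wstep)] @
        map (\<lambda>k. (k, Bang p wstep)) ([0..<k] @ [Suc k..<w])) (?at ?p2)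
      (\<lambda>(M :: ('u, 'v) ambient) \<rho> \<eta> v. \<forall>t. wrep w M t (\<eta> ?u) \<longrightarrow>
        v = app M (\<rho> 1 0) (\<rho> 1 0) (\<eta> k) (wval M (\<rho> 1 0) (map \<eta> [0..<w]) (\<eta> w) t))"
    by (rule der_perm) (simp add: G_def)
  \<comment> \<open>The other step functions serve the word only; their bound \<open>p + 1\<close>
    is lowered to \<open>p\<close> by the order.\<close>
  then have "der w \<Phi> ([(w, ?at (\<lambda>e. 1)), (?u, Zform w p), (k, Bang ?p1 wstep)] @
        map (\<lambda>k. (k, Bang ?p1 wstep)) ([0..<k] @ [Suc k..<w])) (?at ?p2)
      (\<lambda>(M :: ('u, 'v) ambient) \<rho> \<eta> v. \<forall>t. wrep w M t (\<eta> ?u) \<longrightarrow>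
        v = app M (\<rho> 1 0) (\<rho> 1 0) (\<eta> k) (wval M (\<rho> 1 0) (map \<eta> [0..<w]) (\<eta> w) t))"
    by (rule der_le_list) (use assms in \<open>auto intro!: le_Bang le_form_refl simp: entails_sat\<close>)
  then have I: "der w \<Phi> (map (apsnd (ashift 1 0)) [(?u, Zform w p)] @
       map (\<lambda>k. (k, Bang ?p1 wstep)) [0..<w] @ [(w, ?at (\<lambda>e. 1))]) (?at ?p2)
      (\<lambda>(M :: ('u, 'v) ambient) \<rho> \<eta> v. \<forall>t. wrep w M t (\<eta> ?u) \<longrightarrow>
        v = app M (\<rho> 1 0) (\<rho> 1 0) (\<eta> k) (wval M (\<rho> 1 0) (map \<eta> [0..<w]) (\<eta> w) t))"
    by (rule der_perm) (simp add: upt Zform_def ashift_Wgen[unfolded One_nat_def])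
  have m: "map (\<lambda>n. if n < w then fs ! n else if n = w then z else \<eta> n) [0..<w] = fs"
    if "length fs = w" for fs z and \<eta> :: "nat \<Rightarrow> 'v"
    using that by (auto intro: nth_equalityI)
  have "der w \<Phi> [(?u, Zform w p)] (Zform w ?p1)
    (\<lambda>(M :: ('u, 'v) ambient) \<rho> \<eta> v. \<forall>t. wrep w M t (\<eta> ?u) \<longrightarrow> wrep w M (Wcon k t) v)"
  proof (rule der_adapt[OF der_Wgen_intro[OF I]], goal_cases)
    case (4 M \<rho> \<eta> v)
    show ?case
    proof (intro allI impI wrepI)
      fix t C fs z assume *: "wrep w M t (\<eta> ?u)"
      show "Wcon k t \<in> words w" using * assms(3) by (auto intro!: words.intros simp: wrep_def)
      assume "length fs = w" "set fs \<subseteq> el M (fn M C C)" "z \<in> el M C"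
      with 4(4) * assms(3) show "wapp M C fs z (inst M (wfun M w) v C) = wval M C fs z (Wcon k t)"
        by (auto simp: m)
    qed (use 4 in simp)
  qed (auto simp: Zform_def)
  from der_rename[OF this, of "\<lambda>_. n"] show ?thesis by simp
qed

section \<open>Iteration along a word\<close>

definition above :: "nat \<Rightarrow> ('u, 'v) spec \<Rightarrow> bool" where
  "above h S \<longleftrightarrow> (\<forall>M \<rho> \<eta> \<eta>' v. (\<forall>n\<ge>h. \<eta> n = \<eta>' n) \<longrightarrow> S M \<rho> \<eta> v \<longrightarrow> S M \<rho> \<eta>' v)"

text \<open>\<open>m\<close> may recur in the contexts of the steps and of the start value: in
  \<open>der_word_iterate\<close> the iterated word is one of the parameters.\<close>

lemma der_iterate:
  fixes S :: "nat \<Rightarrow> ('u, 'v) spec" and S0 :: "('u, 'v) spec"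
  assumes wf: "wf_constrs \<Phi>" "npoly UNIV a" "npoly UNIV p" "npoly UNIV b"
      "wf_form B" "wf_form (fsub psuc B)" "wf_form (fsub (instr [a]) B)" "wf_form (fsub (instr [b]) B)"
      "\<not> occ False 0 B"
    and steps: "\<And>k. k < w \<Longrightarrow> der w \<Phi> (G k) (Bang p (Lolli B (fsub psuc B))) (S k)"
    and base: "der w \<Phi> G0 (fsub (instr [a]) B) S0"
    and names: "\<And>k n. k < w \<Longrightarrow> n \<in> names (G k) \<Longrightarrow> w < n" "\<And>n. n \<in> names G0 \<Longrightarrow> w < n" "w < m"
    and inv: "\<And>k. k < w \<Longrightarrow> above (Suc w) (S k)" "above (Suc w) S0"
  shows "der w \<Phi> (concat (map G [0..<w]) @ G0 @ [(m, Wgen w a p b)]) (fsub (instr [b]) B)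
    (\<lambda>M \<rho> \<eta> v. \<exists>fs z. length fs = w \<and>
      (\<forall>k<w. fs ! k \<in> el M (fn M (tsem M \<rho> (erase B)) (tsem M \<rho> (erase B))) \<and> S k M \<rho> \<eta> (fs ! k)) \<and>
      z \<in> el M (tsem M \<rho> (erase B)) \<and> S0 M \<rho> \<eta> z \<and>
      (\<forall>t. wrep w M t (\<eta> m) \<longrightarrow> v = wval M (tsem M \<rho> (erase B)) fs z t))"
proof -
  \<comment> \<open>The start value is cut as premise number \<open>w\<close>, after the steps;
    \<open>?r\<close> renames the iterated word from \<open>Suc w\<close> to
    \<open>m\<close>.\<close>
  let ?A = "\<lambda>k. if k < w then Bang p (Lolli B (fsub psuc B)) else fsub (instr [a]) B"
  let ?G = "\<lambda>k. if k < w then G k else G0"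
  let ?S = "\<lambda>k. if k < w then S k else S0"
  let ?r = "\<lambda>n. if n \<le> w then n else m"
  have "der w \<Phi> (map (\<lambda>k. (k, ?A k)) [0..<Suc w] @ [(m, Wgen w a p b)]) (fsub (instr [b]) B)
    (\<lambda>(M :: ('u, 'v) ambient) \<rho> \<eta> v. \<forall>t. wrep w M t (\<eta> m) \<longrightarrow>
      v = wval M (tsem M \<rho> (erase B)) (map \<eta> [0..<w]) (\<eta> w) t)"
  proof (rule der_adapt[OF der_rename[OF der_Wgen_elim[OF wf], where g = ?r]], goal_cases)
    case 1
    have "map (\<lambda>k. (k, ?A k)) [0..<Suc w] @ [(m, Wgen w a p b)] =
      map (apfst ?r) (map (\<lambda>k. (k, Bang p (Lolli B (fsub psuc B)))) [0..<w] @
        [(w, fsub (instr [a]) B), (Suc w, Wgen w a p b)])"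
      using names(3) by simp
    then show ?case by (simp only:)
  next
    case (3 M \<rho> \<eta> v)
    have "map (\<eta> \<circ> ?r) [0..<w] = map \<eta> [0..<w]" by simp
    with 3(4) names(3) show ?case by simp
  qed simp
  then have "der w \<Phi> (concat (map ?G [0..<Suc w]) @ [(m, Wgen w a p b)]) (fsub (instr [b]) B)
     (\<lambda>M \<rho> \<eta> v. \<exists>as. length as = Suc w \<and>
      (\<forall>k<Suc w. as ! k \<in> el M (tsem M \<rho> (erase (?A k))) \<and> ?S k M \<rho> \<eta> (as ! k)) \<and>
      (\<forall>t. wrep w M t (if m < Suc w then as ! m else \<eta> m) \<longrightarrow>
        v = wval M (tsem M \<rho> (erase B)) (map (\<lambda>n. if n < Suc w then as ! n else \<eta> n) [0..<w])
          (if w < Suc w then as ! w else \<eta> w) t))"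
    apply (rule der_multicut[rotated])
    subgoal using names by simp
    subgoal for k n using names(1)[of k n] names(2)[of n] by (cases "k < w") (auto simp: less_Suc_eq)
    subgoal for k M \<rho> \<eta> \<eta>' v
      using inv(1)[of k, unfolded above_def, rule_format, of \<eta> \<eta>' M \<rho> v]
        inv(2)[unfolded above_def, rule_format, of \<eta> \<eta>' M \<rho> v] by (cases "k < w") (simp_all)
    subgoal for k using steps base by (cases "k < w") simp_all
    done
  then show ?thesis
  proof (rule der_adapt, goal_cases)
    case 1
    have G: "map ?G [0..<Suc w] = map G [0..<w] @ [G0]" by simp
    show ?case unfolding G by simp
  next
    case (3 M \<rho> \<eta> v)
    then obtain as where as: "length as = Suc w"
      "\<And>k. k < Suc w \<Longrightarrow> as ! k \<in> el M (tsem M \<rho> (erase (?A k)))"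
      "\<And>k. k < Suc w \<Longrightarrow> ?S k M \<rho> \<eta> (as ! k)"
      "\<And>t. wrep w M t (if m < Suc w then as ! m else \<eta> m) \<Longrightarrow>
        v = wval M (tsem M \<rho> (erase B)) (map (\<lambda>n. if n < Suc w then as ! n else \<eta> n) [0..<w])
          (if w < Suc w then as ! w else \<eta> w) t" by blast
    have take: "map (\<lambda>n. if n < Suc w then as ! n else \<eta> n) [0..<w] = take w as"
      using as(1) by (auto intro: nth_equalityI)
    show ?case
    proof (intro exI[of _ "take w as"] exI[of _ "as ! w"] conjI allI impI)
      show "length (take w as) = w" using as(1) by simp
      show "take w as ! k \<in> el M (fn M (tsem M \<rho> (erase B)) (tsem M \<rho> (erase B)))"
        "S k M \<rho> \<eta> (take w as ! k)" if "k < w" for k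
        using as(2,3)[of k] that by simp_all
      show "as ! w \<in> el M (tsem M \<rho> (erase B))" "S0 M \<rho> \<eta> (as ! w)"
        using as(2,3)[of w] by simp_all
      show "v = wval M (tsem M \<rho> (erase B)) (take w as) (as ! w) t" if "wrep w M t (\<eta> m)" for t
        using as(4)[of t] that names(3) unfolding take by simp
    qed
  qed simp
qed

lemma psub_psuc_wk [simp]: "psub psuc (psub (wk (Suc 0)) p) = psub (wk (Suc 0)) p"
  by (simp add: fun_eq_iff psub_def psuc_def wk_def rvar_def)

lemma psub_instr_wk [simp]: "psub (instr [c]) (psub (wk (Suc 0)) p) = p"
  by (simp add: fun_eq_iff psub_def instr_def wk_def rvar_def)

text \<open>
  Words are duplicable although they are not of the form \<open>!A\<close>: iterating the promoted successor
  rebuilds a word inside any modality.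
\<close>

lemma der_Wform_store:
  assumes "wf_constrs \<Phi>" "npoly UNIV p" "npoly UNIV N"
  shows "der w \<Phi> [(n, Wform w p)] (Bang N (Zform w (psub (wk 1) p)))
    (\<lambda>(M :: ('u, 'v) ambient) \<rho> \<eta> v. isw w M (\<eta> n) \<longrightarrow> v = \<eta> n)"
proof -
  \<comment> \<open>The state at y is a word of size y inside the modality; below the binder of the
    modality y has index 1.\<close>
  let ?B = "Bang (psub (wk 1) N) (Zform w (rvar 1))"
  let ?\<Phi>1 = "below \<Phi> p" and ?\<Phi>2 = "below (below \<Phi> p) (psub (wk 1) N)"
  let ?S = "\<lambda>k (M :: ('u, 'v) ambient) \<rho> \<eta> f. \<forall>a\<in>el M (tsem M \<rho> (erase ?B)). \<forall>t. wrep w M t a \<longrightarrow>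
      wrep w M (Wcon k t) (app M (tsem M \<rho> (erase ?B)) (tsem M \<rho> (erase ?B)) f a)"
  have np: "npoly UNIV (rvar 1)" "npoly UNIV (\<lambda>e. rvar 1 e + 1)" by (simp_all add: rvar_def)
  have wf1: "wf_constrs ?\<Phi>1" and wf2: "wf_constrs ?\<Phi>2"
    using assms by (auto intro!: wf_below)
  have B1: "fsub psuc ?B = Bang (psub (wk 1) N) (Zform w (\<lambda>e. rvar 1 e + 1))"
    by (simp add: fun_eq_iff psub_def psuc_def lift_def wk_def rvar_def)
  have B2: "fsub (instr [c]) ?B = Bang N (Zform w (psub (wk 1) c))" for c
    by (simp add: fun_eq_iff psub_def instr_def lift_def wk_def rvar_def)
  have e1: "erase (fsub psuc ?B) = erase ?B" by (rule erase_fsub)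
  have steps: "der w \<Phi> [] (Bang p (Lolli ?B (fsub psuc ?B))) (?S k)" if "k < w" for k
  proof -
    \<comment> \<open>The successor has no parameters besides the stored word, so it can be promoted
      first below \<open>N\<close> and, once abstracted, below \<open>p\<close>.\<close>
    have "der w ?\<Phi>2 [(0, Zform w (rvar 1))] (Zform w (\<lambda>e. rvar 1 e + 1))
        (\<lambda>(M :: ('u, 'v) ambient) \<rho> \<eta> v. \<forall>t. wrep w M t (\<eta> 0) \<longrightarrow> wrep w M (Wcon k t) v)"
      using wf2 np that by (intro der_Zform_succ)
    then have "der w ?\<Phi>1 (map (apsnd (Bang (psub (wk 1) N))) [(0, Zform w (rvar 1))]) (fsub psuc ?B)
        (\<lambda>(M :: ('u, 'v) ambient) \<rho> \<eta> v. \<forall>t. wrep w M t (\<eta> 0) \<longrightarrow> wrep w M (Wcon k t) v)"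
      unfolding B1 by (rule der_promote) (use wf1 assms in \<open>auto simp: below_def entails_all_def entails_def\<close>)
    then have "der w ?\<Phi>1 ([] @ [(0, ?B)]) (fsub psuc ?B)
        (\<lambda>(M :: ('u, 'v) ambient) \<rho> \<eta> v. \<forall>t. wrep w M t (\<eta> 0) \<longrightarrow> wrep w M (Wcon k t) v)"
      by simp
    from der_lolliR[OF this] have "der w ?\<Phi>1 [] (Lolli ?B (fsub psuc ?B)) (?S k)"
      unfolding e1 by simp
    then have "der w \<Phi> (map (apsnd (Bang p)) []) (Bang p (Lolli ?B (fsub psuc ?B))) (?S k)"
      by (rule der_promote) (use assms in \<open>auto simp: below_def entails_all_def entails_def\<close>)
    then show ?thesis by simp
  qed
  have base: "der w \<Phi> [] (fsub (instr [\<lambda>e. 0]) ?B) (\<lambda>(M :: ('u, 'v) ambient) \<rho> \<eta> v. wrep w M Wzero v)"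
  proof -
    have "der w (below \<Phi> N) [] (Zform w (\<lambda>e. 0)) (\<lambda>(M :: ('u, 'v) ambient) \<rho> \<eta> v. wrep w M Wzero v)"
      unfolding Zform_def by (rule der_Wgen_zero) (use assms in \<open>auto intro!: wf_below simp: entails_sat\<close>)
    then have "der w \<Phi> (map (apsnd (Bang N)) []) (Bang N (Zform w (\<lambda>e. 0))) (\<lambda>(M :: ('u, 'v) ambient) \<rho> \<eta> v. wrep w M Wzero v)"
      by (rule der_promote) (use assms in \<open>auto simp: below_def entails_all_def entails_def\<close>)
    then show ?thesis unfolding B2 by simp
  qed
  have occ: "\<not> occ False 0 ?B"
    by (auto simp: fvp_def)
  have wfB: "wf_form ?B" "wf_form (fsub psuc ?B)" "wf_form (fsub (instr [c]) ?B)" if "npoly UNIV c" for c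
    unfolding B1 B2 using assms np that by auto
  have "der w \<Phi> (concat (map (\<lambda>k. []) [0..<w]) @ [] @ [(Suc w, Wgen w (\<lambda>e. 0) p p)]) (fsub (instr [p]) ?B)
    (\<lambda>M \<rho> \<eta> v. \<exists>fs z. length fs = w \<and>
      (\<forall>k<w. fs ! k \<in> el M (fn M (tsem M \<rho> (erase ?B)) (tsem M \<rho> (erase ?B))) \<and> ?S k M \<rho> \<eta> (fs ! k)) \<and>
      z \<in> el M (tsem M \<rho> (erase ?B)) \<and> wrep w M Wzero z \<and>
      (\<forall>t. wrep w M t (\<eta> (Suc w)) \<longrightarrow> v = wval M (tsem M \<rho> (erase ?B)) fs z t))"
    by (rule der_iterate[OF assms(1) _ assms(2) assms(2) wfB(1,2)[OF assms(2)] wfB(3) wfB(3) occ steps base])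
      (use assms in \<open>auto simp: above_def\<close>)
  from der_rename[OF this, of "\<lambda>_. n"]
  show ?thesis
  proof (rule der_adapt, goal_cases)
    case 2
    show ?case unfolding B2 ..
  next
    case (3 M \<rho> \<eta> v)
    then obtain fs z where fz: "length fs = w"
      "\<And>k. k < w \<Longrightarrow> ?S k M \<rho> \<eta> (fs ! k)" "wrep w M Wzero z"
      "\<And>t. wrep w M t (\<eta> n) \<Longrightarrow> v = wval M (tsem M \<rho> (erase ?B)) fs z t" by fastforce
    \<comment> \<open>The iteration rebuilds the word; uniqueness of representations then identifies
      the result with the given element.\<close>
    have *: "wrep w M t (wval M (tsem M \<rho> (erase ?B)) fs z t)" if "t \<in> words w" for t
      using that
    proof induction
      case (2 k t)
      then have "wval M (tsem M \<rho> (erase ?B)) fs z t \<in> el M (tsem M \<rho> (erase ?B))"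
        by (simp add: wrep_def)
      with 2 fz(2)[of k] show ?case by simp
    qed (simp add: fz)
    show ?case
    proof
      assume "isw w M (\<eta> n)"
      then obtain t where t: "wrep w M t (\<eta> n)" by (auto simp: isw_def)
      with * fz(4) have "wrep w M t v" by (auto dest: wrep_words)
      with t show "v = \<eta> n" using ambient_universe.wrep_unique[OF 3(1)] by blast
    qed
  qed (simp add: Wform_eq)
qed

section \<open>Copying and promoting words\<close>

lemma der_le1:
  fixes R :: "('u, 'v) spec"
  assumes "der w \<Phi> (\<Gamma> @ [(n, B)]) C R" "wf_form A" "le_form \<Phi> A B"
  shows "der w \<Phi> (\<Gamma> @ [(n, A)]) C R"
  using der_le_list[of w \<Phi> \<Gamma> "\<lambda>_. n" "\<lambda>_. B" "[()]" C R "\<lambda>_. A"] assms by simp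

text \<open>The body does not depend on the variable of the modality, so neither the shift in
  contraction nor the instance in dereliction changes it: a bound \<open>h\<close> pays for
  \<open>h\<close> copies.\<close>

lemma der_Zform_copies:
  fixes R :: "('u, 'v) spec"
  assumes "der w \<Phi> (\<Gamma> @ replicate h (n, Wform w (\<lambda>e. p e + 1))) C R" "npoly UNIV p"
  shows "der w \<Phi> (\<Gamma> @ [(n, Bang (\<lambda>e. h) (Zform w (psub (wk 1) p)))]) C R"
  using assms(1)
proof (induction h arbitrary: \<Gamma>)
  case 0
  then have "der w \<Phi> \<Gamma> C R" by simp
  moreover have "wf_form (Zform w (psub (wk 1) p))" using assms(2) by (intro wf_Zform npoly_wk)
  ultimately show ?case by (intro der_weaken) (simp_all del: psub_wk)
next
  case (Suc h)
  let ?Z = "Zform w (psub (wk 1) p)"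
  let ?sh = "\<lambda>i. if i = 0 then (\<lambda>e. psub (wk 1) (\<lambda>e. h) e + e 0) else rvar i"
  have "der w \<Phi> ((\<Gamma> @ [(n, Wform w (\<lambda>e. p e + 1))]) @ [(n, Bang (\<lambda>e. h) ?Z)]) C R"
    by (rule Suc.IH) (use Suc.prems in simp)
  then have "der w \<Phi> ((\<Gamma> @ [(n, Bang (\<lambda>e. h) ?Z)]) @ [(n, Wform w (\<lambda>e. p e + 1))]) C R"
    by (rule der_perm) simp
  then have "der w \<Phi> ((\<Gamma> @ [(n, Bang (\<lambda>e. h) ?Z)]) @ [(n, Zform w p)]) C R"
    by (rule der_le1) (use assms(2) le_Zform_Wform in auto)
  then have "der w \<Phi> ((\<Gamma> @ [(n, Bang (\<lambda>e. h) ?Z)]) @ [(n, fsub (instr [\<lambda>e. 1]) ?Z)]) C R"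
    by simp
  then have "der w \<Phi> ((\<Gamma> @ [(n, Bang (\<lambda>e. h) ?Z)]) @ [(n, Bang (\<lambda>e. 1) ?Z)]) C R"
    by (rule der_derelict) (use assms(2) in \<open>auto simp: entails_sat\<close>)
  moreover have "fsub ?sh ?Z = ?Z"
    by (simp add: fun_eq_iff psub_def wk_def rvar_def)
  ultimately have "der w \<Phi> (\<Gamma> @ [(n, Bang (\<lambda>e. h) ?Z), (n, Bang (\<lambda>e. 1) (fsub ?sh ?Z))]) C R"
    by simp
  then show ?case
    by (rule der_contract) (auto simp: entails_sat)
qed

text \<open>The number of copies enters only the bound of the store, so the sizes grow by 1 for
  every \<open>h\<close>.\<close>

lemma der_Wform_contract:
  fixes R :: "('u, 'v) spec"
  assumes "der w \<Phi> (\<Gamma> @ replicate h (n, Wform w (\<lambda>e. p e + 1))) C R" "npoly UNIV p"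
  shows "der w \<Phi> (\<Gamma> @ [(n, Wform w p)]) C (\<lambda>M \<rho> \<eta> v. isw w M (\<eta> n) \<longrightarrow> R M \<rho> \<eta> v)"
proof (rule der_coerce)
  show "der w \<Phi> (\<Gamma> @ [(n, Bang (\<lambda>e. h) (Zform w (psub (wk 1) p)))]) C R"
    by (rule der_Zform_copies[OF assms])
  have "wf_constrs \<Phi>" using der_wf[OF assms(1)] by (simp add: wf_seq_def)
  then show "der w \<Phi> [(n, Wform w p)] (Bang (\<lambda>e. h) (Zform w (psub (wk 1) p)))
      (\<lambda>(M :: ('u, 'v) ambient) \<rho> \<eta> v. isw w M (\<eta> n) \<longrightarrow> v = \<eta> n)"
    using assms(2) by (intro der_Wform_store) auto
qed

lemma der_Wform_contract_list:
  fixes R :: "('u, 'v) spec"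
  assumes "der w \<Phi> (\<Gamma> @ concat (replicate h (map (\<lambda>l. (f l, Wform w (\<lambda>e. ps l e + 1))) ls))) C R"
    and "\<And>l. l \<in> set ls \<Longrightarrow> npoly UNIV (ps l)"
  shows "der w \<Phi> (\<Gamma> @ map (\<lambda>l. (f l, Wform w (ps l))) ls) C
    (\<lambda>M \<rho> \<eta> v. (\<forall>l\<in>set ls. isw w M (\<eta> (f l))) \<longrightarrow> R M \<rho> \<eta> v)"
  using assms
proof (induction ls arbitrary: \<Gamma> R)
  case Nil
  then show ?case by simp
next
  case (Cons l ls)
  let ?c = "\<lambda>l. (f l, Wform w (\<lambda>e. ps l e + 1))"
  have "mset (concat (replicate h (map ?c (l # ls)))) = mset (concat (replicate h (map ?c ls)) @ replicate h (?c l))"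
    by (induction h) auto
  then have "der w \<Phi> ((\<Gamma> @ concat (replicate h (map ?c ls))) @ replicate h (?c l)) C R"
    by (intro der_perm[OF Cons.prems(1)]) simp
  then have "der w \<Phi> ((\<Gamma> @ concat (replicate h (map ?c ls))) @ [(f l, Wform w (ps l))]) C
      (\<lambda>M \<rho> \<eta> v. isw w M (\<eta> (f l)) \<longrightarrow> R M \<rho> \<eta> v)"
    using Cons.prems(2) by (intro der_Wform_contract) auto
  then have "der w \<Phi> ((\<Gamma> @ [(f l, Wform w (ps l))]) @ concat (replicate h (map ?c ls))) C
      (\<lambda>M \<rho> \<eta> v. isw w M (\<eta> (f l)) \<longrightarrow> R M \<rho> \<eta> v)"
    by (rule der_perm) simp
  from Cons.IH[OF this] Cons.prems(2) show ?case
    by (auto elim!: der_adapt)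
qed

text \<open>Each parameter is stored below the very bound \<open>p\<close> that promotion
  introduces; taking it out inside adds 1 to its size.\<close>

lemma der_Wform_promote:
  fixes R :: "('u, 'v) spec"
  assumes "der w (below \<Phi> p) (map (\<lambda>l. (f l, Wform w (\<lambda>e. psub (wk 1) (ps l) e + 1))) ls) B R"
    and "wf_constrs \<Phi>" "npoly UNIV p" "\<And>l. l \<in> set ls \<Longrightarrow> npoly UNIV (ps l)"
  shows "der w \<Phi> (map (\<lambda>l. (f l, Wform w (ps l))) ls) (Bang p B)
    (\<lambda>M \<rho> \<eta> v. (\<forall>l\<in>set ls. isw w M (\<eta> (f l))) \<longrightarrow> R M \<rho> \<eta> v)"
proof -
  have "der w (below \<Phi> p) ([] @ map (\<lambda>l. (f l, Zform w (psub (wk 1) (ps l)))) ls) B R"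
  proof (rule der_le_list)
    show "le_form (below \<Phi> p) (Zform w (psub (wk 1) (ps l))) (Wform w (\<lambda>e. psub (wk 1) (ps l) e + 1))" for l
      by (rule le_Zform_Wform)
  qed (use assms in auto)
  then have "der w \<Phi> (map (apsnd (Bang p)) (map (\<lambda>l. (f l, Zform w (psub (wk 1) (ps l)))) ls)) (Bang p B) R"
    by (intro der_promote) (use assms in \<open>auto simp: below_def entails_all_def entails_def\<close>)
  then have "der w \<Phi> ([] @ map (\<lambda>l. (f l, Bang p (Zform w (psub (wk 1) (ps l))))) ls) (Bang p B) R"
    by (simp add: comp_def)
  then have "der w \<Phi> ([] @ map (\<lambda>l. (f l, Wform w (ps l))) ls) (Bang p B)
      (\<lambda>M \<rho> \<eta> v. (\<forall>k\<in>set ls. isw w M (\<eta> (f k))) \<longrightarrow> R M \<rho> \<eta> v)"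
    by (rule der_coerce_list) (rule der_Wform_store, use assms in auto)
  then show ?thesis by simp
qed

text \<open>Of the constant 2, one unit is the successor itself and the other is the passage from
  \<open>Zform\<close> back to \<open>Wform\<close>.\<close>

lemma der_Wform_con:
  assumes "wf_constrs \<Phi>" "npoly UNIV p" "k < w"
  shows "der w \<Phi> [(n, Wform w p)] (Wform w (\<lambda>e. p e + 2))
    (\<lambda>(M :: ('u, 'v) ambient) \<rho> \<eta> v. \<forall>t. wrep w M t (\<eta> n) \<longrightarrow> wrep w M (Wcon k t) v)"
proof -
  have "der w \<Phi> [(n, Zform w p)] (Wform w (\<lambda>e. (p e + 1) + 1))
    (\<lambda>(M :: ('u, 'v) ambient) \<rho> \<eta> v. \<forall>t. wrep w M t (\<eta> n) \<longrightarrow> wrep w M (Wcon k t) v)"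
    by (rule der_le_concl[OF der_Zform_succ[OF assms]]) (use assms le_Zform_Wform in auto)
  then have "der w \<Phi> ([] @ [(n, fsub (instr [\<lambda>e. 1]) (Zform w (psub (wk 1) p)))]) (Wform w (\<lambda>e. p e + 2))
    (\<lambda>(M :: ('u, 'v) ambient) \<rho> \<eta> v. \<forall>t. wrep w M t (\<eta> n) \<longrightarrow> wrep w M (Wcon k t) v)"
    by simp
  then have "der w \<Phi> ([] @ [(n, Bang (\<lambda>e. 1) (Zform w (psub (wk 1) p)))]) (Wform w (\<lambda>e. p e + 2))
    (\<lambda>(M :: ('u, 'v) ambient) \<rho> \<eta> v. \<forall>t. wrep w M t (\<eta> n) \<longrightarrow> wrep w M (Wcon k t) v)"
    by (rule der_derelict) (use assms in \<open>auto simp: entails_sat\<close>)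
  from der_coerce[OF _ this, OF der_Wform_store] show ?thesis
    using assms by (auto elim!: der_adapt simp: isw_def)
qed

text \<open>Iteration on the parameter \<open>j\<close> with all parameters at hand. Copying makes
  their sizes \<open>ps l + 1\<close>, which the start value and the iterated word see; promotion
  makes them \<open>ps l + 2\<close> in the steps.\<close>

lemma der_word_iterate:
  fixes S :: "nat \<Rightarrow> ('u, 'v) spec" and S0 :: "('u, 'v) spec" and w n j :: nat
  assumes wf: "wf_constrs \<Phi>" "\<And>l. l < n \<Longrightarrow> npoly UNIV (ps l)" "j < n"
      "wf_form B" "wf_form (fsub psuc B)" "wf_form (fsub (instr [\<lambda>e. 0]) B)"
      "wf_form (fsub (instr [\<lambda>e. ps j e + 1]) B)" "\<not> occ False 0 B"
    and steps: "\<And>k. k < w \<Longrightarrow> der w (below \<Phi> (\<lambda>e. ps j e + 1))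
      (map (\<lambda>l. (Suc w + l, Wform w (\<lambda>e. psub (wk 1) (ps l) e + 2))) [0..<n]) (Lolli B (fsub psuc B)) (S k)"
    and base: "der w \<Phi> (map (\<lambda>l. (Suc w + l, Wform w (\<lambda>e. ps l e + 1))) [0..<n]) (fsub (instr [\<lambda>e. 0]) B) S0"
    and inv: "\<And>k. k < w \<Longrightarrow> above (Suc w) (S k)" "above (Suc w) S0"
  shows "der w \<Phi> (map (\<lambda>l. (Suc w + l, Wform w (ps l))) [0..<n]) (fsub (instr [\<lambda>e. ps j e + 1]) B)
    (\<lambda>M \<rho> \<eta> v. (\<forall>l<n. isw w M (\<eta> (Suc w + l))) \<longrightarrow> (\<exists>fs z. length fs = w \<and>
      (\<forall>k<w. fs ! k \<in> el M (fn M (tsem M \<rho> (erase B)) (tsem M \<rho> (erase B))) \<and> S k M \<rho> \<eta> (fs ! k)) \<and>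
      z \<in> el M (tsem M \<rho> (erase B)) \<and> S0 M \<rho> \<eta> z \<and>
      (\<forall>t. wrep w M t (\<eta> (Suc w + j)) \<longrightarrow> v = wval M (tsem M \<rho> (erase B)) fs z t)))"
proof -
  let ?c = "map (\<lambda>l. (Suc w + l, Wform w (\<lambda>e. ps l e + 1))) [0..<n]"
  let ?T = "\<lambda>k (M :: ('u, 'v) ambient) \<rho> \<eta> v. (\<forall>l\<in>set [0..<n]. isw w M (\<eta> (Suc w + l))) \<longrightarrow> S k M \<rho> \<eta> v"
  have np1: "npoly UNIV (\<lambda>e. ps l e + 1)" if "l < n" for l using wf(2)[OF that] by auto
  have st: "der w \<Phi> ?c (Bang (\<lambda>e. ps j e + 1) (Lolli B (fsub psuc B))) (?T k)" if "k < w" for k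
  proof (rule der_Wform_promote)
    show "der w (below \<Phi> (\<lambda>e. ps j e + 1))
      (map (\<lambda>l. (Suc w + l, Wform w (\<lambda>e. psub (wk 1) (\<lambda>e. ps l e + 1) e + 1))) [0..<n]) (Lolli B (fsub psuc B)) (S k)"
      using steps[OF that] by simp
  qed (use wf np1 in auto)
  have "der w \<Phi> (concat (map (\<lambda>k. ?c) [0..<w]) @ ?c @ [(Suc w + j, Wgen w (\<lambda>e. 0) (\<lambda>e. ps j e + 1) (\<lambda>e. ps j e + 1))])
    (fsub (instr [\<lambda>e. ps j e + 1]) B)
    (\<lambda>M \<rho> \<eta> v. \<exists>fs z. length fs = w \<and>
      (\<forall>k<w. fs ! k \<in> el M (fn M (tsem M \<rho> (erase B)) (tsem M \<rho> (erase B))) \<and> ?T k M \<rho> \<eta> (fs ! k)) \<and>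
      z \<in> el M (tsem M \<rho> (erase B)) \<and> S0 M \<rho> \<eta> z \<and>
      (\<forall>t. wrep w M t (\<eta> (Suc w + j)) \<longrightarrow> v = wval M (tsem M \<rho> (erase B)) fs z t))"
  proof (rule der_iterate[OF wf(1) npoly_const np1[OF wf(3)] np1[OF wf(3)] wf(4-8) st base])
    show "above (Suc w) (?T k)" if "k < w" for k
      unfolding above_def
    proof (intro allI impI)
      fix M \<rho> \<eta> \<eta>' v assume *: "\<forall>n\<ge>Suc w. \<eta> n = \<eta>' n" "?T k M \<rho> \<eta> v" "\<forall>l\<in>set [0..<n]. isw w M (\<eta>' (Suc w + l))"
      then have "S k M \<rho> \<eta> v" by simp
      then show "S k M \<rho> \<eta>' v" using inv(1)[OF that] *(1) unfolding above_def by blast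
    qed
  qed (use inv in auto)
  \<comment> \<open>\<open>w + 2\<close> copies of the parameters: one for each step, one for the
    start value, and one from which the iterated word is taken.\<close>
  then have "der w \<Phi> ([] @ concat (replicate (w + 2) ?c)) (fsub (instr [\<lambda>e. ps j e + 1]) B)
    (\<lambda>M \<rho> \<eta> v. \<exists>fs z. length fs = w \<and>
      (\<forall>k<w. fs ! k \<in> el M (fn M (tsem M \<rho> (erase B)) (tsem M \<rho> (erase B))) \<and> ?T k M \<rho> \<eta> (fs ! k)) \<and>
      z \<in> el M (tsem M \<rho> (erase B)) \<and> S0 M \<rho> \<eta> z \<and>
      (\<forall>t. wrep w M t (\<eta> (Suc w + j)) \<longrightarrow> v = wval M (tsem M \<rho> (erase B)) fs z t))"
  proof (rule der_struct)
    have upt: "[0..<n] = [0..<j] @ j # [Suc j..<n]"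
      using wf(3) upt_add_eq_append[of 0 j "n - j"] by (simp add: upt_conv_Cons)
    have "map (\<lambda>k. ?c) [0..<w] = replicate w ?c" by (simp add: map_replicate_const)
    moreover have "mset ?c = mset ([(Suc w + j, Wform w (\<lambda>e. ps j e + 1))] @
      map (\<lambda>l. (Suc w + l, Wform w (\<lambda>e. ps l e + 1))) ([0..<j] @ [Suc j..<n]))"
      by (subst upt) simp
    ultimately show "mset ([] @ concat (replicate (w + 2) ?c)) =
      mset ((concat (map (\<lambda>k. ?c) [0..<w]) @ ?c @ [(Suc w + j, Wgen w (\<lambda>e. 0) (\<lambda>e. ps j e + 1) (\<lambda>e. ps j e + 1))]) @
        map (\<lambda>l. (Suc w + l, Wform w (\<lambda>e. ps l e + 1))) ([0..<j] @ [Suc j..<n]))"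
      by (simp add: Wform_eq replicate_add numeral_2_eq_2 del: mset_map)
  qed (use wf np1 in auto)
  from der_Wform_contract_list[OF this] show ?thesis
    using wf(2) by (auto elim!: der_adapt)
qed

section \<open>Predecessor\<close>

text \<open>Booleans over a nullary atom contain no resource variables, so they fit any point of an
  iteration, and the positivity condition on instances is void for them.\<close>

definition boolf :: form where
  "boolf = AllA 0 (Lolli (Atom 0 []) (Lolli (Atom 0 []) (Atom 0 [])))"

definition brep :: "('u, 'v) ambient \<Rightarrow> bool \<Rightarrow> 'v \<Rightarrow> bool" where
  "brep M b v \<longleftrightarrow> (\<forall>C. \<forall>x\<in>el M C. \<forall>y\<in>el M C.
     app M C C (app M C (fn M C C) (inst M (\<lambda>C. fn M C (fn M C C)) v C) x) y = (if b then x else y))"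

lemma boolf_simps [simp]: "wf_form boolf" "fsub \<sigma> boolf = boolf" "\<not> occ s x boolf"
  by (simp_all add: boolf_def)

lemma der_bool:
  assumes "wf_constrs \<Phi>"
  shows "der w \<Phi> [] boolf (\<lambda>(M :: ('u, 'v) ambient) \<rho> \<eta> v. brep M b v)"
proof -
  have "der w \<Phi> [(if b then 0 else 1, Atom 0 [])] (Atom 0 [])
      (\<lambda>(M :: ('u, 'v) ambient) \<rho> \<eta> v. v = \<eta> (if b then 0 else 1))"
    using assms by (intro der_ax le_form_refl) auto
  then have "der w \<Phi> ([(0, Atom 0 [])] @ [(1, Atom 0 [])]) (Atom 0 [])
      (\<lambda>(M :: ('u, 'v) ambient) \<rho> \<eta> v. v = \<eta> (if b then 0 else 1))"
    by (rule der_struct[where \<Delta> = "[(if b then 1 else 0, Atom 0 [])]"]) auto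
  from der_lolliR[OF this] have "der w \<Phi> ([] @ [(0, Atom 0 [])]) (Lolli (Atom 0 []) (Atom 0 []))
      (\<lambda>(M :: ('u, 'v) ambient) \<rho> \<eta> f. \<forall>y\<in>el M (\<rho> 0 0).
         app M (\<rho> 0 0) (\<rho> 0 0) f y = (if b then \<eta> 0 else y))"
    by (auto elim!: der_adapt)
  from der_lolliR[OF this] have "der w \<Phi> (map (apsnd (ashift 0 0)) []) (Lolli (Atom 0 []) (Lolli (Atom 0 []) (Atom 0 [])))
      (\<lambda>(M :: ('u, 'v) ambient) \<rho> \<eta> f. \<forall>x\<in>el M (\<rho> 0 0). \<forall>y\<in>el M (\<rho> 0 0).
         app M (\<rho> 0 0) (\<rho> 0 0) (app M (\<rho> 0 0) (fn M (\<rho> 0 0) (\<rho> 0 0)) f x) y = (if b then x else y))"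
    by (auto elim!: der_adapt)
  from der_allAR[OF this] show ?thesis
    unfolding boolf_def by (rule der_conseq) (simp add: brep_def)
qed

lemma der_bool_select:
  assumes "wf_constrs \<Phi>" "wf_form A"
  shows "der w \<Phi> [(1, A), (2, A), (0, boolf)] A (\<lambda>(M :: ('u, 'v) ambient) \<rho> \<eta> v.
    \<forall>b. brep M b (\<eta> 0) \<longrightarrow> v = (if b then \<eta> 1 else \<eta> 2))"
proof -
  have ax: "der w \<Phi> [(n, A)] A (\<lambda>(M :: ('u, 'v) ambient) \<rho> \<eta> v. v = \<eta> n)" for n
    using assms by (intro der_ax le_form_refl)
  have ax0: "der w \<Phi> ([] @ [(n, A)]) A (\<lambda>(M :: ('u, 'v) ambient) \<rho> \<eta> v. v = \<eta> n)" for n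
    using ax by simp
  have "der w \<Phi> ([(2, A)] @ [(0, Lolli A A)]) A
      (\<lambda>(M :: ('u, 'v) ambient) \<rho> \<eta> v. v = app M (tsem M \<rho> (erase A)) (tsem M \<rho> (erase A)) (\<eta> 0) (\<eta> 2))"
    by (rule der_adapt[OF der_lolliL[OF ax[of 2] ax0[of 0], of 0]]) auto
  from der_lolliL[OF ax[of 1] this, of 0]
  have *: "der w \<Phi> ([(1, A), (2, A)] @ [(0, asub 0 0 (Lolli (Atom 0 []) (Lolli (Atom 0 []) (Atom 0 []))) A)]) A
      (\<lambda>(M :: ('u, 'v) ambient) \<rho> \<eta> v. v = app M (tsem M \<rho> (erase A)) (tsem M \<rho> (erase A))
        (app M (tsem M \<rho> (erase A)) (fn M (tsem M \<rho> (erase A)) (tsem M \<rho> (erase A))) (\<eta> 0) (\<eta> 1)) (\<eta> 2))"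
  proof (rule der_adapt, goal_cases)
    case 2
    have "instr [] = rvar" by (auto simp: instr_def)
    then show ?case by simp
  qed (auto simp: instr_def)
  show ?thesis
    by (rule der_adapt[OF der_allAL[OF * _ assms(2), of 0]]) (auto simp: boolf_def brep_def)
qed

primrec wpred :: "word \<Rightarrow> word" where
  "wpred Wzero = Wzero"
| "wpred (Wcon k t) = t"

text \<open>
  The iteration delays the last constructor: its state is a function of a boolean which says
  whether that constructor is to be applied. The boolean chooses between two functions, so that
  the state itself is used once. (The pair of a value and a delayed function \<open>\<alpha>(y) \<multimap> \<alpha>(y+1)\<close> is not
  an admissible state: \<open>y\<close> would occur negatively.)
\<close>

lemma der_Wform_pred:
  assumes "wf_constrs \<Phi>" "npoly UNIV p"
  shows "der w \<Phi> [(n, Wform w p)] (Wform w (\<lambda>e. p e + 1))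
    (\<lambda>(M :: ('u, 'v) ambient) \<rho> \<eta> v. \<forall>t. wrep w M t (\<eta> n) \<longrightarrow> wrep w M (wpred t) v)"
proof -
  let ?at = "\<lambda>p. Atom 0 [p]"
  let ?a1 = "?at (\<lambda>e. Suc (e 0))" and ?a2 = "?at (\<lambda>e. Suc (Suc (e 0)))"
  \<comment> \<open>The state at y takes values in \<open>\<alpha>(y+1)\<close>; accordingly the
    steps used are those shifted by 1.\<close>
  let ?S = "Lolli ?a1 ?a2" and ?B = "Lolli boolf ?a1"
  let ?\<Phi>1 = "below \<Phi> p"
  let ?T = "\<lambda>M \<rho>. tsem M \<rho> (erase boolf)"
  let ?D = "\<lambda>M \<rho>. fn M (?T M \<rho>) (\<rho> 1 0)"
  have wf1: "wf_constrs ?\<Phi>1" using assms by (intro wf_below) auto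
  have np: "npoly UNIV (\<lambda>e. Suc (e 0))" "npoly UNIV (\<lambda>e. Suc (Suc (e 0)))" by auto
  have npp: "npoly UNIV (\<lambda>e. Suc (p e))" using assms by auto
  have B1: "fsub psuc ?B = Lolli boolf ?a2"
    by (simp add: psub_def psuc_def)
  have B2: "fsub (instr [c]) ?B = Lolli boolf (?at (\<lambda>e. Suc (c e)))" for c
    by (simp add: psub_def instr_def)
  have eD: "tsem M \<rho> (erase ?B) = ?D M \<rho>" for M :: "('u, 'v) ambient" and \<rho> by simp
  have true: "der w ?\<Phi>1 [] boolf (\<lambda>(M :: ('u, 'v) ambient) \<rho> \<eta> v. brep M True v)"
    using wf1 by (rule der_bool)
  have ax1: "der w ?\<Phi>1 ([] @ [(1, ?a1)]) ?a1 (\<lambda>(M :: ('u, 'v) ambient) \<rho> \<eta> v. v = \<eta> 1)"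
    and ax2: "der w ?\<Phi>1 ([] @ [(3, ?a2)]) ?a2 (\<lambda>(M :: ('u, 'v) ambient) \<rho> \<eta> v. v = \<eta> 3)"
    and ax3: "der w ?\<Phi>1 ([] @ [(0, ?a1)]) ?a2 (\<lambda>(M :: ('u, 'v) ambient) \<rho> \<eta> v. v = \<eta> 0)"
    using wf1 np by (auto intro!: der_ax le_Atom simp: entails_sat)
  have d2: "der w ?\<Phi>1 [(0, ?B)] ?a1 (\<lambda>(M :: ('u, 'v) ambient) \<rho> \<eta> v.
      \<exists>a\<in>el M (?T M \<rho>). brep M True a \<and> v = app M (?T M \<rho>) (\<rho> 1 0) (\<eta> 0) a)"
    by (rule der_adapt[OF der_lolliL[OF true ax1, of 0]]) auto
  \<comment> \<open>The order contains \<open>\<alpha>(y+1) \<le> \<alpha>(y+2)\<close>, so the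
    identity has the type of a constructor step. It is what the boolean False selects.\<close>
  have d3: "der w ?\<Phi>1 [] ?S (\<lambda>(M :: ('u, 'v) ambient) \<rho> \<eta> v.
      \<forall>x\<in>el M (\<rho> 1 0). app M (\<rho> 1 0) (\<rho> 1 0) v x = x)"
    by (rule der_adapt[OF der_lolliR[OF ax3]]) auto
  have sel: "der w ?\<Phi>1 ([(1, ?S), (0, boolf)] @ [(2, ?S)]) ?S (\<lambda>(M :: ('u, 'v) ambient) \<rho> \<eta> v.
    \<forall>b. brep M b (\<eta> 0) \<longrightarrow> v = (if b then \<eta> 1 else \<eta> 2))"
    by (rule der_perm[OF der_bool_select]) (use wf1 np in auto)
  have "der w ?\<Phi>1 [(1, ?S), (0, boolf)] ?S (\<lambda>(M :: ('u, 'v) ambient) \<rho> \<eta> v.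
    (brep M True (\<eta> 0) \<longrightarrow> v = \<eta> 1) \<and>
    (brep M False (\<eta> 0) \<longrightarrow> (\<forall>x\<in>el M (\<rho> 1 0). app M (\<rho> 1 0) (\<rho> 1 0) v x = x)))"
    by (rule der_adapt[OF der_cut[OF d3 sel]]) auto
  from der_rename[OF this, of "\<lambda>n. if n = 0 then 5 else n"]
  have d4: "der w ?\<Phi>1 [(1, ?S), (5, boolf)] ?S (\<lambda>(M :: ('u, 'v) ambient) \<rho> \<eta> v.
    (brep M True (\<eta> 5) \<longrightarrow> v = \<eta> 1) \<and>
    (brep M False (\<eta> 5) \<longrightarrow> (\<forall>x\<in>el M (\<rho> 1 0). app M (\<rho> 1 0) (\<rho> 1 0) v x = x)))"
    by simp
  have d5: "der w ?\<Phi>1 ([(0, ?B)] @ [(4, ?S)]) ?a2 (\<lambda>(M :: ('u, 'v) ambient) \<rho> \<eta> v.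
      \<exists>a\<in>el M (?T M \<rho>). brep M True a \<and>
        v = app M (\<rho> 1 0) (\<rho> 1 0) (\<eta> 4) (app M (?T M \<rho>) (\<rho> 1 0) (\<eta> 0) a))"
    by (rule der_adapt[OF der_lolliL[OF d2 ax2, of 4]]) auto
  have d6: "der w ?\<Phi>1 (([(1, ?S)] @ [(0, ?B)]) @ [(5, boolf)]) ?a2 (\<lambda>(M :: ('u, 'v) ambient) \<rho> \<eta> v.
      \<exists>a\<in>el M (?T M \<rho>). brep M True a \<and>
        (brep M True (\<eta> 5) \<longrightarrow> v = app M (\<rho> 1 0) (\<rho> 1 0) (\<eta> 1) (app M (?T M \<rho>) (\<rho> 1 0) (\<eta> 0) a)) \<and>
        (brep M False (\<eta> 5) \<longrightarrow> v = app M (?T M \<rho>) (\<rho> 1 0) (\<eta> 0) a))"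
  proof (rule der_adapt[OF der_cut[OF d4 d5]], goal_cases)
    case (4 M \<rho> \<eta> v)
    then obtain g a where g: "brep M True (\<eta> 5) \<longrightarrow> g = \<eta> 1"
      "brep M False (\<eta> 5) \<longrightarrow> (\<forall>x\<in>el M (\<rho> 1 0). app M (\<rho> 1 0) (\<rho> 1 0) g x = x)"
      "a \<in> el M (?T M \<rho>)" "brep M True a"
      "v = app M (\<rho> 1 0) (\<rho> 1 0) g (app M (?T M \<rho>) (\<rho> 1 0) (\<eta> 0) a)" by auto
    moreover have "app M (?T M \<rho>) (\<rho> 1 0) (\<eta> 0) a \<in> el M (\<rho> 1 0)"
      using ambient_universe.app_el[OF 4(1) _ g(3)] 4(2) by simp
    ultimately show ?case by (intro bexI[of _ a]) auto
  qed auto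
  have "der w ?\<Phi>1 [(1, ?S)] (Lolli ?B (fsub psuc ?B)) (\<lambda>(M :: ('u, 'v) ambient) \<rho> \<eta> v.
      \<forall>F\<in>el M (?D M \<rho>). \<forall>\<beta>\<in>el M (?T M \<rho>). \<exists>a\<in>el M (?T M \<rho>). brep M True a \<and>
        (brep M True \<beta> \<longrightarrow> app M (?T M \<rho>) (\<rho> 1 0) (app M (?D M \<rho>) (?D M \<rho>) v F) \<beta> =
          app M (\<rho> 1 0) (\<rho> 1 0) (\<eta> 1) (app M (?T M \<rho>) (\<rho> 1 0) F a)) \<and>
        (brep M False \<beta> \<longrightarrow> app M (?T M \<rho>) (\<rho> 1 0) (app M (?D M \<rho>) (?D M \<rho>) v F) \<beta> =
          app M (?T M \<rho>) (\<rho> 1 0) F a))"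
    unfolding B1 by (rule der_adapt[OF der_lolliR[OF der_lolliR[OF d6]]]) auto
  then have "der w \<Phi> (map (apsnd (Bang p)) [(1, ?S)]) (Bang p (Lolli ?B (fsub psuc ?B)))
      (\<lambda>(M :: ('u, 'v) ambient) \<rho> \<eta> v.
      \<forall>F\<in>el M (?D M \<rho>). \<forall>\<beta>\<in>el M (?T M \<rho>). \<exists>a\<in>el M (?T M \<rho>). brep M True a \<and>
        (brep M True \<beta> \<longrightarrow> app M (?T M \<rho>) (\<rho> 1 0) (app M (?D M \<rho>) (?D M \<rho>) v F) \<beta> =
          app M (\<rho> 1 0) (\<rho> 1 0) (\<eta> 1) (app M (?T M \<rho>) (\<rho> 1 0) F a)) \<and>
        (brep M False \<beta> \<longrightarrow> app M (?T M \<rho>) (\<rho> 1 0) (app M (?D M \<rho>) (?D M \<rho>) v F) \<beta> =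
          app M (?T M \<rho>) (\<rho> 1 0) F a))" (is "der _ _ _ _ ?spec")
    by (rule der_promote) (use assms in \<open>auto simp: below_def entails_all_def entails_def\<close>)
  from der_rename[OF this, of "\<lambda>_. Suc w + k" for k]
  have steps: "der w \<Phi> [(Suc w + k, Bang p ?S)] (Bang p (Lolli ?B (fsub psuc ?B)))
      (\<lambda>(M :: ('u, 'v) ambient) \<rho> \<eta> v. ?spec M \<rho> (\<lambda>_. \<eta> (Suc w + k)) v)" for k
    by (simp add: comp_def)
  have "der w \<Phi> [(0, ?at (\<lambda>e. 0))] (?at (\<lambda>e. 1)) (\<lambda>(M :: ('u, 'v) ambient) \<rho> \<eta> v. v = \<eta> 0)"
    using assms by (intro der_ax le_Atom) (auto simp: entails_sat)
  then have "der w \<Phi> ([(0, ?at (\<lambda>e. 0))] @ [(1, boolf)]) (?at (\<lambda>e. 1)) (\<lambda>(M :: ('u, 'v) ambient) \<rho> \<eta> v. v = \<eta> 0)"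
    by (rule der_weaken) simp
  from der_rename[OF der_lolliR[OF this], of "\<lambda>_. 2 * w + 1"]
  have base: "der w \<Phi> [(2 * w + 1, ?at (\<lambda>e. 0))] (fsub (instr [\<lambda>e. 0]) ?B) (\<lambda>(M :: ('u, 'v) ambient) \<rho> \<eta> v.
      \<forall>\<beta>\<in>el M (?T M \<rho>). app M (?T M \<rho>) (\<rho> 1 0) v \<beta> = \<eta> (2 * w + 1))"
    unfolding B2 by (auto elim!: der_adapt)
  have occ: "\<not> occ False 0 ?B" by simp
  have wfB: "wf_form ?B" "wf_form (fsub psuc ?B)" "wf_form (fsub (instr [\<lambda>e. 0]) ?B)" "wf_form (fsub (instr [p]) ?B)"
    unfolding B1 B2 using np npp by auto
  have it: "der w \<Phi> (concat (map (\<lambda>k. [(Suc w + k, Bang p ?S)]) [0..<w]) @ [(2 * w + 1, ?at (\<lambda>e. 0))] @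
      [(2 * w + 2, Wgen w (\<lambda>e. 0) p p)]) (Lolli boolf (?at (\<lambda>e. Suc (p e))))
    (\<lambda>(M :: ('u, 'v) ambient) \<rho> \<eta> v. \<exists>fs z. length fs = w \<and>
      (\<forall>k<w. fs ! k \<in> el M (fn M (tsem M \<rho> (erase ?B)) (tsem M \<rho> (erase ?B))) \<and>
        ?spec M \<rho> (\<lambda>_. \<eta> (Suc w + k)) (fs ! k)) \<and>
      z \<in> el M (tsem M \<rho> (erase ?B)) \<and>
      (\<forall>\<beta>\<in>el M (?T M \<rho>). app M (?T M \<rho>) (\<rho> 1 0) z \<beta> = \<eta> (2 * w + 1)) \<and>
      (\<forall>t. wrep w M t (\<eta> (2 * w + 2)) \<longrightarrow> v = wval M (tsem M \<rho> (erase ?B)) fs z t))"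
    unfolding B2[of p, symmetric]
    by (rule der_iterate[OF assms(1) npoly_const assms(2) assms(2) wfB occ steps base])
      (auto simp: above_def)
  have "der w \<Phi> ([] @ [(0, ?at (\<lambda>e. Suc (p e)))]) (?at (\<lambda>e. Suc (p e))) (\<lambda>(M :: ('u, 'v) ambient) \<rho> \<eta> v. v = \<eta> 0)"
    using assms npp by (auto intro!: der_ax le_form_refl)
  \<comment> \<open>At the end the state is applied to False, so the outermost constructor is held
    back for good.\<close>
  from der_lolliL[OF der_bool[OF assms(1), of w False] this, of 0]
  have fin: "der w \<Phi> ([] @ [(0, Lolli boolf (?at (\<lambda>e. Suc (p e))))]) (?at (\<lambda>e. Suc (p e)))
    (\<lambda>(M :: ('u, 'v) ambient) \<rho> \<eta> v. \<exists>a\<in>el M (?T M \<rho>). brep M False a \<and>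
      v = app M (?T M \<rho>) (\<rho> 1 0) (\<eta> 0) a)"
    by (auto elim!: der_adapt)
  have "der w \<Phi> ([(2 * w + 1, ?at (\<lambda>e. 0)), (2 * w + 2, Wform w p)] @ map (\<lambda>k. (Suc w + k, Bang p ?S)) [0..<w])
    (?at (\<lambda>e. Suc (p e)))
    (\<lambda>(M :: ('u, 'v) ambient) \<rho> \<eta> v. \<forall>t. wrep w M t (\<eta> (2 * w + 2)) \<longrightarrow>
      v = wval M (\<rho> 1 0) (map (\<lambda>k. \<eta> (Suc w + k)) [0..<w]) (\<eta> (2 * w + 1)) (wpred t))"
  proof (rule der_adapt[OF der_cut[OF it fin]], goal_cases)
    case (4 M \<rho> \<eta> v)
    let ?C = "\<rho> 1 0"
    let ?cs = "map (\<lambda>k. \<eta> (Suc w + k)) [0..<w]" and ?z = "\<eta> (2 * w + 1)"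
    from 4(4) obtain fs z \<beta>0 where fz: "length fs = w"
      "\<And>k. k < w \<Longrightarrow> fs ! k \<in> el M (fn M (?D M \<rho>) (?D M \<rho>))"
      "\<And>k. k < w \<Longrightarrow> ?spec M \<rho> (\<lambda>_. \<eta> (Suc w + k)) (fs ! k)"
      "z \<in> el M (?D M \<rho>)" "\<And>\<beta>. \<beta> \<in> el M (?T M \<rho>) \<Longrightarrow> app M (?T M \<rho>) ?C z \<beta> = ?z"
      and b0: "\<beta>0 \<in> el M (?T M \<rho>)" "brep M False \<beta>0"
      and v: "\<And>t. wrep w M t (\<eta> (2 * w + 2)) \<Longrightarrow> v = app M (?T M \<rho>) ?C (wval M (?D M \<rho>) fs z t) \<beta>0"
      unfolding eD by (auto simp del: erase.simps)
    \<comment> \<open>Invariant: on True the state gives the value of t, on False the value of its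
      predecessor. Both are the start value at zero.\<close>
    have "wval M (?D M \<rho>) fs z t \<in> el M (?D M \<rho>) \<and> (\<forall>\<beta>\<in>el M (?T M \<rho>).
        (brep M True \<beta> \<longrightarrow> app M (?T M \<rho>) ?C (wval M (?D M \<rho>) fs z t) \<beta> = wval M ?C ?cs ?z t) \<and>
        (brep M False \<beta> \<longrightarrow> app M (?T M \<rho>) ?C (wval M (?D M \<rho>) fs z t) \<beta> = wval M ?C ?cs ?z (wpred t)))"
      if "t \<in> words w" for t
      using that
    proof induction
      case 1
      then show ?case using fz by simp
    next
      case (2 k t)
      note el = ambient_universe.app_el[OF 4(1) fz(2)[OF 2(1)] conjunct1[OF 2(3)]]
      show ?case
      proof (intro conjI ballI)
        fix \<beta> assume \<beta>: "\<beta> \<in> el M (?T M \<rho>)"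
        from fz(3)[OF 2(1), rule_format, OF conjunct1[OF 2(3)] \<beta>] obtain a where
          a: "a \<in> el M (?T M \<rho>)" "brep M True a"
          "brep M True \<beta> \<longrightarrow> app M (?T M \<rho>) ?C (app M (?D M \<rho>) (?D M \<rho>) (fs ! k) (wval M (?D M \<rho>) fs z t)) \<beta> =
            app M ?C ?C (\<eta> (Suc w + k)) (app M (?T M \<rho>) ?C (wval M (?D M \<rho>) fs z t) a)"
          "brep M False \<beta> \<longrightarrow> app M (?T M \<rho>) ?C (app M (?D M \<rho>) (?D M \<rho>) (fs ! k) (wval M (?D M \<rho>) fs z t)) \<beta> =
            app M (?T M \<rho>) ?C (wval M (?D M \<rho>) fs z t) a" by blast
        have "app M (?T M \<rho>) ?C (wval M (?D M \<rho>) fs z t) a = wval M ?C ?cs ?z t"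
          using 2(3) a(1,2) by blast
        then show "brep M True \<beta> \<longrightarrow> app M (?T M \<rho>) ?C (wval M (?D M \<rho>) fs z (Wcon k t)) \<beta> = wval M ?C ?cs ?z (Wcon k t)"
          "brep M False \<beta> \<longrightarrow> app M (?T M \<rho>) ?C (wval M (?D M \<rho>) fs z (Wcon k t)) \<beta> = wval M ?C ?cs ?z (wpred (Wcon k t))"
          using a(3,4) 2(1) by simp_all
      qed (use el in simp)
    qed
    then show ?case using b0 v by (auto dest: wrep_words)
  qed (auto simp: Wform_eq)
  then have "der w \<Phi> ([(2 * w + 1, ?at (\<lambda>e. 0)), (2 * w + 2, Wform w p)] @
      map (\<lambda>k. (Suc w + k, Bang (\<lambda>e. Suc (p e)) wstep)) [0..<w]) (?at (\<lambda>e. Suc (p e)))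
    (\<lambda>(M :: ('u, 'v) ambient) \<rho> \<eta> v. (\<forall>k\<in>set [0..<w]. (\<lambda>_ _. True) M (\<eta> (Suc w + k))) \<longrightarrow> (\<forall>t. wrep w M t (\<eta> (2 * w + 2)) \<longrightarrow>
      v = wval M (\<rho> 1 0) (map (\<lambda>k. \<eta> (Suc w + k)) [0..<w]) (\<eta> (2 * w + 1)) (wpred t)))"
  proof (rule der_coerce_list)
    fix k
    \<comment> \<open>Splitting the bound \<open>p + 1\<close> as 1 plus \<open>p\<close> shifts the
      second part by 1, which is the step that the state requires; the first part is weakened
      away.\<close>
    let ?sh = "\<lambda>i. if i = 0 then (\<lambda>e. psub (wk 1) (\<lambda>e. 1) e + e 0) else rvar i"
    have S: "fsub ?sh wstep = ?S" by (simp add: wstep_def psub_def rvar_def)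
    have "der w \<Phi> [(Suc w + k, Bang p ?S)] (Bang p ?S) (\<lambda>(M :: ('u, 'v) ambient) \<rho> \<eta> v. v = \<eta> (Suc w + k))"
      using assms np by (intro der_ax le_form_refl) auto
    then have "der w \<Phi> ([] @ [(Suc w + k, Bang (\<lambda>e. 1) wstep), (Suc w + k, Bang p (fsub ?sh wstep))]) (Bang p ?S)
        (\<lambda>(M :: ('u, 'v) ambient) \<rho> \<eta> v. v = \<eta> (Suc w + k))"
      unfolding S by (rule der_struct[where \<Delta> = "[(Suc w + k, Bang (\<lambda>e. 1) wstep)]"]) auto
    then have "der w \<Phi> ([] @ [(Suc w + k, Bang (\<lambda>e. Suc (p e)) wstep)]) (Bang p ?S)
        (\<lambda>(M :: ('u, 'v) ambient) \<rho> \<eta> v. v = \<eta> (Suc w + k))"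
      by (rule der_contract) (use npp in \<open>auto simp: entails_sat\<close>)
    then show "der w \<Phi> [(Suc w + k, Bang (\<lambda>e. Suc (p e)) wstep)] (Bang p ?S)
        (\<lambda>(M :: ('u, 'v) ambient) \<rho> \<eta> v. True \<longrightarrow> v = \<eta> (Suc w + k))"
      by simp
  qed
  \<comment> \<open>\<open>der_iterate\<close> reserves the names up to \<open>w\<close> for itself;
    subtraction returns to the convention of \<open>der_Wgen_intro\<close>.\<close>
  from der_rename[OF this, of "\<lambda>m. m - Suc w"]
  have I: "der w \<Phi> (map (apsnd (ashift 1 0)) [(Suc w, Wform w p)] @
      map (\<lambda>k. (k, Bang (\<lambda>e. Suc (p e)) wstep)) [0..<w] @ [(w, ?at (\<lambda>e. 0))]) (?at (\<lambda>e. Suc (p e)))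
    (\<lambda>(M :: ('u, 'v) ambient) \<rho> \<eta> v. \<forall>t. wrep w M t (\<eta> (Suc w)) \<longrightarrow>
      v = wval M (\<rho> 1 0) (map \<eta> [0..<w]) (\<eta> w) (wpred t))"
  proof (rule der_adapt, goal_cases)
    case 1
    have "ashift (Suc 0) 0 (Wform w p) = Wform w p" using ashift_Wgen[of w "\<lambda>e. 0" p p] by (simp add: Wform_eq)
    then show ?case by (simp add: comp_def)
  next
    case (3 M \<rho> \<eta> v)
    have "2 * w + 2 - Suc w = Suc w" "2 * w + 1 - Suc w = w" by auto
    with 3(4) show ?case by (simp add: comp_def)
  qed simp
  have m: "map (\<lambda>n. if n < w then fs ! n else if n = w then z else \<eta> n) [0..<w] = fs"
    if "length fs = w" for fs z and \<eta> :: "nat \<Rightarrow> 'v"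
    using that by (auto intro: nth_equalityI)
  have "der w \<Phi> [(Suc w, Wform w p)] (Wform w (\<lambda>e. p e + 1))
    (\<lambda>(M :: ('u, 'v) ambient) \<rho> \<eta> v. \<forall>t. wrep w M t (\<eta> (Suc w)) \<longrightarrow> wrep w M (wpred t) v)"
  proof (rule der_adapt[OF der_Wgen_intro[OF I]], goal_cases)
    case (4 M \<rho> \<eta> v)
    show ?case
    proof (intro allI impI wrepI)
      fix t C fs z assume *: "wrep w M t (\<eta> (Suc w))"
      show "wpred t \<in> words w" using wrep_words[OF *] by cases (auto intro: words.intros)
      assume "length fs = w" "set fs \<subseteq> el M (fn M C C)" "z \<in> el M C"
      with 4(4) * show "wapp M C fs z (inst M (wfun M w) v C) = wval M C fs z (wpred t)"
        by (auto simp: m)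
    qed (use 4 in simp)
  qed (auto simp: Wform_eq)
  from der_rename[OF this, of "\<lambda>_. n"] show ?thesis by simp
qed

section \<open>Ramified recurrence\<close>

definition computes :: "nat \<Rightarrow> (word list \<Rightarrow> word) \<Rightarrow> (nat \<Rightarrow> nat) \<Rightarrow> nat \<Rightarrow> ('u, 'v) spec" where
  "computes w f g n M \<rho> \<eta> v \<longleftrightarrow> (\<forall>ts. length ts = n \<longrightarrow> (\<forall>l<n. wrep w M (ts ! l) (\<eta> (g l))) \<longrightarrow> wrep w M (f ts) v)"

text \<open>
  The sizes \<open>ps\<close> of the arguments and the constraints are arbitrary, so that no substitution
  lemma for proofs is needed.
\<close>

definition bounded_by :: "('u \<times> 'v) itself \<Rightarrow> nat \<Rightarrow> (word list \<Rightarrow> word) \<Rightarrow> nat list \<Rightarrow> nat \<Rightarrow> rpoly \<Rightarrow> bool" where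
  "bounded_by T w f tiers i q \<longleftrightarrow> npoly {j. j < length tiers \<and> i < tiers ! j} q \<and>
    (\<forall>\<Phi> ps P. wf_constrs \<Phi> \<longrightarrow> (\<forall>l<length tiers. npoly UNIV (ps l)) \<longrightarrow> npoly UNIV P \<longrightarrow>
      (\<forall>l<length tiers. tiers ! l = i \<longrightarrow> \<Phi> \<Turnstile> (ps l, P)) \<longrightarrow>
      der w \<Phi> (map (\<lambda>l. (l, Wform w (ps l))) [0..<length tiers]) (Wform w (\<lambda>e. psub ps q e + P e))
        (computes w f id (length tiers) :: ('u, 'v) spec))"

text \<open>The type argument is present because the types of the universe occur only inside the
  specification.\<close>

definition representable :: "('u \<times> 'v) itself \<Rightarrow> nat \<Rightarrow> (word list \<Rightarrow> word) \<Rightarrow> nat list \<Rightarrow> nat \<Rightarrow> bool" where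
  "representable T w f tiers i \<longleftrightarrow> (\<exists>q. bounded_by T w f tiers i q)"

lemma bounded_byD:
  assumes "bounded_by TYPE('u \<times> 'v) w f tiers i q"
  shows "npoly {j. j < length tiers \<and> i < tiers ! j} q"
    and "wf_constrs \<Phi> \<Longrightarrow> (\<And>l. l < length tiers \<Longrightarrow> npoly UNIV (ps l)) \<Longrightarrow> npoly UNIV P \<Longrightarrow>
      (\<And>l. l < length tiers \<Longrightarrow> tiers ! l = i \<Longrightarrow> \<Phi> \<Turnstile> (ps l, P)) \<Longrightarrow>
      der w \<Phi> (map (\<lambda>l. (g l, Wform w (ps l))) [0..<length tiers]) (Wform w (\<lambda>e. psub ps q e + P e))
        (computes w f g (length tiers) :: ('u, 'v) spec)"
proof -
  show "npoly {j. j < length tiers \<and> i < tiers ! j} q"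
    using assms unfolding bounded_by_def by blast
  assume "wf_constrs \<Phi>" "\<And>l. l < length tiers \<Longrightarrow> npoly UNIV (ps l)" "npoly UNIV P"
      "\<And>l. l < length tiers \<Longrightarrow> tiers ! l = i \<Longrightarrow> \<Phi> \<Turnstile> (ps l, P)"
  then have "der w \<Phi> (map (\<lambda>l. (l, Wform w (ps l))) [0..<length tiers]) (Wform w (\<lambda>e. psub ps q e + P e))
        (computes w f id (length tiers) :: ('u, 'v) spec)"
    using assms unfolding bounded_by_def by blast
  from der_rename[OF this, where g = g]
  show "der w \<Phi> (map (\<lambda>l. (g l, Wform w (ps l))) [0..<length tiers]) (Wform w (\<lambda>e. psub ps q e + P e))
        (computes w f g (length tiers) :: ('u, 'v) spec)"
    by (simp add: comp_def computes_def[abs_def])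
qed

lemma representableI:
  assumes "npoly {j. j < length tiers \<and> i < tiers ! j} q"
    and "\<And>\<Phi> ps P. wf_constrs \<Phi> \<Longrightarrow> (\<And>l. l < length tiers \<Longrightarrow> npoly UNIV (ps l)) \<Longrightarrow> npoly UNIV P \<Longrightarrow>
      (\<And>l. l < length tiers \<Longrightarrow> tiers ! l = i \<Longrightarrow> \<Phi> \<Turnstile> (ps l, P)) \<Longrightarrow>
      der w \<Phi> (map (\<lambda>l. (l, Wform w (ps l))) [0..<length tiers]) (Wform w (\<lambda>e. psub ps q e + P e))
        (computes w f id (length tiers) :: ('u, 'v) spec)"
  shows "representable TYPE('u \<times> 'v) w f tiers i"
  using assms unfolding representable_def bounded_by_def by blast

section \<open>Representability of the schemes of ramified recurrence\<close>

lemma representable_proj: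
  assumes "l < length js" "js ! l = j"
  shows "representable TYPE('u \<times> 'v) w (\<lambda>ts. ts ! l) js j"
proof (rule representableI[where q = "\<lambda>e. 0"])
  fix \<Phi> ps P
  assume *: "wf_constrs \<Phi>" "\<And>l. l < length js \<Longrightarrow> npoly UNIV (ps l)" "npoly UNIV P"
    "\<And>l. l < length js \<Longrightarrow> js ! l = j \<Longrightarrow> \<Phi> \<Turnstile> (ps l, P)"
  have upt: "[0..<length js] = [0..<l] @ l # [Suc l..<length js]"
    using assms(1) upt_add_eq_append[of 0 l "length js - l"] by (simp add: upt_conv_Cons)
  have "der w \<Phi> [(l, Wform w (ps l))] (Wform w P) (\<lambda>(M :: ('u, 'v) ambient) \<rho> \<eta> v. v = \<eta> l)"
    using * assms by (intro der_ax le_Wform) auto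
  then have "der w \<Phi> (map (\<lambda>l. (l, Wform w (ps l))) [0..<length js]) (Wform w P)
      (\<lambda>(M :: ('u, 'v) ambient) \<rho> \<eta> v. v = \<eta> l)"
    by (rule der_struct[where \<Delta> = "map (\<lambda>l. (l, Wform w (ps l))) ([0..<l] @ [Suc l..<length js])"])
      (use * assms in \<open>auto simp: upt\<close>)
  then show "der w \<Phi> (map (\<lambda>l. (l, Wform w (ps l))) [0..<length js]) (Wform w (\<lambda>e. psub ps (\<lambda>e. 0) e + P e))
        (computes w (\<lambda>ts. ts ! l) id (length js) :: ('u, 'v) spec)"
    by (rule der_adapt) (use assms(1) in \<open>auto simp: computes_def\<close>)
qed auto

lemma representable_zero: "representable TYPE('u \<times> 'v) w (\<lambda>ts. Wzero) [] i"
proof (rule representableI[where q = "\<lambda>e. 0"])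
  fix \<Phi> and ps :: "nat \<Rightarrow> rpoly" and P
  assume *: "wf_constrs \<Phi>" "npoly UNIV P"
  have "der w \<Phi> [] (Wform w P) (\<lambda>(M :: ('u, 'v) ambient) \<rho> \<eta> v. wrep w M Wzero v)"
    unfolding Wform_eq by (rule der_Wgen_zero) (use * in \<open>auto simp: entails_sat\<close>)
  then show "der w \<Phi> (map (\<lambda>l. (l, Wform w (ps l))) [0..<length []]) (Wform w (\<lambda>e. psub ps (\<lambda>e. 0) e + P e))
        (computes w (\<lambda>ts. Wzero) id (length []) :: ('u, 'v) spec)"
    by (rule der_adapt) (auto simp: computes_def)
qed auto

lemma representable_con:
  assumes "k < w"
  shows "representable TYPE('u \<times> 'v) w (\<lambda>ts. Wcon k (hd ts)) [i] i"
proof (rule representableI[where q = "\<lambda>e. 2"])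
  fix \<Phi> and ps :: "nat \<Rightarrow> rpoly" and P
  assume *: "wf_constrs \<Phi>" "\<And>l. l < length [i] \<Longrightarrow> npoly UNIV (ps l)" "npoly UNIV P"
    "\<And>l. l < length [i] \<Longrightarrow> [i] ! l = i \<Longrightarrow> \<Phi> \<Turnstile> (ps l, P)"
  have "der w \<Phi> [(0, Wform w (ps 0))] (Wform w (\<lambda>e. ps 0 e + 2))
    (\<lambda>(M :: ('u, 'v) ambient) \<rho> \<eta> v. \<forall>t. wrep w M t (\<eta> 0) \<longrightarrow> wrep w M (Wcon k t) v)"
    using * assms by (intro der_Wform_con) auto
  then have "der w \<Phi> [(0, Wform w (ps 0))] (Wform w (\<lambda>e. 2 + P e))
    (\<lambda>(M :: ('u, 'v) ambient) \<rho> \<eta> v. \<forall>t. wrep w M t (\<eta> 0) \<longrightarrow> wrep w M (Wcon k t) v)"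
    by (rule der_le_concl) (use *(2,3) *(4)[of 0] in \<open>auto intro!: le_Wform simp: entails_sat\<close>)
  then show "der w \<Phi> (map (\<lambda>l. (l, Wform w (ps l))) [0..<length [i]]) (Wform w (\<lambda>e. psub ps (\<lambda>e. 2) e + P e))
        (computes w (\<lambda>ts. Wcon k (hd ts)) id (length [i]) :: ('u, 'v) spec)"
    by (rule der_adapt) (auto simp: computes_def length_Suc_conv)
qed auto

text \<open>Each inner function needs a common bound for the arguments of its own tier. Above tier
  \<open>i\<close> the sum of their sizes serves, as these may enter the polynomial; at tier
  \<open>i\<close> it must be \<open>P\<close>, to keep the coefficient 1.\<close>

lemma representable_comp:
  assumes g: "representable TYPE('u \<times> 'v) w g is' i" and len: "length fs = length is'"
    and fs: "\<And>k. k < length is' \<Longrightarrow> representable TYPE('u \<times> 'v) w (fs ! k) js (is' ! k)"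
  shows "representable TYPE('u \<times> 'v) w (\<lambda>ts. g (map (\<lambda>f. f ts) fs)) js i"
proof -
  let ?h = "length is'" and ?n = "length js"
  obtain qg where qg: "bounded_by TYPE('u \<times> 'v) w g is' i qg"
    using g unfolding representable_def by blast
  have "\<forall>k<?h. \<exists>q. bounded_by TYPE('u \<times> 'v) w (fs ! k) js (is' ! k) q"
    using fs unfolding representable_def by blast
  then obtain q where q: "\<And>k. k < ?h \<Longrightarrow> bounded_by TYPE('u \<times> 'v) w (fs ! k) js (is' ! k) (q k)"
    by metis
  \<comment> \<open>Size of the inner result \<open>k\<close> when the arguments have sizes
    \<open>\<sigma>\<close>; the added 1 is the charge for copying the arguments to all inner
    functions.\<close>
  define sz :: "rsubst \<Rightarrow> rpoly \<Rightarrow> nat \<Rightarrow> rpoly" where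
    "sz \<sigma> P k = (\<lambda>e. psub (\<lambda>l e. \<sigma> l e + 1) (q k) e +
       (if is' ! k = i then P e else \<Sum>l<?n. if js ! l = is' ! k then \<sigma> l e + 1 else 0))" for \<sigma> P k
  \<comment> \<open>With 0 for \<open>P\<close>, \<open>sz\<close> at tier \<open>i\<close> is the
    growth alone. Adding the growths bounds all inner results of tier \<open>i\<close> while
    \<open>P\<close> is counted once; the last 1 is the copying charge on \<open>P\<close>.\<close>
  define Q where "Q = (\<lambda>e. psub (sz rvar (\<lambda>e. 0)) qg e +
     (\<Sum>k<?h. if is' ! k = i then sz rvar (\<lambda>e. 0) k e else 0) + 1)"
  show ?thesis
  proof (rule representableI)
    let ?V = "{j. j < ?n \<and> i < js ! j}"
    \<comment> \<open>Only tiers from \<open>i\<close> on matter: inner results above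
      \<open>i\<close> enter \<open>qg\<close>, those of tier \<open>i\<close> enter the common
      bound.\<close>
    have sz: "npoly ?V (sz rvar (\<lambda>e. 0) k)" if "k < ?h" "i \<le> is' ! k" for k
    proof -
      have "npoly ?V (psub (\<lambda>l e. rvar l e + 1) (q k))"
        by (rule npoly_psub[OF bounded_byD(1)[OF q[OF that(1)]]]) (use that in auto)
      moreover have "npoly ?V (\<lambda>e. if is' ! k = i then 0 else \<Sum>l<?n. if js ! l = is' ! k then rvar l e + 1 else 0)"
      proof (cases "is' ! k = i")
        case False
        have "npoly ?V (\<lambda>e. if js ! l = is' ! k then rvar l e + 1 else 0)" if "l < ?n" for l
          using that \<open>i \<le> is' ! k\<close> False by (cases "js ! l = is' ! k") auto
        then show ?thesis using False by (auto intro!: npoly_sum)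
      qed simp
      ultimately show ?thesis unfolding sz_def by (rule npoly_add)
    qed
    have "npoly ?V (psub (sz rvar (\<lambda>e. 0)) qg)"
      by (rule npoly_psub[OF bounded_byD(1)[OF qg]]) (use sz in auto)
    moreover have "npoly ?V (\<lambda>e. if is' ! k = i then sz rvar (\<lambda>e. 0) k e else 0)" if "k < ?h" for k
      using sz[OF that] by (cases "is' ! k = i") auto
    ultimately show "npoly ?V Q"
      unfolding Q_def by (intro npoly_add npoly_sum npoly_const) auto
  next
    fix \<Phi> ps P
    assume *: "wf_constrs \<Phi>" "\<And>l. l < ?n \<Longrightarrow> npoly UNIV (ps l)" "npoly UNIV P"
      "\<And>l. l < ?n \<Longrightarrow> js ! l = i \<Longrightarrow> \<Phi> \<Turnstile> (ps l, P)"
    let ?P = "\<lambda>e. P e + 1"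
    let ?r = "sz ps ?P"
    let ?R = "\<lambda>e. (\<Sum>k<?h. if is' ! k = i then psub (\<lambda>l e. ps l e + 1) (q k) e else 0) + ?P e"
    let ?Pk = "\<lambda>k e. if is' ! k = i then ?P e else \<Sum>l<?n. if js ! l = is' ! k then ps l e + 1 else 0"
    let ?G = "map (\<lambda>l. (?h + l, Wform w (\<lambda>e. ps l e + 1))) [0..<?n]"
    have npq: "npoly UNIV (psub (\<lambda>l e. ps l e + 1) (q k))" if "k < ?h" for k
      by (rule npoly_psub[OF bounded_byD(1)[OF q[OF that]]]) (use *(2) in auto)
    have npPk: "npoly UNIV (?Pk k)" for k
    proof (cases "is' ! k = i")
      case False
      have "npoly UNIV (\<lambda>e. if js ! l = is' ! k then ps l e + 1 else 0)" if "l < ?n" for l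
        using *(2)[OF that] by (cases "js ! l = is' ! k") auto
      then show ?thesis using False by (auto intro!: npoly_sum)
    qed (use *(3) in auto)
    have npr: "npoly UNIV (?r k)" if "k < ?h" for k
      unfolding sz_def by (rule npoly_add[OF npq[OF that] npPk])
    have npR: "npoly UNIV ?R"
    proof -
      have "npoly UNIV (\<lambda>e. if is' ! k = i then psub (\<lambda>l e. ps l e + 1) (q k) e else 0)" if "k < ?h" for k
        using npq[OF that] by (cases "is' ! k = i") auto
      then show ?thesis using *(3) by (intro npoly_add npoly_sum npoly_const) auto
    qed
    have df: "der w \<Phi> ?G (Wform w (?r k)) (computes w (fs ! k) ((+) ?h) ?n :: ('u, 'v) spec)" if "k < ?h" for k
    proof -
      have "\<Phi> \<Turnstile> ((\<lambda>e. ps l e + 1), ?Pk k)" if l: "l < ?n" "js ! l = is' ! k" for l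
      proof (cases "is' ! k = i")
        case True
        then show ?thesis using *(4)[OF l(1)] l(2) by (simp add: entails_sat)
      next
        case False
        have "ps l e + 1 \<le> (\<Sum>l<?n. if js ! l = is' ! k then ps l e + 1 else 0)" for e
          using member_le_sum[of l "{..<?n}" "\<lambda>l. if js ! l = is' ! k then ps l e + 1 else 0"] l by simp
        with False show ?thesis by (simp add: entails_sat)
      qed
      from bounded_byD(2)[OF q[OF that] *(1) _ npPk this] show ?thesis
        unfolding sz_def using *(2) by auto
    qed
    have dg: "der w \<Phi> (map (\<lambda>k. (k, Wform w (?r k))) [0..<?h] @ []) (Wform w (\<lambda>e. psub ?r qg e + ?R e))
        (computes w g id ?h :: ('u, 'v) spec)"
    proof -
      have "\<Phi> \<Turnstile> (?r k, ?R)" if "k < ?h" "is' ! k = i" for k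
      proof -
        have "psub (\<lambda>l e. ps l e + 1) (q k) e \<le> (\<Sum>k<?h. if is' ! k = i then psub (\<lambda>l e. ps l e + 1) (q k) e else 0)" for e
          using member_le_sum[of k "{..<?h}" "\<lambda>k. if is' ! k = i then psub (\<lambda>l e. ps l e + 1) (q k) e else 0"] that by simp
        then show ?thesis using that by (simp add: entails_sat sz_def)
      qed
      from bounded_byD(2)[OF qg *(1) npr npR this, where g = id] show ?thesis by simp
    qed
    have "der w \<Phi> (concat (map (\<lambda>k. ?G) [0..<?h]) @ []) (Wform w (\<lambda>e. psub ?r qg e + ?R e))
      (\<lambda>(M :: ('u, 'v) ambient) \<rho> \<eta> v. \<exists>as. length as = ?h \<and>
        (\<forall>k<?h. as ! k \<in> el M (tsem M \<rho> (erase (Wform w (?r k)))) \<and>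
          computes w (fs ! k) ((+) ?h) ?n M \<rho> \<eta> (as ! k)) \<and>
        computes w g id ?h M \<rho> (\<lambda>n. if n < ?h then as ! n else \<eta> n) v)"
      by (rule der_multicut[OF df dg]) (auto simp: computes_def)
    then have "der w \<Phi> ([] @ concat (replicate ?h ?G)) (Wform w (\<lambda>e. psub ?r qg e + ?R e))
      (\<lambda>(M :: ('u, 'v) ambient) \<rho> \<eta> v. computes w (\<lambda>ts. g (map (\<lambda>f. f ts) fs)) ((+) ?h) ?n M \<rho> \<eta> v)"
    proof (rule der_adapt, goal_cases)
      case 1
      then show ?case by (simp add: map_replicate_const)
    next
      case (3 M \<rho> \<eta> v)
      then obtain as where as: "length as = ?h"
        "\<And>k. k < ?h \<Longrightarrow> computes w (fs ! k) ((+) ?h) ?n M \<rho> \<eta> (as ! k)"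
        "computes w g id ?h M \<rho> (\<lambda>n. if n < ?h then as ! n else \<eta> n) v" by blast
      show ?case unfolding computes_def
      proof (intro allI impI)
        fix ts :: "word list" assume ts: "length ts = ?n" "\<forall>l<?n. wrep w M (ts ! l) (\<eta> (?h + l))"
        have "wrep w M (map (\<lambda>f. f ts) fs ! k) (as ! k)" if "k < ?h" for k
          using as(2)[OF that] ts that len by (simp add: computes_def)
        with as(3) len show "wrep w M (g (map (\<lambda>f. f ts) fs)) v" by (simp add: computes_def)
      qed
    qed simp
    from der_Wform_contract_list[OF this *(2)]
    have c: "der w \<Phi> (map (\<lambda>l. (?h + l, Wform w (ps l))) [0..<?n]) (Wform w (\<lambda>e. psub ?r qg e + ?R e))
      (computes w (\<lambda>ts. g (map (\<lambda>f. f ts) fs)) ((+) ?h) ?n :: ('u, 'v) spec)"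
      by (auto elim!: der_adapt simp: computes_def isw_def) blast
    \<comment> \<open>\<open>qg\<close> reads only inner results of tiers above \<open>i\<close>,
      whose sizes do not contain \<open>P\<close>.\<close>
    have "psub ?r qg e = psub (sz ps (\<lambda>e. 0)) qg e" for e
      unfolding psub_def by (rule npoly_agree[OF bounded_byD(1)[OF qg]]) (simp add: sz_def)
    then have size: "(\<lambda>e. psub ps Q e + P e) = (\<lambda>e. psub ?r qg e + ?R e)"
      by (simp add: fun_eq_iff Q_def psub_def sz_def rvar_def cong: if_cong sum.cong)
    from der_rename[OF c, of "\<lambda>m. m - ?h"]
    show "der w \<Phi> (map (\<lambda>l. (l, Wform w (ps l))) [0..<?n]) (Wform w (\<lambda>e. psub ps Q e + P e))
        (computes w (\<lambda>ts. g (map (\<lambda>f. f ts) fs)) id ?n :: ('u, 'v) spec)"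
      unfolding size by (rule der_adapt) (simp_all add: comp_def computes_def)
  qed
qed

text \<open>
  The state at \<open>y\<close> is a value of size \<open>y K + K\<^sub>0 + P\<close> together with the current prefix of the recursion
  argument. The latter is both copied and extended in every step, whence its size \<open>3 y\<close>.
  Since \<open>i < j\<close>, neither \<open>K\<close> nor \<open>K\<^sub>0\<close> depends on the size of the value.
\<close>

lemma representable_rec:
  assumes fc: "\<And>k. k < w \<Longrightarrow> representable TYPE('u \<times> 'v) w (fc k) (is' @ [i, j]) i"
    and f0: "representable TYPE('u \<times> 'v) w f0 is' i" and "i < j"
  shows "representable TYPE('u \<times> 'v) w (\<lambda>ts. wrec fc f0 (butlast ts) (last ts)) (is' @ [j]) i"
proof -
  define n where "n = length is'"
  obtain q0 where q0: "bounded_by TYPE('u \<times> 'v) w f0 is' i q0"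
    using f0 unfolding representable_def by blast
  have "\<forall>k<w. \<exists>q. bounded_by TYPE('u \<times> 'v) w (fc k) (is' @ [i, j]) i q"
    using fc unfolding representable_def by blast
  then obtain q where q: "\<And>k. k < w \<Longrightarrow> bounded_by TYPE('u \<times> 'v) w (fc k) (is' @ [i, j]) i (q k)"
    by metis
  \<comment> \<open>Sizes as seen in a step: parameters carry the 2 of
    \<open>der_word_iterate\<close>, and the copied prefix has size \<open>3 y + 1\<close> with y at
    most \<open>\<sigma> n + 1\<close>. The recursive value, at index \<open>n\<close>, has tier
    \<open>i\<close> and does not enter \<open>q k\<close>.\<close>
  define K where "K \<sigma> = (\<lambda>e. \<Sum>k<w. psub (\<lambda>l e. if l < n then \<sigma> l e + 2 else 3 * (\<sigma> n e + 1) + 1) (q k) e)" for \<sigma> :: rsubst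
  \<comment> \<open>The final 2 places the parameters of tier \<open>i\<close>, of size
    \<open>ps l + 2\<close> in a step, below the size of the value, which is the common bound handed
    to \<open>fc k\<close>.\<close>
  define K0 where "K0 \<sigma> = (\<lambda>e. psub (\<lambda>l e. \<sigma> l e + 2) q0 e + 2)" for \<sigma> :: rsubst
  \<comment> \<open>The recursion argument is copied before it is iterated, so the number of steps
    is bounded by its size plus 1.\<close>
  define Q where "Q = (\<lambda>e. (rvar n e + 1) * K rvar e + K0 rvar e)"
  have np_K: "npoly U (K \<sigma>)" if "\<And>l. l < n \<Longrightarrow> i < is' ! l \<Longrightarrow> npoly U (\<sigma> l)" "npoly U (\<sigma> n)" for U \<sigma>
  proof -
    have "npoly U (psub (\<lambda>l e. if l < n then \<sigma> l e + 2 else 3 * (\<sigma> n e + 1) + 1) (q k))" if "k < w" for k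
    proof (rule npoly_psub[OF bounded_byD(1)[OF q[OF that]]])
      fix l assume "l \<in> {l. l < length (is' @ [i, j]) \<and> i < (is' @ [i, j]) ! l}"
      then show "npoly U (\<lambda>e. if l < n then \<sigma> l e + 2 else 3 * (\<sigma> n e + 1) + 1)"
        using \<open>\<And>l. l < n \<Longrightarrow> i < is' ! l \<Longrightarrow> npoly U (\<sigma> l)\<close> \<open>npoly U (\<sigma> n)\<close>
        by (cases "l < n") (auto simp: n_def nth_append)
    qed
    then show ?thesis unfolding K_def by (intro npoly_sum) auto
  qed
  have np_K0: "npoly U (K0 \<sigma>)" if "\<And>l. l < n \<Longrightarrow> i < is' ! l \<Longrightarrow> npoly U (\<sigma> l)" for U \<sigma>
    unfolding K0_def by (intro npoly_add npoly_const npoly_psub[OF bounded_byD(1)[OF q0]]) (use that n_def in auto)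
  show ?thesis
  proof (rule representableI)
    show "npoly {l. l < length (is' @ [j]) \<and> i < (is' @ [j]) ! l} Q"
      unfolding Q_def by (intro npoly_add npoly_mult npoly_const np_K np_K0 npoly_var)
        (use \<open>i < j\<close> in \<open>auto simp: n_def nth_append\<close>)
  next
    fix \<Phi> ps P
    assume *: "wf_constrs \<Phi>" "\<And>l. l < length (is' @ [j]) \<Longrightarrow> npoly UNIV (ps l)" "npoly UNIV P"
      "\<And>l. l < length (is' @ [j]) \<Longrightarrow> (is' @ [j]) ! l = i \<Longrightarrow> \<Phi> \<Turnstile> (ps l, P)"
    have nps: "npoly UNIV (ps l)" if "l < Suc n" for l using *(2)[of l] that by (simp add: n_def)
    have tier: "\<Phi> \<Turnstile> (ps l, P)" if "l < n" "is' ! l = i" for l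
      using *(4)[of l] that by (simp add: n_def nth_append)
    have npK: "npoly UNIV (K ps)" and npK0: "npoly UNIV (K0 ps)"
      using nps by (auto intro!: np_K np_K0)
    let ?up = "psub (wk 1)"
    let ?p = "\<lambda>e. ps n e + 1"
    let ?\<Phi>1 = "below \<Phi> ?p"
    \<comment> \<open>Size of the value after y steps, with y as variable 0; \<open>X1\<close> is
      its instance at y + 1, and \<open>Xi c\<close> the instance at \<open>c\<close> outside the
      binder.\<close>
    define X where "X = (\<lambda>e. e 0 * ?up (K ps) e + ?up (K0 ps) e + ?up P e)"
    define X1 where "X1 = (\<lambda>e. (e 0 + 1) * ?up (K ps) e + ?up (K0 ps) e + ?up P e)"
    define Xi where "Xi c = (\<lambda>e. c e * K ps e + K0 ps e + P e)" for c :: rpoly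
    let ?B = "Tensor (Wform w X) (Wform w (\<lambda>e. 3 * e 0))"
    have npup: "npoly UNIV (\<lambda>e. ?up (ps l) e + c)" if "l < Suc n" for l c
      using nps[OF that] by (intro npoly_add npoly_wk npoly_const)
    have wf1: "wf_constrs ?\<Phi>1" using *(1) nps[of n] by (intro wf_below npoly_respoly[of UNIV]) auto
    have npX: "npoly UNIV X" "npoly UNIV X1"
      unfolding X_def X1_def using *(3) npK npK0 by (intro npoly_add npoly_mult npoly_wk npoly_const npoly_var; simp)+
    have npXi: "npoly UNIV (Xi c)" if "npoly UNIV c" for c
      unfolding Xi_def using *(3) npK npK0 that by (intro npoly_add npoly_mult npoly_wk npoly_const npoly_var; simp)
    have B1: "fsub psuc ?B = Tensor (Wform w X1) (Wform w (\<lambda>e. 3 * e 0 + 3))"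
      by (simp add: fun_eq_iff X_def X1_def psub_def psuc_def wk_def rvar_def add.commute[of _ 3])
    have B2: "fsub (instr [c]) ?B = Tensor (Wform w (Xi c)) (Wform w (\<lambda>e. 3 * c e))" for c
      by (simp add: fun_eq_iff X_def Xi_def psub_def instr_def wk_def rvar_def)
    have satX: "ps l (\<lambda>i. e (Suc i)) + 2 \<le> X e" if "sat ?\<Phi>1 e" "l < n" "is' ! l = i" for l e
      using tier[OF that(2,3)] that(1) by (fastforce simp: X_def K0_def entails_sat sat_below)
    \<comment> \<open>By monotonicity of \<open>q k\<close>: the constraint
      \<open>y < ps n + 1\<close> replaces y in the size of the prefix, and the entry for the
      recursive value is not read.\<close>
    have satK: "psub (\<lambda>l e. if l < n then ?up (ps l) e + 2 else if l = n then X e else 3 * e 0 + 1) (q k) e \<le> ?up (K ps) e"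
      if "sat ?\<Phi>1 e" "k < w" for k e
    proof -
      let ?e = "\<lambda>i. e (Suc i)"
      have "q k (\<lambda>l. if l < n then ps l ?e + 2 else if l = n then X e else 3 * e 0 + 1) \<le>
          q k (\<lambda>l. if l < n then ps l ?e + 2 else 3 * (ps n ?e + 1) + 1)"
        by (rule npoly_mono[OF bounded_byD(1)[OF q[OF that(2)]]])
          (use that(1) in \<open>auto simp: sat_below n_def nth_append\<close>)
      also have "\<dots> \<le> K ps ?e"
        unfolding K_def psub_def
        by (rule member_le_sum[of k "{..<w}" "\<lambda>k. q k (\<lambda>l. if l < n then ps l ?e + 2 else 3 * (ps n ?e + 1) + 1)"])
          (use that(2) in auto)
      finally show ?thesis by (simp add: psub_def wk_def rvar_def cong: if_cong)
    qed
    let ?W = "\<lambda>M. pi M (wfun M w)"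
    let ?D = "\<lambda>M. prd M (?W M) (?W M)"
    let ?u = "Suc w + Suc n" and ?t = "Suc w + Suc n + 1" and ?s = "Suc w + Suc n + 2"
    let ?S = "\<lambda>k (M :: ('u, 'v) ambient) (\<rho> :: nat \<Rightarrow> nat \<Rightarrow> 'u) \<eta> v. \<forall>ts a r t0. length ts = n \<longrightarrow>
      (\<forall>l<n. wrep w M (ts ! l) (\<eta> (Suc w + l))) \<longrightarrow> a \<in> el M (?D M) \<longrightarrow>
      wrep w M r (fstv M (?W M) (?W M) a) \<longrightarrow> wrep w M t0 (sndv M (?W M) (?W M) a) \<longrightarrow>
      wrep w M (fc k (ts @ [r, t0])) (fstv M (?W M) (?W M) (app M (?D M) (?D M) v a)) \<and>
      wrep w M (Wcon k t0) (sndv M (?W M) (?W M) (app M (?D M) (?D M) v a))"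
    let ?Sz = "\<lambda>(M :: ('u, 'v) ambient) (\<rho> :: nat \<Rightarrow> nat \<Rightarrow> 'u) \<eta> v. \<forall>ts. length ts = n \<longrightarrow>
      (\<forall>l<n. wrep w M (ts ! l) (\<eta> (Suc w + l))) \<longrightarrow>
      wrep w M (f0 ts) (fstv M (?W M) (?W M) v) \<and> wrep w M Wzero (sndv M (?W M) (?W M) v)"
    have steps: "der w ?\<Phi>1 (map (\<lambda>l. (Suc w + l, Wform w (\<lambda>e. ?up (ps l) e + 2))) [0..<Suc n]) (Lolli ?B (fsub psuc ?B)) (?S k)"
      if "k < w" for k
    proof -
      let ?g = "\<lambda>l. if l < n then Suc w + l else if l = n then ?u else ?t"
      let ?ps = "\<lambda>l e. if l < n then ?up (ps l) e + 2 else if l = n then X e else 3 * e 0 + 1"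
      let ?C = "map (\<lambda>l. (Suc w + l, Wform w (\<lambda>e. ?up (ps l) e + 2))) [0..<n]"
      have "der w ?\<Phi>1 (map (\<lambda>l. (?g l, Wform w (?ps l))) [0..<length (is' @ [i, j])])
        (Wform w (\<lambda>e. psub ?ps (q k) e + X e)) (computes w (fc k) ?g (length (is' @ [i, j])) :: ('u, 'v) spec)"
      proof (rule bounded_byD(2)[OF q[OF that] wf1])
        show "npoly UNIV (?ps l)" for l
        proof -
          consider "l < n" | "l = n" | "n < l" by linarith
          then show ?thesis
            using npX(1) npup[of l 2] by cases auto
        qed
        show "?\<Phi>1 \<Turnstile> (?ps l, X)" if "l < length (is' @ [i, j])" "(is' @ [i, j]) ! l = i" for l
          using that satX \<open>i < j\<close> by (auto simp: entails_sat n_def nth_append less_Suc_eq)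
      qed (rule npX)
      moreover have "map (\<lambda>l. (?g l, Wform w (?ps l))) [0..<length (is' @ [i, j])] =
          ?C @ [(?u, Wform w X), (?t, Wform w (\<lambda>e. 3 * e 0 + 1))]"
        by (simp add: n_def)
      moreover have "length (is' @ [i, j]) = n + 2" by (simp add: n_def)
      ultimately have "der w ?\<Phi>1 (?C @ [(?u, Wform w X), (?t, Wform w (\<lambda>e. 3 * e 0 + 1))])
        (Wform w (\<lambda>e. psub ?ps (q k) e + X e)) (computes w (fc k) ?g (n + 2) :: ('u, 'v) spec)"
        by (simp only:)
      then have d1: "der w ?\<Phi>1 (?C @ [(?u, Wform w X), (?t, Wform w (\<lambda>e. 3 * e 0 + 1))])
        (Wform w X1) (computes w (fc k) ?g (n + 2) :: ('u, 'v) spec)"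
      proof (rule der_le_concl[OF _ _ le_Wform])
        show "?\<Phi>1 \<Turnstile> ((\<lambda>e. psub ?ps (q k) e + X e), X1)"
          using satK that by (fastforce simp: entails_sat X_def X1_def)
      qed (use npX in auto)
      \<comment> \<open>Copying brings the prefix from \<open>3 y\<close> to \<open>3 y + 1\<close>,
        and the constructor adds 2, which is the size required at y + 1.\<close>
      have d2: "der w ?\<Phi>1 [(?t, Wform w (\<lambda>e. 3 * e 0 + 1))] (Wform w (\<lambda>e. 3 * e 0 + 3))
        (\<lambda>(M :: ('u, 'v) ambient) \<rho> \<eta> v. \<forall>t. wrep w M t (\<eta> ?t) \<longrightarrow> wrep w M (Wcon k t) v)"
        by (rule der_adapt[OF der_Wform_con[OF wf1 _ that, of "\<lambda>e. 3 * e 0 + 1" ?t]]) (auto simp: numeral_eq_Suc)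
      have "der w ?\<Phi>1 ((?C @ [(?u, Wform w X)]) @ replicate 2 (?t, Wform w (\<lambda>e. (\<lambda>e. 3 * e 0) e + 1))) (fsub psuc ?B)
        (\<lambda>(M :: ('u, 'v) ambient) \<rho> \<eta> v. computes w (fc k) ?g (n + 2) M \<rho> \<eta> (fstv M (?W M) (?W M) v) \<and>
          (\<forall>t. wrep w M t (\<eta> ?t) \<longrightarrow> wrep w M (Wcon k t) (sndv M (?W M) (?W M) v)))"
        unfolding B1
        by (rule der_adapt[OF der_tensorR[OF d1 d2]])
          (auto simp: numeral_2_eq_2 ambient_universe.fst_pair ambient_universe.snd_pair)
      then have "der w ?\<Phi>1 ((?C @ [(?u, Wform w X)]) @ [(?t, Wform w (\<lambda>e. 3 * e 0))]) (fsub psuc ?B)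
        (\<lambda>(M :: ('u, 'v) ambient) \<rho> \<eta> v. isw w M (\<eta> ?t) \<longrightarrow> computes w (fc k) ?g (n + 2) M \<rho> \<eta> (fstv M (?W M) (?W M) v) \<and>
          (\<forall>t. wrep w M t (\<eta> ?t) \<longrightarrow> wrep w M (Wcon k t) (sndv M (?W M) (?W M) v)))"
        by (rule der_Wform_contract) auto
      then have d3: "der w ?\<Phi>1 (?C @ [(?u, Wform w X), (?t, Wform w (\<lambda>e. 3 * e 0))]) (fsub psuc ?B)
        (\<lambda>(M :: ('u, 'v) ambient) \<rho> \<eta> v. isw w M (\<eta> ?t) \<longrightarrow> computes w (fc k) ?g (n + 2) M \<rho> \<eta> (fstv M (?W M) (?W M) v) \<and>
          (\<forall>t. wrep w M t (\<eta> ?t) \<longrightarrow> wrep w M (Wcon k t) (sndv M (?W M) (?W M) v)))"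
        by simp
      have "?u \<notin> names ?C" "?t \<notin> names ?C" "?u \<noteq> ?t" by auto
      note d4 = der_tensorL[OF d3 this, where k = ?s]
      have "der w ?\<Phi>1 (map (\<lambda>l. (Suc w + l, Wform w (\<lambda>e. ?up (ps l) e + 2))) [0..<Suc n] @ [(?s, ?B)]) (fsub psuc ?B)
        (\<lambda>(M :: ('u, 'v) ambient) \<rho> \<eta> v. \<forall>ts r t0. length ts = n \<longrightarrow>
          (\<forall>l<n. wrep w M (ts ! l) (\<eta> (Suc w + l))) \<longrightarrow>
          wrep w M r (fstv M (?W M) (?W M) (\<eta> ?s)) \<longrightarrow> wrep w M t0 (sndv M (?W M) (?W M) (\<eta> ?s)) \<longrightarrow>
          wrep w M (fc k (ts @ [r, t0])) (fstv M (?W M) (?W M) v) \<and>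
          wrep w M (Wcon k t0) (sndv M (?W M) (?W M) v))"
      proof (rule der_adapt[OF der_weaken[OF d4, where \<Delta> = "[(Suc w + n, Wform w (\<lambda>e. ?up (ps n) e + 2))]"]], goal_cases)
        case 1
        have "wf_form (Wform w (\<lambda>e. ?up (ps n) e + 2))" by (rule wf_Wform, rule npup) simp
        then show ?case by (simp del: psub_wk)
      next
        case 2
        show ?case by simp
      next
        case (4 M \<rho> \<eta> v)
        show ?case
        proof (intro allI impI)
          fix ts r t0 assume H: "length ts = n" "\<forall>l<n. wrep w M (ts ! l) (\<eta> (Suc w + l))"
            "wrep w M r (fstv M (?W M) (?W M) (\<eta> ?s))" "wrep w M t0 (sndv M (?W M) (?W M) (\<eta> ?s))"
          from 4(4) H(4) have c: "computes w (fc k) ?g (n + 2) M \<rho>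
              (\<eta>(?u := fstv M (?W M) (?W M) (\<eta> ?s), ?t := sndv M (?W M) (?W M) (\<eta> ?s))) (fstv M (?W M) (?W M) v)"
            and s: "wrep w M (Wcon k t0) (sndv M (?W M) (?W M) v)"
            by (auto simp: isw_def)
          from c H have "wrep w M (fc k (ts @ [r, t0])) (fstv M (?W M) (?W M) v)"
            by (simp add: computes_def nth_append less_Suc_eq all_conj_distrib nth_Cons')
          with s show "wrep w M (fc k (ts @ [r, t0])) (fstv M (?W M) (?W M) v) \<and>
              wrep w M (Wcon k t0) (sndv M (?W M) (?W M) v)" by blast
        qed
      qed simp
      from der_lolliR[OF this] show ?thesis
        by (rule der_adapt) auto
    qed
    have base: "der w \<Phi> (map (\<lambda>l. (Suc w + l, Wform w (\<lambda>e. ps l e + 1))) [0..<Suc n]) (fsub (instr [\<lambda>e. 0]) ?B) ?Sz"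
    proof -
      let ?C = "map (\<lambda>l. (Suc w + l, Wform w (\<lambda>e. ps l e + 1))) [0..<n]"
      have "der w \<Phi> (map (\<lambda>l. (Suc w + l, Wform w (\<lambda>e. ps l e + 1))) [0..<length is'])
        (Wform w (\<lambda>e. psub (\<lambda>l e. ps l e + 1) q0 e + (P e + 1))) (computes w f0 (\<lambda>l. Suc w + l) (length is') :: ('u, 'v) spec)"
        by (rule bounded_byD(2)[OF q0 *(1)]) (use nps tier *(3) in \<open>auto simp: n_def entails_sat\<close>)
      then have "der w \<Phi> ?C (Wform w (Xi (\<lambda>e. 0))) (computes w f0 (\<lambda>l. Suc w + l) n :: ('u, 'v) spec)"
        unfolding n_def[symmetric]
      proof (rule der_le_concl[OF _ _ le_Wform])
        have "psub (\<lambda>l e. ps l e + 1) q0 e \<le> psub (\<lambda>l e. ps l e + 2) q0 e" for e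
          unfolding psub_def by (rule npoly_mono[OF bounded_byD(1)[OF q0]]) auto
        then show "\<Phi> \<Turnstile> ((\<lambda>e. psub (\<lambda>l e. ps l e + 1) q0 e + (P e + 1)), Xi (\<lambda>e. 0))"
          by (auto simp: entails_sat Xi_def K0_def intro!: le_SucI)
      qed (use npXi in auto)
      moreover have "der w \<Phi> [] (Wform w (\<lambda>e. 3 * 0)) (\<lambda>(M :: ('u, 'v) ambient) \<rho> \<eta> v. wrep w M Wzero v)"
        unfolding Wform_eq by (rule der_Wgen_zero) (use *(1) in \<open>auto simp: entails_sat\<close>)
      ultimately have "der w \<Phi> ?C (fsub (instr [\<lambda>e. 0]) ?B) ?Sz"
        unfolding B2
        by (rule der_adapt[OF der_tensorR])
          (auto simp: ambient_universe.fst_pair ambient_universe.snd_pair computes_def)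
      then show ?thesis
        by (rule der_struct[where \<Delta> = "[(Suc w + n, Wform w (\<lambda>e. ps n e + 1))]"]) (use nps in auto)
    qed
    have wfB: "wf_form ?B" "wf_form (fsub psuc ?B)" "wf_form (fsub (instr [\<lambda>e. 0]) ?B)" "wf_form (fsub (instr [?p]) ?B)"
      unfolding B1 B2 using npX npXi nps by auto
    have occ: "\<not> occ False 0 ?B" by simp
    have it: "der w \<Phi> (map (\<lambda>l. (Suc w + l, Wform w (ps l))) [0..<Suc n]) (fsub (instr [?p]) ?B)
      (\<lambda>M \<rho> \<eta> v. (\<forall>l<Suc n. isw w M (\<eta> (Suc w + l))) \<longrightarrow> (\<exists>fs z. length fs = w \<and>
      (\<forall>k<w. fs ! k \<in> el M (fn M (tsem M \<rho> (erase ?B)) (tsem M \<rho> (erase ?B))) \<and> ?S k M \<rho> \<eta> (fs ! k)) \<and>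
      z \<in> el M (tsem M \<rho> (erase ?B)) \<and> ?Sz M \<rho> \<eta> z \<and>
      (\<forall>t. wrep w M t (\<eta> (Suc w + n)) \<longrightarrow> v = wval M (tsem M \<rho> (erase ?B)) fs z t)))"
      by (rule der_word_iterate[OF *(1) nps _ wfB occ steps base]) (auto simp: above_def)
    have "der w \<Phi> [(1, Wform w (Xi ?p))] (Wform w (Xi ?p)) (\<lambda>(M :: ('u, 'v) ambient) \<rho> \<eta> v. v = \<eta> 1)"
      using *(1) npXi nps by (intro der_ax le_form_refl) auto
    then have "der w \<Phi> ([] @ [(1, Wform w (Xi ?p)), (2, Wform w (\<lambda>e. 3 * ?p e))]) (Wform w (Xi ?p))
        (\<lambda>(M :: ('u, 'v) ambient) \<rho> \<eta> v. v = \<eta> 1)"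
      by (rule der_struct[where \<Delta> = "[(2, Wform w (\<lambda>e. 3 * ?p e))]"]) (use nps in auto)
    from der_tensorL[OF this, of 0]
    have "der w \<Phi> ([] @ [(0, fsub (instr [?p]) ?B)]) (Wform w (Xi ?p))
        (\<lambda>(M :: ('u, 'v) ambient) \<rho> \<eta> v. v = fstv M (?W M) (?W M) (\<eta> 0))"
      unfolding B2 by (auto elim!: der_adapt)
    note proj = this
    have "der w \<Phi> (map (\<lambda>l. (Suc w + l, Wform w (ps l))) [0..<Suc n]) (Wform w (Xi ?p))
      (computes w (\<lambda>ts. wrec fc f0 (butlast ts) (last ts)) ((+) (Suc w)) (Suc n) :: ('u, 'v) spec)"
    proof (rule der_adapt[OF der_cut[OF it proj]], goal_cases)
      case (4 M \<rho> \<eta> v)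
      show ?case unfolding computes_def
      proof (intro allI impI)
        fix ts :: "word list" assume ts: "length ts = Suc n" "\<forall>l<Suc n. wrep w M (ts ! l) (\<eta> (Suc w + l))"
        obtain us t where ust: "ts = us @ [t]" "length us = n"
          using ts(1) by (cases ts rule: rev_cases) auto
        have us: "\<forall>l<n. wrep w M (us ! l) (\<eta> (Suc w + l))" and t: "wrep w M t (\<eta> (Suc w + n))"
          using ts(2) ust by (auto simp: nth_append less_Suc_eq)
        have "\<forall>l<Suc n. isw w M (\<eta> (Suc w + l))" using ts(2) unfolding isw_def by blast
        with 4(4) obtain fs z where fz: "length fs = w"
          "\<And>k. k < w \<Longrightarrow> fs ! k \<in> el M (fn M (?D M) (?D M))" "\<And>k. k < w \<Longrightarrow> ?S k M \<rho> \<eta> (fs ! k)"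
          "z \<in> el M (?D M)" "?Sz M \<rho> \<eta> z"
          and v: "v = fstv M (?W M) (?W M) (wval M (?D M) fs z t)"
          using t by auto
        \<comment> \<open>Invariant: after the constructors of t the state is the pair of the
          recursive value at t and t itself.\<close>
        have "wval M (?D M) fs z t \<in> el M (?D M) \<and>
          wrep w M (wrec fc f0 us t) (fstv M (?W M) (?W M) (wval M (?D M) fs z t)) \<and>
          wrep w M t (sndv M (?W M) (?W M) (wval M (?D M) fs z t))" if "t \<in> words w" for t
          using that
        proof induction
          case 1
          then show ?case using fz(4,5) ust(2) us by simp
        next
          case (2 k t)
          let ?a = "wval M (?D M) fs z t"
          from 2(3) have a: "?a \<in> el M (?D M)" "wrep w M (wrec fc f0 us t) (fstv M (?W M) (?W M) ?a)"
            "wrep w M t (sndv M (?W M) (?W M) ?a)" by auto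
          show ?case
            using ambient_universe.app_el[OF 4(1) fz(2)[OF 2(1)] a(1)]
              fz(3)[OF 2(1), rule_format, OF ust(2) _ a] us by simp
        qed
        then show "wrep w M (wrec fc f0 (butlast ts) (last ts)) v"
          using wrep_words[OF t] by (simp add: ust v)
      qed
    qed auto
    from der_rename[OF this, of "\<lambda>m. m - Suc w"]
    show "der w \<Phi> (map (\<lambda>l. (l, Wform w (ps l))) [0..<length (is' @ [j])]) (Wform w (\<lambda>e. psub ps Q e + P e))
        (computes w (\<lambda>ts. wrec fc f0 (butlast ts) (last ts)) id (length (is' @ [j])) :: ('u, 'v) spec)"
    proof (rule der_adapt, goal_cases)
      case 2
      show ?case
        by (simp add: fun_eq_iff Xi_def Q_def K_def K0_def psub_def rvar_def cong: sum.cong if_cong)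
    qed (simp_all add: comp_def computes_def n_def)
  qed
qed

text \<open>Each step overwrites the state, so the state keeps a fixed size and no growth
  accumulates; this is why the tested word may have any tier \<open>j\<close>.\<close>

lemma representable_cond:
  assumes fc: "\<And>k. k < w \<Longrightarrow> representable TYPE('u \<times> 'v) w (fc k) (is' @ [j]) i"
    and f0: "representable TYPE('u \<times> 'v) w f0 is' i"
  shows "representable TYPE('u \<times> 'v) w (\<lambda>ts. wcond fc f0 (butlast ts) (last ts)) (is' @ [j]) i"
proof -
  define n where "n = length is'"
  obtain q0 where q0: "bounded_by TYPE('u \<times> 'v) w f0 is' i q0"
    using f0 unfolding representable_def by blast
  have "\<forall>k<w. \<exists>q. bounded_by TYPE('u \<times> 'v) w (fc k) (is' @ [j]) i q"
    using fc unfolding representable_def by blast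
  then obtain q where q: "\<And>k. k < w \<Longrightarrow> bounded_by TYPE('u \<times> 'v) w (fc k) (is' @ [j]) i (q k)"
    by metis
  \<comment> \<open>In the sizes, 3 is the 2 of \<open>der_word_iterate\<close> plus 1 for the
    predecessor. The final 3 pays for raising the common bound \<open>P\<close> by the same
    amount.\<close>
  define K where "K \<sigma> = (\<lambda>e. (\<Sum>k<w. psub (\<lambda>l e. \<sigma> l e + 3) (q k) e) + psub (\<lambda>l e. \<sigma> l e + 3) q0 e + 3)" for \<sigma> :: rsubst
  have np_K: "npoly U (K \<sigma>)" if "\<And>l. l \<le> n \<Longrightarrow> i < (is' @ [j]) ! l \<Longrightarrow> npoly U (\<sigma> l)" for U \<sigma>
  proof -
    have "npoly U (psub (\<lambda>l e. \<sigma> l e + 3) (q k))" if "k < w" for k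
      by (rule npoly_psub[OF bounded_byD(1)[OF q[OF that]]])
        (use \<open>\<And>l. l \<le> n \<Longrightarrow> i < (is' @ [j]) ! l \<Longrightarrow> npoly U (\<sigma> l)\<close> in \<open>auto simp: n_def\<close>)
    moreover have "npoly U (psub (\<lambda>l e. \<sigma> l e + 3) q0)"
    proof (rule npoly_psub[OF bounded_byD(1)[OF q0]])
      fix l assume "l \<in> {l. l < length is' \<and> i < is' ! l}"
      then show "npoly U (\<lambda>e. \<sigma> l e + 3)" using that[of l] by (auto simp: n_def nth_append)
    qed
    ultimately show ?thesis unfolding K_def by (intro npoly_add npoly_sum npoly_const) auto
  qed
  show ?thesis
  proof (rule representableI)
    show "npoly {l. l < length (is' @ [j]) \<and> i < (is' @ [j]) ! l} (K rvar)"
      by (intro np_K npoly_var) (auto simp: n_def)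
  next
    fix \<Phi> ps P
    assume *: "wf_constrs \<Phi>" "\<And>l. l < length (is' @ [j]) \<Longrightarrow> npoly UNIV (ps l)" "npoly UNIV P"
      "\<And>l. l < length (is' @ [j]) \<Longrightarrow> (is' @ [j]) ! l = i \<Longrightarrow> \<Phi> \<Turnstile> (ps l, P)"
    have nps: "npoly UNIV (ps l)" if "l < Suc n" for l using *(2)[of l] that by (simp add: n_def)
    have npK: "npoly UNIV (K ps)" using nps by (auto intro!: np_K)
    let ?up = "psub (wk 1)"
    let ?p = "\<lambda>e. ps n e + 1"
    let ?\<Phi>1 = "below \<Phi> ?p"
    define R where "R = (\<lambda>e. K ps e + P e)"
    \<comment> \<open>\<open>R\<close> is weakened over the counter y: the state has the same type
      before and after a step.\<close>
    let ?B = "Wform w (?up R)"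
    have npup: "npoly UNIV (\<lambda>e. ?up (ps l) e + c)" if "l < Suc n" for l c
      using nps[OF that] by (intro npoly_add npoly_wk npoly_const)
    have wf1: "wf_constrs ?\<Phi>1" using *(1) nps[of n] by (intro wf_below npoly_respoly[of UNIV]) auto
    have npR: "npoly UNIV R" unfolding R_def using npK *(3) by auto
    have B1: "fsub psuc ?B = ?B" by simp
    have B2: "fsub (instr [c]) ?B = Wform w R" for c by simp
    let ?W = "\<lambda>M. pi M (wfun M w)"
    let ?s = "Suc w + Suc n" and ?u = "Suc w + Suc n + 1"
    let ?S = "\<lambda>k (M :: ('u, 'v) ambient) (\<rho> :: nat \<Rightarrow> nat \<Rightarrow> 'u) \<eta> v. \<forall>ts t a. length ts = n \<longrightarrow>
      (\<forall>l<n. wrep w M (ts ! l) (\<eta> (Suc w + l))) \<longrightarrow> wrep w M t (\<eta> (Suc w + n)) \<longrightarrow> a \<in> el M (?W M) \<longrightarrow>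
      wrep w M (fc k (ts @ [wpred t])) (app M (?W M) (?W M) v a)"
    let ?Sz = "\<lambda>(M :: ('u, 'v) ambient) (\<rho> :: nat \<Rightarrow> nat \<Rightarrow> 'u) \<eta> v. \<forall>ts. length ts = n \<longrightarrow>
      (\<forall>l<n. wrep w M (ts ! l) (\<eta> (Suc w + l))) \<longrightarrow> wrep w M (f0 ts) v"
    have steps: "der w ?\<Phi>1 (map (\<lambda>l. (Suc w + l, Wform w (\<lambda>e. ?up (ps l) e + 2))) [0..<Suc n]) (Lolli ?B (fsub psuc ?B)) (?S k)"
      if "k < w" for k
    proof -
      let ?g = "\<lambda>l. if l < n then Suc w + l else ?u"
      let ?ps = "\<lambda>l e. if l < n then ?up (ps l) e + 2 else ?up (ps n) e + 3"
      let ?P = "\<lambda>e. ?up P e + 3"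
      let ?C = "map (\<lambda>l. (Suc w + l, Wform w (\<lambda>e. ?up (ps l) e + 2))) [0..<n]"
      have "der w ?\<Phi>1 (map (\<lambda>l. (?g l, Wform w (?ps l))) [0..<length (is' @ [j])])
        (Wform w (\<lambda>e. psub ?ps (q k) e + ?P e)) (computes w (fc k) ?g (length (is' @ [j])) :: ('u, 'v) spec)"
      proof (rule bounded_byD(2)[OF q[OF that] wf1])
        show "npoly UNIV ?P" using *(3) by (intro npoly_add npoly_wk npoly_const)
        show "npoly UNIV (?ps l)" for l
          using npup[of l 2] npup[of n 3] by (cases "l < n") auto
        show "?\<Phi>1 \<Turnstile> (?ps l, ?P)" if "l < length (is' @ [j])" "(is' @ [j]) ! l = i" for l
        proof -
          have "l < n \<or> l = n" using that(1) by (auto simp: n_def)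
          then show ?thesis using *(4)[OF that] by (fastforce simp: entails_sat sat_below)
        qed
      qed
      moreover have "map (\<lambda>l. (?g l, Wform w (?ps l))) [0..<length (is' @ [j])] =
          ?C @ [(?u, Wform w (\<lambda>e. ?up (ps n) e + 3))]"
        by (simp add: n_def)
      moreover have "length (is' @ [j]) = n + 1" by (simp add: n_def)
      ultimately have "der w ?\<Phi>1 (?C @ [(?u, Wform w (\<lambda>e. ?up (ps n) e + 3))])
        (Wform w (\<lambda>e. psub ?ps (q k) e + ?P e)) (computes w (fc k) ?g (n + 1) :: ('u, 'v) spec)"
        by (simp only:)
      then have d1: "der w ?\<Phi>1 (?C @ [(?u, Wform w (\<lambda>e. ?up (ps n) e + 3))]) ?B
        (computes w (fc k) ?g (n + 1) :: ('u, 'v) spec)"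
      proof (rule der_le_concl[OF _ _ le_Wform])
        have "psub ?ps (q k) e + 3 \<le> ?up (K ps) e" for e
        proof -
          let ?e = "\<lambda>i. e (Suc i)"
          have "q k (\<lambda>l. ?ps l e) \<le> q k (\<lambda>l. ps l ?e + 3)"
            by (rule npoly_mono[OF bounded_byD(1)[OF q[OF that]]]) (auto simp: n_def less_Suc_eq)
          also have "\<dots> \<le> (\<Sum>k<w. q k (\<lambda>l. ps l ?e + 3))"
            by (rule member_le_sum[of k "{..<w}" "\<lambda>k. q k (\<lambda>l. ps l ?e + 3)"]) (use that in auto)
          finally show ?thesis by (simp add: K_def psub_def wk_def rvar_def cong: if_cong)
        qed
        then show "?\<Phi>1 \<Turnstile> ((\<lambda>e. psub ?ps (q k) e + ?P e), ?up R)"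
          by (fastforce simp: entails_sat R_def)
        show "wf_form ?B" using npR by (intro wf_Wform npoly_wk)
      qed
      have "der w ?\<Phi>1 [(Suc w + n, Wform w (\<lambda>e. ?up (ps n) e + 2))] (Wform w (\<lambda>e. ?up (ps n) e + 3))
        (\<lambda>(M :: ('u, 'v) ambient) \<rho> \<eta> v. \<forall>t. wrep w M t (\<eta> (Suc w + n)) \<longrightarrow> wrep w M (wpred t) v)"
        by (rule der_adapt[OF der_Wform_pred[OF wf1 npup[OF lessI, of 2], of w "Suc w + n"]]) (auto simp: numeral_eq_Suc)
      note pred = this
      have "der w ?\<Phi>1 (map (\<lambda>l. (Suc w + l, Wform w (\<lambda>e. ?up (ps l) e + 2))) [0..<Suc n]) ?B
        (\<lambda>(M :: ('u, 'v) ambient) \<rho> \<eta> v. \<forall>ts t. length ts = n \<longrightarrow>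
          (\<forall>l<n. wrep w M (ts ! l) (\<eta> (Suc w + l))) \<longrightarrow> wrep w M t (\<eta> (Suc w + n)) \<longrightarrow>
          wrep w M (fc k (ts @ [wpred t])) v)"
      proof (rule der_adapt[OF der_cut[OF pred d1]], goal_cases)
        case (4 M \<rho> \<eta> v)
        show ?case
        proof (intro allI impI)
          fix ts t assume H: "length ts = n" "\<forall>l<n. wrep w M (ts ! l) (\<eta> (Suc w + l))"
            "wrep w M t (\<eta> (Suc w + n))"
          with 4(4) obtain a where "wrep w M (wpred t) a" "computes w (fc k) ?g (n + 1) M \<rho> (\<eta>(?u := a)) v"
            by blast
          with H show "wrep w M (fc k (ts @ [wpred t])) v"
            by (simp add: computes_def nth_append less_Suc_eq all_conj_distrib)
        qed
      qed auto
      then have "der w ?\<Phi>1 (map (\<lambda>l. (Suc w + l, Wform w (\<lambda>e. ?up (ps l) e + 2))) [0..<Suc n] @ [(?s, ?B)]) ?B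
        (\<lambda>(M :: ('u, 'v) ambient) \<rho> \<eta> v. \<forall>ts t. length ts = n \<longrightarrow>
          (\<forall>l<n. wrep w M (ts ! l) (\<eta> (Suc w + l))) \<longrightarrow> wrep w M t (\<eta> (Suc w + n)) \<longrightarrow>
          wrep w M (fc k (ts @ [wpred t])) v)"
      proof (rule der_weaken)
        have "wf_form ?B" using npR by (intro wf_Wform npoly_wk)
        then show "\<forall>(n, A)\<in>set [(?s, ?B)]. wf_form A" by (simp del: psub_wk)
      qed
      from der_lolliR[OF this] show ?thesis
        unfolding B1 by (rule der_adapt) auto
    qed
    have base: "der w \<Phi> (map (\<lambda>l. (Suc w + l, Wform w (\<lambda>e. ps l e + 1))) [0..<Suc n]) (fsub (instr [\<lambda>e. 0]) ?B) ?Sz"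
    proof -
      have "der w \<Phi> (map (\<lambda>l. (Suc w + l, Wform w (\<lambda>e. ps l e + 1))) [0..<length is'])
        (Wform w (\<lambda>e. psub (\<lambda>l e. ps l e + 1) q0 e + (P e + 1))) (computes w f0 (\<lambda>l. Suc w + l) (length is') :: ('u, 'v) spec)"
      proof (rule bounded_byD(2)[OF q0 *(1)])
        show "\<Phi> \<Turnstile> ((\<lambda>e. ps l e + 1), (\<lambda>e. P e + 1))" if "l < length is'" "is' ! l = i" for l
          using *(4)[of l] that by (simp add: entails_sat nth_append)
      qed (use nps *(3) in \<open>auto simp: n_def\<close>)
      then have "der w \<Phi> (map (\<lambda>l. (Suc w + l, Wform w (\<lambda>e. ps l e + 1))) [0..<n]) (Wform w R)
        (computes w f0 (\<lambda>l. Suc w + l) n :: ('u, 'v) spec)"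
        unfolding n_def[symmetric]
      proof (rule der_le_concl[OF _ _ le_Wform])
        have "psub (\<lambda>l e. ps l e + 1) q0 e \<le> psub (\<lambda>l e. ps l e + 3) q0 e" for e
          unfolding psub_def by (rule npoly_mono[OF bounded_byD(1)[OF q0]]) auto
        then show "\<Phi> \<Turnstile> ((\<lambda>e. psub (\<lambda>l e. ps l e + 1) q0 e + (P e + 1)), R)"
          by (auto simp: entails_sat R_def K_def intro!: le_SucI trans_le_add2)
      qed (use npR in auto)
      then have "der w \<Phi> (map (\<lambda>l. (Suc w + l, Wform w (\<lambda>e. ps l e + 1))) [0..<Suc n]) (Wform w R)
        (computes w f0 (\<lambda>l. Suc w + l) n :: ('u, 'v) spec)"
        by (rule der_struct[where \<Delta> = "[(Suc w + n, Wform w (\<lambda>e. ps n e + 1))]"]) (use nps in auto)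
      then show ?thesis unfolding B2 by (rule der_conseq) (auto simp: computes_def)
    qed
    have wfB: "wf_form ?B" "wf_form (fsub psuc ?B)" "wf_form (fsub (instr [\<lambda>e. 0]) ?B)" "wf_form (fsub (instr [?p]) ?B)"
      unfolding B1 B2 using npR by (intro wf_Wform npoly_wk; simp)+
    have occ: "\<not> occ False 0 ?B" by simp
    have "der w \<Phi> (map (\<lambda>l. (Suc w + l, Wform w (ps l))) [0..<Suc n]) (fsub (instr [?p]) ?B)
      (\<lambda>M \<rho> \<eta> v. (\<forall>l<Suc n. isw w M (\<eta> (Suc w + l))) \<longrightarrow> (\<exists>fs z. length fs = w \<and>
      (\<forall>k<w. fs ! k \<in> el M (fn M (tsem M \<rho> (erase ?B)) (tsem M \<rho> (erase ?B))) \<and> ?S k M \<rho> \<eta> (fs ! k)) \<and>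
      z \<in> el M (tsem M \<rho> (erase ?B)) \<and> ?Sz M \<rho> \<eta> z \<and>
      (\<forall>t. wrep w M t (\<eta> (Suc w + n)) \<longrightarrow> v = wval M (tsem M \<rho> (erase ?B)) fs z t)))"
      by (rule der_word_iterate[OF *(1) nps _ wfB occ steps base]) (auto simp: above_def)
    then have "der w \<Phi> (map (\<lambda>l. (Suc w + l, Wform w (ps l))) [0..<Suc n]) (Wform w R)
      (computes w (\<lambda>ts. wcond fc f0 (butlast ts) (last ts)) ((+) (Suc w)) (Suc n) :: ('u, 'v) spec)"
      unfolding B2
    proof (rule der_conseq, goal_cases)
      case (1 M \<rho> \<eta> v)
      show ?case unfolding computes_def
      proof (intro allI impI)
        fix ts :: "word list" assume ts: "length ts = Suc n" "\<forall>l<Suc n. wrep w M (ts ! l) (\<eta> (Suc w + l))"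
        obtain us t where ust: "ts = us @ [t]" "length us = n"
          using ts(1) by (cases ts rule: rev_cases) auto
        have us: "\<forall>l<n. wrep w M (us ! l) (\<eta> (Suc w + l))" and t: "wrep w M t (\<eta> (Suc w + n))"
          using ts(2) ust by (auto simp: nth_append less_Suc_eq)
        have "\<forall>l<Suc n. isw w M (\<eta> (Suc w + l))" using ts(2) unfolding isw_def by blast
        with 1(4) obtain fs z where fz: "length fs = w"
          "\<And>k. k < w \<Longrightarrow> fs ! k \<in> el M (fn M (?W M) (?W M))" "\<And>k. k < w \<Longrightarrow> ?S k M \<rho> \<eta> (fs ! k)"
          "z \<in> el M (?W M)" "?Sz M \<rho> \<eta> z"
          and v: "v = wval M (?W M) fs z t"
          using t by auto
        have el: "wval M (?W M) fs z t \<in> el M (?W M)" if "t \<in> words w" for t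
          using that by induction (use fz ambient_universe.app_el[OF 1(1)] in auto)
        \<comment> \<open>The step of the outermost constructor computes its branch from the
          predecessor of the whole word, whatever the inner steps produced; so a case distinction
          suffices.\<close>
        have "wrep w M (wcond fc f0 us t) v"
          using wrep_words[OF t]
        proof cases
          case 1
          then show ?thesis using fz(5) us ust v by simp
        next
          case (2 k t')
          then show ?thesis using fz(3)[OF 2(2), rule_format, of us t] us t ust v el by simp
        qed
        then show "wrep w M (wcond fc f0 (butlast ts) (last ts)) v" by (simp add: ust)
      qed
    qed
    from der_rename[OF this, of "\<lambda>m. m - Suc w"]
    show "der w \<Phi> (map (\<lambda>l. (l, Wform w (ps l))) [0..<length (is' @ [j])]) (Wform w (\<lambda>e. psub ps (K rvar) e + P e))
        (computes w (\<lambda>ts. wcond fc f0 (butlast ts) (last ts)) id (length (is' @ [j])) :: ('u, 'v) spec)"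
    proof (rule der_adapt, goal_cases)
      case 2
      show ?case
        by (simp add: fun_eq_iff R_def K_def psub_def rvar_def cong: sum.cong)
    qed (simp_all add: comp_def computes_def n_def)
  qed
qed

lemma rrw_representable: "rrw w f tiers i \<Longrightarrow> representable TYPE('u \<times> 'v) w f tiers i"
proof (induction rule: rrw.induct)
  case (rrw_id i)
  have "representable TYPE('u \<times> 'v) w (\<lambda>ts. ts ! 0) [i] i"
    by (rule representable_proj) auto
  moreover have "computes w hd g (Suc 0) = (computes w (\<lambda>ts. ts ! 0) g (Suc 0) :: ('u, 'v) spec)" for g
    by (auto simp: fun_eq_iff computes_def length_Suc_conv)
  ultimately show ?case
    unfolding representable_def bounded_by_def by simp
qed (blast intro: representable_zero representable_con representable_proj representable_comp
    representable_rec representable_cond)+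

section \<open>The canonical representations\<close>

context ambient_universe
begin

text \<open>Representations are obtained as denotations of the derivations of zero and successor.
  Sizes vanish in the meaning, so the successor at size 0 applies to every representation.\<close>

lemma wrep_exists: "t \<in> words w \<Longrightarrow> \<exists>u. wrep w M t u"
proof (induction rule: words.induct)
  case 1
  have "der w {} [] (Wgen w (\<lambda>e. 0) (\<lambda>e. 0) (\<lambda>e. 0)) (\<lambda>(M :: ('u, 'v) ambient) \<rho> \<eta> v. wrep w M Wzero v)"
    by (rule der_Wgen_zero) (auto simp: wf_constrs_def entails_sat)
  then show ?case
    by (rule derE) (use ambient_universe_axioms in fastforce)
next
  case (2 k t)
  then obtain u where u: "wrep w M t u" by blast
  have "der w {} [(0, Zform w (\<lambda>e. 0))] (Zform w (\<lambda>e. 0 + 1))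
    (\<lambda>(M :: ('u, 'v) ambient) \<rho> \<eta> v. \<forall>t. wrep w M t (\<eta> 0) \<longrightarrow> wrep w M (Wcon k t) v)"
    by (rule der_Zform_succ) (use 2 in \<open>auto simp: wf_constrs_def\<close>)
  then show ?case
  proof (rule derE)
    fix \<pi>
    assume "\<And>(M :: ('u, 'v) ambient) \<rho> \<eta>. ambient_universe w M \<Longrightarrow> typed M \<rho> \<eta> [(0, Zform w (\<lambda>e. 0))] \<Longrightarrow>
      \<forall>t. wrep w M t (\<eta> 0) \<longrightarrow> wrep w M (Wcon k t)
        (psem M \<rho> \<pi> (map (\<lambda>x. \<eta> (fst x)) [(0, Zform w (\<lambda>e. 0))]))"
    from this[OF ambient_universe_axioms, of undefined "\<lambda>_. u"] u show ?thesis
      by (auto simp: wrep_def)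
  qed
qed

lemma wrep_phi:
  assumes "t \<in> words w"
  shows "wrep w M t (phi w M t)"
proof -
  have "phi w M t = (THE u. wrep w M t u)"
    using assms by (simp add: phi_def wrep_def)
  moreover have "wrep w M t (THE u. wrep w M t u)"
    using wrep_exists[OF assms] wrep_unique by (metis theI')
  ultimately show ?thesis by simp
qed

text \<open>A representation iterates the given functions along t; for the constructors themselves
  this returns t.\<close>

lemma psi_wrep:
  assumes "wrep w M t u"
  shows "psi w M u = wordv M t"
proof -
  let ?cs = "map (conv M) [0..<w]"
  have val: "wval M (wordset M) ?cs (wordv M Wzero) t = wordv M t" if "t \<in> words w" for t
    using that by induction (auto simp: con_app)
  have "set ?cs \<subseteq> el M (fn M (wordset M) (wordset M))" by (auto intro: con_el)
  moreover have "wordv M Wzero \<in> el M (wordset M)" by (auto simp: word_el intro: words.intros)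
  ultimately have "psi w M u = wval M (wordset M) ?cs (wordv M Wzero) t"
    using assms by (simp add: psi_def wrep_def)
  then show ?thesis using val[OF wrep_words[OF assms]] by simp
qed

end

theorem theorem7p2:
  fixes w :: nat and f :: "word list \<Rightarrow> word" and tiers :: "nat list" and i :: nat
    and xs :: "nat list" and x :: nat
  assumes "rrw w f tiers i"
    and "length xs = length tiers"
    and "distinct (x # xs)"
  shows "\<exists>\<pi> q. respoly q \<and> fvp q \<subseteq> {xs ! j | j. j < length tiers \<and> i < tiers ! j} \<and>
    qbal {(rvar (xs ! k), rvar x) | k. k < length tiers \<and> tiers ! k = i}
      (map (\<lambda>y. Wform w (rvar y)) xs) (Wform w (\<lambda>e. q e + e x)) \<pi> \<and>
    (\<forall>(M :: ('u, 'v) ambient) \<rho> ts.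
       ambient_universe w M \<and> length ts = length tiers \<and> set ts \<subseteq> words w \<longrightarrow>
       psi w M (psem M \<rho> \<pi> (map (phi w M) ts)) = wordv M (f ts))"
proof -
  let ?n = "length tiers"
  let ?V = "{xs ! j | j. j < ?n \<and> i < tiers ! j}"
  let ?\<Phi> = "{(rvar (xs ! k), rvar x) | k. k < ?n \<and> tiers ! k = i}"
  let ?ps = "\<lambda>l. rvar (xs ! l)"
  obtain q0 where q0: "bounded_by TYPE('u \<times> 'v) w f tiers i q0"
    using rrw_representable[OF assms(1)] unfolding representable_def by blast
  define q where "q = psub ?ps q0"
  have q: "npoly ?V q"
    unfolding q_def by (rule npoly_psub[OF bounded_byD(1)[OF q0]]) auto
  have ctx: "map snd (map (\<lambda>l. (l, Wform w (?ps l))) [0..<?n]) = map (\<lambda>y. Wform w (rvar y)) xs"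
    using assms(2) by (intro nth_equalityI) auto
  have "wf_constrs ?\<Phi>"
    unfolding wf_constrs_def using npoly_respoly[of UNIV "rvar _"] by auto
  \<comment> \<open>The sizes are the variables themselves and \<open>P\<close> is the variable
    \<open>x\<close>; the side conditions on \<open>P\<close> are then exactly the constraints in
    \<open>?\<Phi>\<close>.\<close>
  then have "der w ?\<Phi> (map (\<lambda>l. (id l, Wform w (?ps l))) [0..<?n]) (Wform w (\<lambda>e. psub ?ps q0 e + rvar x e))
      (computes w f id ?n :: ('u, 'v) spec)"
    by (rule bounded_byD(2)[OF q0]) (auto simp: entails_def)
  then have "der w ?\<Phi> (map (\<lambda>l. (l, Wform w (?ps l))) [0..<?n]) (Wform w (\<lambda>e. q e + e x))
      (computes w f id ?n :: ('u, 'v) spec)"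
    by (simp add: q_def rvar_def)
  then show ?thesis
  proof (rule derE)
    fix \<pi>
    assume "qbal ?\<Phi> (map snd (map (\<lambda>l. (l, Wform w (?ps l))) [0..<?n])) (Wform w (\<lambda>e. q e + e x)) \<pi>"
    moreover assume sem: "\<And>(M :: ('u, 'v) ambient) \<rho> \<eta>. ambient_universe w M \<Longrightarrow>
      typed M \<rho> \<eta> (map (\<lambda>l. (l, Wform w (?ps l))) [0..<?n]) \<Longrightarrow>
      computes w f id ?n M \<rho> \<eta> (psem M \<rho> \<pi> (map (\<lambda>x. \<eta> (fst x)) (map (\<lambda>l. (l, Wform w (?ps l))) [0..<?n])))"
    have "psi w M (psem M \<rho> \<pi> (map (phi w M) ts)) = wordv M (f ts)"
      if "ambient_universe w M" "length ts = ?n" "set ts \<subseteq> words w" for M :: "('u, 'v) ambient" and \<rho> ts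
    proof -
      interpret ambient_universe w M by fact
      have rep: "wrep w M (ts ! l) (phi w M (ts ! l))" if "l < ?n" for l
        using that \<open>length ts = ?n\<close> \<open>set ts \<subseteq> words w\<close> by (intro wrep_phi) auto
      have "typed M \<rho> (\<lambda>l. phi w M (ts ! l)) (map (\<lambda>l. (l, Wform w (?ps l))) [0..<?n])"
        using rep by (auto simp: typed_def wrep_def)
      from sem[OF that(1) this] rep that(2)
      have "wrep w M (f ts) (psem M \<rho> \<pi> (map (\<lambda>l. phi w M (ts ! l)) [0..<?n]))"
        by (simp add: computes_def comp_def)
      moreover have "map (\<lambda>l. phi w M (ts ! l)) [0..<?n] = map (phi w M) ts"
        using that(2) by (intro nth_equalityI) auto
      ultimately show ?thesis by (simp add: psi_wrep)
    qed
    ultimately show ?thesis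
      using npoly_respoly[OF q] npoly_fvp[OF q] unfolding ctx by blast
  qed
qed

end
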